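(* Let $p\ge3$, let $\mathcal M$ be a Riemannian manifold with retraction $R$ and vector transport $\mathrm{VT}$, and let $f\in C^p(\mathcal M)$ be bounded below. Let $\{v_i\}_{i=0}^\infty$ be the set of increments generated by $p$-RAR. Suppose on the set $\{v_i\}_{i=0}^\infty$ that 1. (Functional assumptions) $f$ is $(L_1,p,R)$-majorization smooth, $(L_1,p,R,\mathrm{VT})$-smooth, and $(L_2,p,R,\mathrm{VT})$-second-order smooth; 2. (Retraction assumptions) $R$ is a second-order retraction; 3. (Transport assumptions) $\mathrm{VT}$ satisfies an $(r,b)$-short-step lower bound. If $p$-RAR enforces the Second-Order Model Optimality condition at every iteration, then it finds an $(\epsilon_1,\epsilon_2)$-second-order stationary point, i.e. $x\in\mathcal M$ with $\|\operatorname{grad}f(x)\|_x\le\epsilon_1$ and $\lambda_{\min}[\operatorname{Hess}f(x)]\ge-\epsilon_2$, in $$\mathcal O\left[\max\left\{\left(\frac{L_1}{\epsilon_1}\right)^{\frac{p+1}{p}},\left(\frac{L_2}{\epsilon_2}\right)^{\frac{p+1}{p-1}}\right\}\right]$$ total iterations and calls to the derivative oracles $\{x\mapsto D^k\hat f_x(0)\}_{k=0}^p$.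
   Context: Notation. $\pi:\mathcal T\mathcal M\to\mathcal M$ is the tangent bundle projection; $\|\cdot\|_x$ is the Riemannian norm on $\mathcal T_x\mathcal M$; $\|\cdot\|_{op}$ is the operator norm of multilinear maps. A retraction is a smooth map $R:\mathcal T\mathcal M\to\mathcal M$ with $R(0_x)=x$ and $d(R|_{\mathcal T_x\mathcal M})_{0_x}=\mathrm{Id}$ for all $x$; it is second-order if for all $s\in\mathcal T\mathcal M$ the curve $\gamma(t)=R(ts)$ has $\frac{D}{dt}\gamma'(t)|_{t=0}=0$. The pullback is $\hat f_x:=f\circ R|_{\mathcal T_x\mathcal M}$, with classical derivatives $D^j\hat f_x$. Put $T_p\hat f_x(0,v)=\sum_{j=0}^p\frac1{j!}D^j\hat f_x(0)[v^{\otimes j}]$; $T_{p-1}D\hat f_x(0,v)$ and $T_{p-2}D^2\hat f_x(0,v)$ are the Taylor expansions of $D\hat f_x$ and $D^2\hat f_x$ at $0$ of orders $p-1$ and $p-2$, evaluated at $v$; and $m_p(\alpha,x;v)=T_p\hat f_x(0,v)+\frac{\alpha}{p+1}\|v\|_x^{p+1}$. $\operatorname{grad}f$ and $\operatorname{Hess}f$ are the Riemannian gradient and Hessian; $\lambda_{\min}$ of a symmetric bilinear form or self-adjoint operator is its smallest eigenvalue. A vector transport $\mathrm{VT}$ (associated with $R$) is a smooth map assigning to each $u\in\mathcal T\mathcal M$ a linear map $\mathrm{VT}_u:\mathcal T_{\pi(u)}\mathcal M\to\mathcal T_{R(u)}\mathcal M$ with $\mathrm{VT}_{0_x}=\mathrm{Id}$.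 For a covariant $\ell$-tensor $T$ at $R(w)$, $(\mathrm{VT}_w)^*T(v_1,\dots,v_\ell)=T(\mathrm{VT}_wv_1,\dots,\mathrm{VT}_wv_\ell)$. Assumptions on a set $S\subseteq\mathcal T\mathcal M$: - $(L,p,R)$-majorization smooth: $\hat f_{\pi(v)}(v)\le T_p\hat f_{\pi(v)}(0,v)+\frac{L}{p+1}\|v\|^{p+1}$ for all $v\in S$. - $(L,p,R,\mathrm{VT})$-smooth: $\|(\mathrm{VT}_v)^*D\hat f_{R(v)}(0)-T_{p-1}D\hat f_{\pi(v)}(0,v)\|_{op}\le\frac{p}{p+1}L\|v\|^p$ for all $v\in S$. - $(L,p,R,\mathrm{VT})$-second-order smooth: $\|(\mathrm{VT}_v)^*D^2\hat f_{R(v)}(0)-T_{p-2}D^2\hat f_{\pi(v)}(0,v)\|_{op}\le\frac{p(p-1)}{p+1}L\|v\|^{p-1}$ for all $v\in S$. - $(r,b)$-short-step lower bound, for $r,b>0$: $\inf_{v\in S,\ \|v\|\le r}\sigma_{\min}(\mathrm{VT}_v)\ge b$ ($\sigma_{\min}$ = smallest singular value). Algorithm $p$-RAR ($p$-th order Riemannian Adaptive Regularization, second-order mode). Inputs: $x_0\in\mathcal M$, tolerances $\epsilon_1,\epsilon_2>0$, and parameters $\theta>0$, $\alpha_0>0$, $\alpha_{\min}\in(0,\alpha_0]$, $0<\eta_1\le\eta_2<1$, $0<\gamma_1<1<\gamma_2<\gamma_3$. For $i=0,1,2,\dots$: stop and return $x_i$ if $\|\operatorname{grad}f(x_i)\|_{x_i}\le\epsilon_1$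 and $\lambda_{\min}[\operatorname{Hess}f(x_i)]\ge-\epsilon_2$. Otherwise select $v_i\in\mathcal T_{x_i}\mathcal M$ with $m_p(\alpha_i,x_i;v_i)\le m_p(\alpha_i,x_i;0)$, $\|Dm_p(\alpha_i,x_i;v_i)\|_{op}\le\theta\|v_i\|_{x_i}^p$, and (Second-Order Model Optimality) $\lambda_{\min}(D^2m_p(\alpha_i,x_i;v_i))\ge-\theta\|v_i\|_{x_i}^{p-1}$ (derivatives in the tangent-vector variable). Compute $\rho_i=\frac{f(x_i)-f(R(v_i))}{f(x_i)-T_p\hat f_{x_i}(0,v_i)}$. Set $x_{i+1}=R(v_i)$ if $\rho_i\ge\eta_1$ and $x_{i+1}=x_i$ otherwise. Choose $\alpha_{i+1}\in[\max\{\alpha_{\min},\gamma_1\alpha_i\},\alpha_i]$ if $\rho_i\ge\eta_2$; $\alpha_{i+1}\in[\alpha_i,\gamma_2\alpha_i]$ if $\eta_1\le\rho_i<\eta_2$; $\alpha_{i+1}\in[\gamma_2\alpha_i,\gamma_3\alpha_i]$ if $\rho_i<\eta_1$. *)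

theory Defs
  imports "HOL-Analysis.Analysis"
begin

section \<open>Derivatives, Taylor polynomials and functions of class C^k\<close>

primrec Ck_on ::
  "nat \<Rightarrow> 'a::real_normed_vector set \<Rightarrow> ('a \<Rightarrow> 'b::real_normed_vector) \<Rightarrow> bool" where
  "Ck_on 0 S F \<longleftrightarrow> continuous_on S F"
| "Ck_on (Suc k) S F \<longleftrightarrow>
     (\<forall>x\<in>S. F differentiable (at x)) \<and> (\<forall>v. Ck_on k S (\<lambda>x. frechet_derivative F (at x) v))"

text \<open>Covariant tensors of order \<open>l\<close> are represented by functions on lists of length \<open>l\<close>:
  \<open>nderiv F [v\<^sub>1, \<dots>, v\<^sub>j] x\<close> is \<open>D\<^sup>jF(x)[v\<^sub>1, \<dots>, v\<^sub>j]\<close>, the last entry of the list being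
  differentiated first.\<close>

primrec nderiv ::
  "('a::real_normed_vector \<Rightarrow> 'b::real_normed_vector) \<Rightarrow> 'a list \<Rightarrow> 'a \<Rightarrow> 'b" where
  "nderiv F [] = F"
| "nderiv F (v # vs) = (\<lambda>x. frechet_derivative (nderiv F vs) (at x) v)"

text \<open>The Taylor expansion of \<open>F\<close> at 0 of order \<open>q\<close>, evaluated at \<open>v\<close>. The expansion of the
  tensor field \<open>D\<^sup>lF\<close> is taken entrywise: its value on a list \<open>us\<close> of length \<open>l\<close> is
  \<open>taylor q (nderiv F us) v\<close>.\<close>

definition taylor :: "nat \<Rightarrow> ('a::real_normed_vector \<Rightarrow> real) \<Rightarrow> 'a \<Rightarrow> real" where
  "taylor q F v = (\<Sum>j\<le>q. nderiv F (replicate j v) 0 / fact j)"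


section \<open>Smooth manifolds and their tangent bundles\<close>

text \<open>A chart is a pair of its domain and its coordinate map.\<close>

type_synonym ('m, 'e) chart = "'m set \<times> ('m \<Rightarrow> 'e)"

definition chart_inv :: "('m, 'e) chart \<Rightarrow> 'e \<Rightarrow> 'm" where
  "chart_inv c = inv_into (fst c) (snd c)"

definition is_chart :: "('m::topological_space, 'e::real_normed_vector) chart \<Rightarrow> bool" where
  "is_chart c \<longleftrightarrow> open (fst c) \<and> open (snd c ` fst c) \<and>
     homeomorphism (fst c) (snd c ` fst c) (snd c) (chart_inv c)"

definition Ck_map ::
  "nat \<Rightarrow> ('m, 'a::real_normed_vector) chart set \<Rightarrow> ('n, 'b::real_normed_vector) chart set
    \<Rightarrow> ('m \<Rightarrow> 'n) \<Rightarrow> bool" where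
  "Ck_map k A B F \<longleftrightarrow>
     (\<forall>x. \<exists>c\<in>A. \<exists>d\<in>B. \<exists>W. x \<in> fst c \<and> F x \<in> fst d \<and>
        open W \<and> snd c x \<in> W \<and> W \<subseteq> snd c ` fst c \<and> F ` chart_inv c ` W \<subseteq> fst d \<and>
        Ck_on k W (snd d \<circ> F \<circ> chart_inv c))"

definition smooth_map ::
  "('m, 'a::real_normed_vector) chart set \<Rightarrow> ('n, 'b::real_normed_vector) chart set
    \<Rightarrow> ('m \<Rightarrow> 'n) \<Rightarrow> bool" where
  "smooth_map A B F \<longleftrightarrow> (\<forall>k. Ck_map k A B F)"

definition real_atlas :: "(real, real) chart set" where
  "real_atlas = {(UNIV, id)}"

text \<open>The manifold is the whole type \<open>'m\<close>. Each point \<open>x\<close> carries a distinguished chart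
  \<open>base_chart M x\<close> of the atlas around it, whose differential identifies the tangent space at \<open>x\<close>
  with the model space \<open>'e\<close>. So a tangent vector is a pair \<open>(x, u)\<close> of type \<open>'m \<times> 'e\<close>, with \<open>u\<close>
  read in the coordinates of \<open>base_chart M x\<close>. As base charts vary with \<open>x\<close> without any
  continuity, smoothness on the tangent bundle is expressed through \<open>tangent_atlas\<close>, not through
  the product structure of \<open>'m \<times> 'e\<close>.\<close>

record ('m, 'e) riemannian =
  atlas :: "('m, 'e) chart set"
  base_chart :: "'m \<Rightarrow> ('m, 'e) chart"
  riem_metric :: "'m \<Rightarrow> 'e \<Rightarrow> 'e \<Rightarrow> real"

definition base_pt :: "('m, 'e) riemannian \<Rightarrow> 'm \<Rightarrow> 'e" where
  "base_pt M x = snd (base_chart M x) x"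

definition smooth_manifold ::
  "('m::{t2_space, second_countable_topology}, 'e::euclidean_space) riemannian \<Rightarrow> bool" where
  "smooth_manifold M \<longleftrightarrow>
     (\<forall>c\<in>atlas M. is_chart c) \<and>
     (\<forall>x. base_chart M x \<in> atlas M \<and> x \<in> fst (base_chart M x)) \<and>
     (\<forall>c\<in>atlas M. \<forall>d\<in>atlas M. \<forall>k. Ck_on k (snd c ` (fst c \<inter> fst d)) (snd d \<circ> chart_inv c))"

text \<open>The differential of a chart \<open>c\<close> at \<open>x\<close>, from the tangent space at \<open>x\<close> to \<open>'e\<close>, and the
  differential of the inverse chart at \<open>a\<close>, from \<open>'e\<close> to the tangent space at \<open>chart_inv c a\<close>.\<close>

definition dchart ::
  "('m, 'e::real_normed_vector) riemannian \<Rightarrow> ('m, 'e) chart \<Rightarrow> 'm \<Rightarrow> 'e \<Rightarrow> 'e" where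
  "dchart M c x = frechet_derivative (snd c \<circ> chart_inv (base_chart M x)) (at (base_pt M x))"

definition dchart_inv ::
  "('m, 'e::real_normed_vector) riemannian \<Rightarrow> ('m, 'e) chart \<Rightarrow> 'e \<Rightarrow> 'e \<Rightarrow> 'e" where
  "dchart_inv M c a =
     frechet_derivative (snd (base_chart M (chart_inv c a)) \<circ> chart_inv c) (at a)"

definition tangent_atlas ::
  "('m, 'e::real_normed_vector) riemannian \<Rightarrow> ('m \<times> 'e, 'e \<times> 'e) chart set" where
  "tangent_atlas M =
     (\<lambda>c. (fst c \<times> UNIV, \<lambda>(x, u). (snd c x, dchart M c x u))) ` atlas M"

text \<open>The atlas of the Whitney sum of the tangent bundle with itself.\<close>

definition tangent2_atlas ::
  "('m, 'e::real_normed_vector) riemannian \<Rightarrow> ('m \<times> 'e \<times> 'e, 'e \<times> 'e \<times> 'e) chart set" where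
  "tangent2_atlas M =
     (\<lambda>c. (fst c \<times> UNIV, \<lambda>(x, u, w). (snd c x, dchart M c x u, dchart M c x w))) ` atlas M"


section \<open>Riemannian geometry\<close>

definition riemannian_manifold ::
  "('m::{t2_space, second_countable_topology}, 'e::euclidean_space) riemannian \<Rightarrow> bool" where
  "riemannian_manifold M \<longleftrightarrow>
     smooth_manifold M \<and>
     (\<forall>x. bilinear (riem_metric M x)) \<and>
     (\<forall>x u w. riem_metric M x u w = riem_metric M x w u) \<and>
     (\<forall>x u. u \<noteq> 0 \<longrightarrow> 0 < riem_metric M x u u) \<and>
     smooth_map (tangent2_atlas M) real_atlas (\<lambda>(x, u, w). riem_metric M x u w)"

definition tnorm :: "('m, 'e) riemannian \<Rightarrow> 'm \<Rightarrow> 'e \<Rightarrow> real" where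
  "tnorm M x u = sqrt (riem_metric M x u u)"

definition op_norm :: "('m, 'e) riemannian \<Rightarrow> 'm \<Rightarrow> nat \<Rightarrow> ('e list \<Rightarrow> real) \<Rightarrow> real" where
  "op_norm M x l T =
     (SUP us \<in> {us. length us = l \<and> (\<forall>u\<in>set us. tnorm M x u \<le> 1)}. \<bar>T us\<bar>)"

text \<open>Smallest eigenvalue of a self-adjoint operator \<open>H\<close>, and of a symmetric bilinear form \<open>B\<close>
  relative to an inner product \<open>G\<close>.\<close>

definition lambda_min :: "('e::real_vector \<Rightarrow> 'e) \<Rightarrow> real" where
  "lambda_min H = Min {l. \<exists>u. u \<noteq> 0 \<and> H u = l *\<^sub>R u}"

definition lambda_min_form ::
  "('e::real_vector \<Rightarrow> 'e \<Rightarrow> real) \<Rightarrow> ('e \<Rightarrow> 'e \<Rightarrow> real) \<Rightarrow> real" where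
  "lambda_min_form G B = Min {l. \<exists>u. u \<noteq> 0 \<and> (\<forall>w. B u w = l * G u w)}"

text \<open>Smallest singular value of a linear map \<open>A\<close> from the tangent space at \<open>x\<close> to that at \<open>y\<close>:
  the form below is \<open>\<langle>A\<^sup>* A u, w\<rangle>\<close>.\<close>

definition sigma_min ::
  "('m, 'e::real_vector) riemannian \<Rightarrow> 'm \<Rightarrow> 'm \<Rightarrow> ('e \<Rightarrow> 'e) \<Rightarrow> real" where
  "sigma_min M x y A =
     sqrt (lambda_min_form (riem_metric M x) (\<lambda>u w. riem_metric M y (A u) (A w)))"

definition grad ::
  "('m, 'e::real_normed_vector) riemannian \<Rightarrow> ('m \<Rightarrow> real) \<Rightarrow> 'm \<Rightarrow> 'e" where
  "grad M f x = (THE w. \<forall>u. riem_metric M x w u =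
     frechet_derivative (f \<circ> chart_inv (base_chart M x)) (at (base_pt M x)) u)"

text \<open>The metric in the coordinates of the base chart at \<open>x\<close>, and the Christoffel map
  \<open>\<Gamma>(u, w) = \<Sum> \<Gamma>\<^sup>k\<^sub>i\<^sub>j u\<^sup>i w\<^sup>j \<partial>\<^sub>k\<close> of the Levi-Civita connection at \<open>x\<close> in these coordinates; the
  defining equation is \<open>2 g\<^sub>k\<^sub>l \<Gamma>\<^sup>k\<^sub>i\<^sub>j = \<partial>\<^sub>i g\<^sub>j\<^sub>l + \<partial>\<^sub>j g\<^sub>i\<^sub>l - \<partial>\<^sub>l g\<^sub>i\<^sub>j\<close>.\<close>

definition coord_metric ::
  "('m, 'e::real_normed_vector) riemannian \<Rightarrow> 'm \<Rightarrow> 'e \<Rightarrow> 'e \<Rightarrow> 'e \<Rightarrow> real" where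
  "coord_metric M x u w a =
     (let c = base_chart M x
      in riem_metric M (chart_inv c a) (dchart_inv M c a u) (dchart_inv M c a w))"

definition christoffel ::
  "('m, 'e::real_normed_vector) riemannian \<Rightarrow> 'm \<Rightarrow> 'e \<Rightarrow> 'e \<Rightarrow> 'e" where
  "christoffel M x u w = (THE y. \<forall>z. 2 * riem_metric M x y z =
       frechet_derivative (coord_metric M x w z) (at (base_pt M x)) u
     + frechet_derivative (coord_metric M x u z) (at (base_pt M x)) w
     - frechet_derivative (coord_metric M x u w) (at (base_pt M x)) z)"

text \<open>Levi-Civita covariant derivative at \<open>x\<close>, in direction \<open>u\<close>, of a vector field \<open>X\<close>.\<close>

definition cov_deriv ::
  "('m, 'e::real_normed_vector) riemannian \<Rightarrow> ('m \<Rightarrow> 'e) \<Rightarrow> 'm \<Rightarrow> 'e \<Rightarrow> 'e" where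
  "cov_deriv M X x u =
     frechet_derivative
       (\<lambda>a. let y = chart_inv (base_chart M x) a in dchart M (base_chart M x) y (X y))
       (at (base_pt M x)) u
     + christoffel M x u (X x)"

definition hess ::
  "('m, 'e::real_normed_vector) riemannian \<Rightarrow> ('m \<Rightarrow> real) \<Rightarrow> 'm \<Rightarrow> 'e \<Rightarrow> 'e" where
  "hess M f x u = cov_deriv M (grad M f) x u"

definition velocity ::
  "('m, 'e::real_normed_vector) riemannian \<Rightarrow> (real \<Rightarrow> 'm) \<Rightarrow> real \<Rightarrow> 'e" where
  "velocity M \<gamma> t = vector_derivative (snd (base_chart M (\<gamma> t)) \<circ> \<gamma>) (at t)"

text \<open>The covariant derivative \<open>D/dt\<close> of a vector field \<open>Y\<close> along the curve \<open>\<gamma>\<close>.\<close>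

definition cov_deriv_along ::
  "('m, 'e::real_normed_vector) riemannian \<Rightarrow> (real \<Rightarrow> 'm) \<Rightarrow> (real \<Rightarrow> 'e) \<Rightarrow> real \<Rightarrow> 'e" where
  "cov_deriv_along M \<gamma> Y t =
     vector_derivative (\<lambda>s. dchart M (base_chart M (\<gamma> t)) (\<gamma> s) (Y s)) (at t)
     + christoffel M (\<gamma> t) (velocity M \<gamma> t) (Y t)"


section \<open>Retractions and vector transports\<close>

definition manifold_retraction ::
  "('m, 'e::real_normed_vector) riemannian \<Rightarrow> ('m \<times> 'e \<Rightarrow> 'm) \<Rightarrow> bool" where
  "manifold_retraction M R \<longleftrightarrow>
     smooth_map (tangent_atlas M) (atlas M) R \<and>
     (\<forall>x. R (x, 0) = x) \<and>
     (\<forall>x. ((\<lambda>u. snd (base_chart M x) (R (x, u))) has_derivative id) (at 0))"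

definition second_order_retraction ::
  "('m, 'e::real_normed_vector) riemannian \<Rightarrow> ('m \<times> 'e \<Rightarrow> 'm) \<Rightarrow> bool" where
  "second_order_retraction M R \<longleftrightarrow>
     manifold_retraction M R \<and>
     (\<forall>x u. let \<gamma> = (\<lambda>t. R (x, t *\<^sub>R u)) in cov_deriv_along M \<gamma> (velocity M \<gamma>) 0 = 0)"

text \<open>Smoothness of \<open>VT\<close> is smoothness of the bundle map \<open>(x, u, w) \<mapsto> (R(x, u), VT\<^sub>(\<^sub>x\<^sub>,\<^sub>u\<^sub>) w)\<close>.\<close>

definition vector_transport ::
  "('m, 'e::real_normed_vector) riemannian \<Rightarrow> ('m \<times> 'e \<Rightarrow> 'm) \<Rightarrow> ('m \<times> 'e \<Rightarrow> 'e \<Rightarrow> 'e)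
    \<Rightarrow> bool" where
  "vector_transport M R VT \<longleftrightarrow>
     smooth_map (tangent2_atlas M) (tangent_atlas M) (\<lambda>(x, u, w). (R (x, u), VT (x, u) w)) \<and>
     (\<forall>s. linear (VT s)) \<and>
     (\<forall>x. VT (x, 0) = id)"

definition transport_pullback ::
  "('m \<times> 'e \<Rightarrow> 'e \<Rightarrow> 'e) \<Rightarrow> 'm \<times> 'e \<Rightarrow> ('e list \<Rightarrow> real) \<Rightarrow> 'e list \<Rightarrow> real" where
  "transport_pullback VT s T us = T (map (VT s) us)"

definition pullback :: "('m \<times> 'e \<Rightarrow> 'm) \<Rightarrow> ('m \<Rightarrow> real) \<Rightarrow> 'm \<Rightarrow> 'e \<Rightarrow> real" where
  "pullback R f x u = f (R (x, u))"


section \<open>Regularity assumptions on a set of tangent vectors\<close>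

definition majorization_smooth ::
  "('m, 'e::real_normed_vector) riemannian \<Rightarrow> ('m \<times> 'e \<Rightarrow> 'm) \<Rightarrow> real \<Rightarrow> nat \<Rightarrow> ('m \<Rightarrow> real)
    \<Rightarrow> ('m \<times> 'e) set \<Rightarrow> bool" where
  "majorization_smooth M R L p f S \<longleftrightarrow>
     (\<forall>(x, v)\<in>S. pullback R f x v
        \<le> taylor p (pullback R f x) v + L / (real p + 1) * tnorm M x v ^ (p + 1))"

definition transport_smooth ::
  "('m, 'e::real_normed_vector) riemannian \<Rightarrow> ('m \<times> 'e \<Rightarrow> 'm) \<Rightarrow> ('m \<times> 'e \<Rightarrow> 'e \<Rightarrow> 'e)
    \<Rightarrow> real \<Rightarrow> nat \<Rightarrow> ('m \<Rightarrow> real) \<Rightarrow> ('m \<times> 'e) set \<Rightarrow> bool" where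
  "transport_smooth M R VT L p f S \<longleftrightarrow>
     (\<forall>(x, v)\<in>S. op_norm M x 1
         (\<lambda>us. transport_pullback VT (x, v) (\<lambda>us. nderiv (pullback R f (R (x, v))) us 0) us
               - taylor (p - 1) (nderiv (pullback R f x) us) v)
        \<le> real p / (real p + 1) * L * tnorm M x v ^ p)"

definition transport_second_order_smooth ::
  "('m, 'e::real_normed_vector) riemannian \<Rightarrow> ('m \<times> 'e \<Rightarrow> 'm) \<Rightarrow> ('m \<times> 'e \<Rightarrow> 'e \<Rightarrow> 'e)
    \<Rightarrow> real \<Rightarrow> nat \<Rightarrow> ('m \<Rightarrow> real) \<Rightarrow> ('m \<times> 'e) set \<Rightarrow> bool" where
  "transport_second_order_smooth M R VT L p f S \<longleftrightarrow>
     (\<forall>(x, v)\<in>S. op_norm M x 2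
         (\<lambda>us. transport_pullback VT (x, v) (\<lambda>us. nderiv (pullback R f (R (x, v))) us 0) us
               - taylor (p - 2) (nderiv (pullback R f x) us) v)
        \<le> real p * (real p - 1) / (real p + 1) * L * tnorm M x v ^ (p - 1))"

definition short_step_lower_bound ::
  "('m, 'e::real_vector) riemannian \<Rightarrow> ('m \<times> 'e \<Rightarrow> 'm) \<Rightarrow> ('m \<times> 'e \<Rightarrow> 'e \<Rightarrow> 'e)
    \<Rightarrow> real \<Rightarrow> real \<Rightarrow> ('m \<times> 'e) set \<Rightarrow> bool" where
  "short_step_lower_bound M R VT r b S \<longleftrightarrow>
     ereal b \<le> (INF (x, v)\<in>{(x, v)\<in>S. tnorm M x v \<le> r}.
                  ereal (sigma_min M x (R (x, v)) (VT (x, v))))"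


section \<open>The algorithm\<close>

record rar_params =
  theta :: real
  alpha0 :: real
  alpha_min :: real
  eta1 :: real
  eta2 :: real
  gamma1 :: real
  gamma2 :: real
  gamma3 :: real

definition valid_params :: "rar_params \<Rightarrow> bool" where
  "valid_params P \<longleftrightarrow>
     0 < theta P \<and> 0 < alpha_min P \<and> alpha_min P \<le> alpha0 P \<and>
     0 < eta1 P \<and> eta1 P \<le> eta2 P \<and> eta2 P < 1 \<and>
     0 < gamma1 P \<and> gamma1 P < 1 \<and> 1 < gamma2 P \<and> gamma2 P < gamma3 P"

definition second_order_stationary ::
  "('m, 'e::real_normed_vector) riemannian \<Rightarrow> ('m \<Rightarrow> real) \<Rightarrow> real \<Rightarrow> real \<Rightarrow> 'm \<Rightarrow> bool" where
  "second_order_stationary M f \<epsilon>1 \<epsilon>2 x \<longleftrightarrow>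
     tnorm M x (grad M f x) \<le> \<epsilon>1 \<and> - \<epsilon>2 \<le> lambda_min (hess M f x)"

definition model ::
  "('m, 'e::real_normed_vector) riemannian \<Rightarrow> ('m \<times> 'e \<Rightarrow> 'm) \<Rightarrow> ('m \<Rightarrow> real) \<Rightarrow> nat
    \<Rightarrow> real \<Rightarrow> 'm \<Rightarrow> 'e \<Rightarrow> real" where
  "model M R f p a x v =
     taylor p (pullback R f x) v + a / (real p + 1) * tnorm M x v ^ (p + 1)"

definition rho ::
  "('m \<times> 'e::real_normed_vector \<Rightarrow> 'm) \<Rightarrow> ('m \<Rightarrow> real) \<Rightarrow> nat \<Rightarrow> 'm \<Rightarrow> 'e \<Rightarrow> real" where
  "rho R f p x v = (f x - f (R (x, v))) / (f x - taylor p (pullback R f x) v)"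

text \<open>A run is given by infinite sequences of iterates \<open>x\<close>, increments \<open>v\<close> and regularization
  parameters \<open>\<alpha>\<close>; once the stopping test has succeeded they are unconstrained and irrelevant.
  \<open>rar_active\<close> says that iteration \<open>i\<close> is reached and does not stop.\<close>

definition rar_active ::
  "('m, 'e::real_normed_vector) riemannian \<Rightarrow> ('m \<Rightarrow> real) \<Rightarrow> real \<Rightarrow> real \<Rightarrow> (nat \<Rightarrow> 'm)
    \<Rightarrow> nat \<Rightarrow> bool" where
  "rar_active M f \<epsilon>1 \<epsilon>2 x i \<longleftrightarrow> (\<forall>j\<le>i. \<not> second_order_stationary M f \<epsilon>1 \<epsilon>2 (x j))"

definition rar_select ::
  "('m, 'e::real_normed_vector) riemannian \<Rightarrow> ('m \<times> 'e \<Rightarrow> 'm) \<Rightarrow> ('m \<Rightarrow> real) \<Rightarrow> nat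
    \<Rightarrow> rar_params \<Rightarrow> real \<Rightarrow> 'm \<Rightarrow> 'e \<Rightarrow> bool" where
  "rar_select M R f p P a x v \<longleftrightarrow>
     (let m = model M R f p a x in
        m v \<le> m 0 \<and>
        op_norm M x 1 (\<lambda>us. nderiv m us v) \<le> theta P * tnorm M x v ^ p \<and>
        - theta P * tnorm M x v ^ (p - 1)
          \<le> lambda_min_form (riem_metric M x) (\<lambda>u w. nderiv m [u, w] v))"

definition rar_alpha_update :: "rar_params \<Rightarrow> real \<Rightarrow> real \<Rightarrow> real \<Rightarrow> bool" where
  "rar_alpha_update P \<rho> a a' \<longleftrightarrow>
     (if eta2 P \<le> \<rho> then a' \<in> {max (alpha_min P) (gamma1 P * a) .. a}
      else if eta1 P \<le> \<rho> then a' \<in> {a .. gamma2 P * a}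
      else a' \<in> {gamma2 P * a .. gamma3 P * a})"

definition rar_run ::
  "('m, 'e::real_normed_vector) riemannian \<Rightarrow> ('m \<times> 'e \<Rightarrow> 'm) \<Rightarrow> ('m \<Rightarrow> real) \<Rightarrow> nat
    \<Rightarrow> rar_params \<Rightarrow> real \<Rightarrow> real \<Rightarrow> 'm \<Rightarrow> (nat \<Rightarrow> 'm) \<Rightarrow> (nat \<Rightarrow> 'e) \<Rightarrow> (nat \<Rightarrow> real) \<Rightarrow> bool" where
  "rar_run M R f p P \<epsilon>1 \<epsilon>2 x0 x v \<alpha> \<longleftrightarrow>
     x 0 = x0 \<and> \<alpha> 0 = alpha0 P \<and>
     (\<forall>i. rar_active M f \<epsilon>1 \<epsilon>2 x i \<longrightarrow>
        rar_select M R f p P (\<alpha> i) (x i) (v i) \<and>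
        x (Suc i) = (if eta1 P \<le> rho R f p (x i) (v i) then R (x i, v i) else x i) \<and>
        rar_alpha_update P (rho R f p (x i) (v i)) (\<alpha> i) (\<alpha> (Suc i)))"

definition rar_increments ::
  "('m, 'e::real_normed_vector) riemannian \<Rightarrow> ('m \<Rightarrow> real) \<Rightarrow> real \<Rightarrow> real \<Rightarrow> (nat \<Rightarrow> 'm)
    \<Rightarrow> (nat \<Rightarrow> 'e) \<Rightarrow> ('m \<times> 'e) set" where
  "rar_increments M f \<epsilon>1 \<epsilon>2 x v = {(x i, v i) | i. rar_active M f \<epsilon>1 \<epsilon>2 x i}"

text \<open>The queries \<open>(k, y)\<close> to the oracles \<open>y \<mapsto> D\<^sup>k(f \<circ> R|\<^sub>y)(0)\<close> made by a run that passes
  \<open>N + 1\<close> times through the loop and stops at the stopping test of pass \<open>N\<close>. Every pass queries all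
  orders up to \<open>p\<close> at the current iterate, for the stopping test and the model, and a pass that does
  not stop also queries \<open>f\<close> at the trial point. Repeated queries at the same point, after a
  rejected step for example, are counted every time.\<close>

definition rar_queries ::
  "('m \<times> 'e \<Rightarrow> 'm) \<Rightarrow> nat \<Rightarrow> (nat \<Rightarrow> 'm) \<Rightarrow> (nat \<Rightarrow> 'e) \<Rightarrow> nat \<Rightarrow> (nat \<times> 'm) list" where
  "rar_queries R p x v N =
     concat (map (\<lambda>i. map (\<lambda>k. (k, x i)) [0..<p + 1] @ (if i < N then [(0, R (x i, v i))] else []))
       [0..<N + 1])"

text \<open>On the complexity bound \<open>O(max {(L1 / \<epsilon>1)\<^bsup>(p+1)/p\<^esup>, (L2 / \<epsilon>2)\<^bsup>(p+1)/(p-1)\<^esup>})\<close>: the hidden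
  constant must not depend on the tolerances. It cannot be uniform over all \<open>L1, L2 > 0\<close>, since
  \<open>\<alpha>\<^sub>i\<close> may reach the order of \<open>max {alpha0, L1}\<close> and enters the lower bounds for the step lengths
  next to \<open>L1\<close> and \<open>L2\<close>. It is therefore allowed to depend on \<open>L1\<close> and \<open>L2\<close>, but only through a
  positive lower bound \<open>\<kappa>\<close> of \<open>L1\<close> and \<open>L2 / L1\<close>; any given \<open>L1, L2 > 0\<close> admit such a \<open>\<kappa>\<close>.
  The bound is asymptotic for small tolerances and tends to 0 when both of them grow, so the
  tolerances are bounded by an arbitrary \<open>\<epsilon>max\<close>, which has to bound only one of them.\<close>

end

theory Submission
  imports Defs
begin

text \<open>Since \<open>R\<close> is second-order, \<open>D\<^sup>2(f \<circ> R\<^sub>x)(0)\<close> is the Riemannian Hessian at \<open>x\<close>: the second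
  derivative of \<open>R\<^sub>x\<close> in the base chart is \<open>-\<Gamma>(u,u)\<close>, exactly the Christoffel term of the Hessian.
  So after an accepted step \<open>v\<close> with \<open>\<parallel>v\<parallel> \<le> r\<close>, transport smoothness, the optimality conditions of the
  model and invertibility of the transport bound the gradient at \<open>R(v)\<close> by \<open>O(L\<^sub>1 \<parallel>v\<parallel>\<^sup>p)\<close> and the
  negative curvature there by \<open>O(L\<^sub>2 \<parallel>v\<parallel>\<^bsup>p-1\<^esup>)\<close>, because majorization keeps \<open>\<alpha>\<close> at \<open>O(L\<^sub>1)\<close>. If
  \<open>R(v)\<close> is not stationary, \<open>v\<close> is therefore long, and the decrease of \<open>f\<close>, at least a multiple of
  \<open>\<parallel>v\<parallel>\<^bsup>p+1\<^esup>\<close>, is at least a multiple of the inverse of the claimed bound. This limits the accepted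
  steps; every rejected step multiplies \<open>\<alpha>\<close> by at least \<open>\<gamma>\<^sub>2\<close>, so the upper bound on \<open>\<alpha>\<close> limits the
  rejected ones.\<close>

section \<open>Functions of class C^k and Taylor polynomials\<close>

text \<open>The chosen notions create three obstacles. \<open>Ck_on\<close> and
  \<open>nderiv\<close> differentiate along fixed directions, so chain rules have to be expanded in
  a basis, and higher derivatives must be known to be symmetric before a Taylor polynomial can be
  differentiated in its argument. The gradient at each point is defined in that point's own base
  chart, and these charts vary without continuity; differentiability of the gradient field in one
  chart is extracted from the linear equation that it solves there. \<open>Min\<close> and
  \<open>SUP\<close> in eigenvalues and operator norms are meaningful only once finiteness and
  boundedness are known. The constant must serve all manifolds and all \<open>L1\<close>,
  \<open>L2\<close> with \<kappa> \<le> L1 and \<kappa> L1 \<le> L2. These bounds turn \<alpha> and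
  \<open>theta P\<close> into multiples of \<open>L1\<close> or \<open>L2\<close> and, with
  \<open>\<epsilon>max\<close>, keep the claimed maximum above a fixed multiple of
  \<open>L1\<close>. This absorbs additive constants, the logarithm of \<open>L1\<close> due to
  rejected steps, and the accepted steps longer than \<open>r\<close>: the transport bound is silent
  about them, but they decrease f by a fixed amount.\<close>

lemma differentiable_has_frechet:
  "F differentiable (at x) \<Longrightarrow> (F has_derivative frechet_derivative F (at x)) (at x)"
  by (simp add: frechet_derivative_works)

lemma frechet_eqI: "(F has_derivative F') (at x) \<Longrightarrow> frechet_derivative F (at x) = F'"
  by (rule frechet_derivative_at[symmetric])

text \<open>Both sides are the same choice from the same set of derivatives, so the equation also
  holds where neither function is differentiable.\<close>

lemma frechet_derivative_cong_open:
  assumes "open S" "x \<in> S" "\<And>y. y \<in> S \<Longrightarrow> F y = G y"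
  shows "frechet_derivative F (at x) = frechet_derivative G (at x)"
proof -
  have "(F has_derivative F') (at x) \<longleftrightarrow> (G has_derivative F') (at x)" for F'
    using assms has_derivative_transform_within_open[of F F' x UNIV S G]
      has_derivative_transform_within_open[of G F' x UNIV S F] by metis
  then show ?thesis
    by (simp add: frechet_derivative_def)
qed

lemma differentiable_cong_open:
  assumes "open S" "x \<in> S" "\<And>y. y \<in> S \<Longrightarrow> F y = G y" "F differentiable (at x)"
  shows "G differentiable (at x)"
  using assms has_derivative_transform_within_open unfolding differentiable_def by metis

lemma Ck_on_cong:
  assumes "open S" "\<And>x. x \<in> S \<Longrightarrow> F x = G x" "Ck_on k S F"
  shows "Ck_on k S G"
  using assms(2,3)
proof (induction k arbitrary: F G)
  case 0
  then show ?case using continuous_on_cong by force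
next
  case (Suc k)
  have "G differentiable (at x)" if "x \<in> S" for x
    using differentiable_cong_open[OF assms(1) that] Suc.prems that by auto
  moreover have "Ck_on k S (\<lambda>x. frechet_derivative G (at x) v)" for v
  proof (rule Suc.IH)
    show "Ck_on k S (\<lambda>x. frechet_derivative F (at x) v)" using Suc.prems by simp
    show "frechet_derivative F (at x) v = frechet_derivative G (at x) v" if "x \<in> S" for x
      using frechet_derivative_cong_open[OF assms(1) that, of F G] Suc.prems(1) by simp
  qed
  ultimately show ?case by simp
qed

lemma Ck_on_subset: "Ck_on k S F \<Longrightarrow> T \<subseteq> S \<Longrightarrow> Ck_on k T F"
  by (induction k arbitrary: F) (auto intro: continuous_on_subset)

lemma Ck_on_imp_continuous: "Ck_on k S F \<Longrightarrow> continuous_on S F"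
  by (cases k) (simp, simp only: Ck_on.simps(2), blast intro: continuous_at_imp_continuous_on differentiable_imp_continuous_within)

lemma Ck_on_Suc_imp: "Ck_on (Suc k) S F \<Longrightarrow> Ck_on k S F"
proof (induction k arbitrary: F)
  case 0
  then show ?case using Ck_on_imp_continuous[OF 0] by simp
next
  case (Suc k)
  from Suc.prems have "\<forall>v. Ck_on (Suc k) S (\<lambda>x. frechet_derivative F (at x) v)"
    unfolding Ck_on.simps(2)[of "Suc k"] by blast
  with Suc show ?case
    unfolding Ck_on.simps(2)[of k] Ck_on.simps(2)[of "Suc k"] by blast
qed

lemma Ck_on_mono: "Ck_on k S F \<Longrightarrow> l \<le> k \<Longrightarrow> Ck_on l S F"
proof (induction k)
  case (Suc k)
  then show ?case using Ck_on_Suc_imp le_Suc_eq by blast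
qed simp

lemma Ck_on_const: "Ck_on k S (\<lambda>x. c)"
  by (induction k arbitrary: c) auto

lemma Ck_on_bounded_linear:
  assumes "open S" "bounded_linear A"
  shows "Ck_on k S F \<Longrightarrow> Ck_on k S (\<lambda>x. A (F x))"
proof (induction k arbitrary: F)
  case 0
  then show ?case using bounded_linear.continuous_on[OF assms(2)] by auto
next
  case (Suc k)
  have d: "((\<lambda>x. A (F x)) has_derivative (\<lambda>h. A (frechet_derivative F (at x) h))) (at x)"
    if "x \<in> S" for x
    by (rule bounded_linear.has_derivative[OF assms(2) differentiable_has_frechet])
      (use Suc.prems that in simp)
  have "Ck_on k S (\<lambda>x. A (frechet_derivative F (at x) v))" for v
    using Suc by auto
  then have "Ck_on k S (\<lambda>x. frechet_derivative (\<lambda>x. A (F x)) (at x) v)" for v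
    by (rule Ck_on_cong[OF assms(1), rotated]) (simp add: frechet_eqI[OF d])
  then show ?case using d by (auto simp: differentiable_def)
qed

lemma Ck_on_add:
  assumes "open S"
  shows "Ck_on k S F \<Longrightarrow> Ck_on k S G \<Longrightarrow> Ck_on k S (\<lambda>x. F x + G x)"
proof (induction k arbitrary: F G)
  case 0
  then show ?case by (auto intro: continuous_on_add)
next
  case (Suc k)
  have d: "((\<lambda>x. F x + G x) has_derivative
      (\<lambda>h. frechet_derivative F (at x) h + frechet_derivative G (at x) h)) (at x)"
    if "x \<in> S" for x
    using Suc.prems that by (auto intro!: has_derivative_add differentiable_has_frechet)
  have "Ck_on k S (\<lambda>x. frechet_derivative F (at x) v + frechet_derivative G (at x) v)" for v
    using Suc by auto
  then have "Ck_on k S (\<lambda>x. frechet_derivative (\<lambda>x. F x + G x) (at x) v)" for v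
    by (rule Ck_on_cong[OF assms(1), rotated]) (simp add: frechet_eqI[OF d])
  then show ?case using d by (auto simp: differentiable_def)
qed

lemma Ck_on_sum:
  assumes "open S" "\<And>i. i \<in> I \<Longrightarrow> Ck_on k S (F i)"
  shows "Ck_on k S (\<lambda>x. \<Sum>i\<in>I. F i x)"
  using assms(2) by (induction I rule: infinite_finite_induct) (auto intro: Ck_on_const Ck_on_add[OF assms(1)])

lemma Ck_on_scaleR:
  fixes F :: "'a::real_normed_vector \<Rightarrow> real" and G :: "'a \<Rightarrow> 'b::real_normed_vector"
  assumes "open S"
  shows "Ck_on k S F \<Longrightarrow> Ck_on k S G \<Longrightarrow> Ck_on k S (\<lambda>x. F x *\<^sub>R G x)"
proof (induction k arbitrary: F G)
  case 0
  then show ?case by (auto intro: continuous_on_scaleR)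
next
  case (Suc k)
  have d: "((\<lambda>x. F x *\<^sub>R G x) has_derivative
      (\<lambda>h. F x *\<^sub>R frechet_derivative G (at x) h + frechet_derivative F (at x) h *\<^sub>R G x)) (at x)"
    if "x \<in> S" for x
    using Suc.prems that by (auto intro!: has_derivative_scaleR differentiable_has_frechet)
  have "Ck_on k S (\<lambda>x. F x *\<^sub>R frechet_derivative G (at x) v + frechet_derivative F (at x) v *\<^sub>R G x)" for v
    using Suc.IH Suc.prems Ck_on_Suc_imp[OF Suc.prems(1)] Ck_on_Suc_imp[OF Suc.prems(2)]
    by (intro Ck_on_add[OF assms]) auto
  then have "Ck_on k S (\<lambda>x. frechet_derivative (\<lambda>x. F x *\<^sub>R G x) (at x) v)" for v
    by (rule Ck_on_cong[OF assms(1), rotated]) (simp add: frechet_eqI[OF d])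
  then show ?case using d by (auto simp: differentiable_def)
qed

text \<open>Turns a derivative applied to a varying direction into a finite sum of products of
  scalar coordinates with derivatives along fixed directions.\<close>

lemma linear_euclidean_sum:
  fixes u :: "'a::euclidean_space"
  assumes "linear A"
  shows "A u = (\<Sum>b\<in>Basis. (u \<bullet> b) *\<^sub>R A b)"
proof -
  have "A u = A (\<Sum>b\<in>Basis. (u \<bullet> b) *\<^sub>R b)" by (simp add: euclidean_representation)
  also have "\<dots> = (\<Sum>b\<in>Basis. (u \<bullet> b) *\<^sub>R A b)"
    using assms by (simp add: linear_sum linear_scale)
  finally show ?thesis .
qed

text \<open>In the chain rule the derivative of G is applied to a direction that varies with x,
  which \<open>Ck_on\<close> does not cover. Expanding that direction in the basis of the
  intermediate space leaves sums and products, for which regularity is inherited.\<close>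

lemma Ck_on_compose:
  fixes F :: "'a::real_normed_vector \<Rightarrow> 'b::euclidean_space"
    and G :: "'b \<Rightarrow> 'c::real_normed_vector"
  assumes "open S" "F ` S \<subseteq> T"
  shows "Ck_on k S F \<Longrightarrow> Ck_on k T G \<Longrightarrow> Ck_on k S (G \<circ> F)"
proof (induction k arbitrary: G)
  case 0
  then show ?case using assms by (simp only: Ck_on.simps) (blast intro: continuous_on_compose continuous_on_subset)
next
  case (Suc k)
  let ?DF = "\<lambda>x. frechet_derivative F (at x)" and ?DG = "\<lambda>y. frechet_derivative G (at y)"
  have d: "((G \<circ> F) has_derivative (?DG (F x) \<circ> ?DF x)) (at x)"
    if "x \<in> S" for x
    using Suc.prems that assms(2)
    by (intro diff_chain_at differentiable_has_frechet) auto
  have eq: "frechet_derivative (G \<circ> F) (at x) v = (\<Sum>b\<in>Basis. (?DF x v \<bullet> b) *\<^sub>R ?DG (F x) b)"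
    if "x \<in> S" for x v
    unfolding frechet_eqI[OF d[OF that]] o_apply
    using that Suc.prems(2) assms(2) by (intro linear_euclidean_sum linear_frechet_derivative) auto
  have "Ck_on k S (\<lambda>x. \<Sum>b\<in>Basis. (?DF x v \<bullet> b) *\<^sub>R ?DG (F x) b)" for v
  proof (intro Ck_on_sum Ck_on_scaleR assms)
    show "Ck_on k S (\<lambda>x. ?DF x v \<bullet> b)" for b
      using Suc.prems(1) by (intro Ck_on_bounded_linear[OF assms(1) bounded_linear_inner_left]) auto
    show "Ck_on k S (\<lambda>x. ?DG (F x) b)" for b
      using Suc.IH[of "\<lambda>y. ?DG y b"] Suc.prems Ck_on_Suc_imp[OF Suc.prems(1)] by (auto simp: o_def)
  qed
  then have "Ck_on k S (\<lambda>x. frechet_derivative (G \<circ> F) (at x) v)" for v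
    by (rule Ck_on_cong[OF assms(1), rotated]) (simp add: eq)
  then show ?case using d unfolding Ck_on.simps differentiable_def by blast
qed

lemma Ck_on_affine:
  assumes "open S" "bounded_linear A"
  shows "Ck_on k S (\<lambda>x. c + A x)"
proof -
  have "Ck_on k S (\<lambda>x. x)"
    by (cases k) (auto intro: Ck_on_const)
  from Ck_on_add[OF assms(1) Ck_on_const Ck_on_bounded_linear[OF assms this]]
  show ?thesis .
qed

section \<open>Iterated derivatives and their symmetry\<close>

lemma nderiv_append: "nderiv F (us @ vs) = nderiv (nderiv F vs) us"
  by (induction us) auto

lemma Ck_on_nderiv: "Ck_on (length us + k) S F \<Longrightarrow> Ck_on k S (nderiv F us)"
proof (induction us arbitrary: k)
  case (Cons u us)
  then have "Ck_on (Suc k) S (nderiv F us)"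
    by (metis add_Suc_shift length_Cons)
  then show ?case by simp
qed simp

lemma Ck_on_nderiv': "Ck_on n S F \<Longrightarrow> length us + k \<le> n \<Longrightarrow> Ck_on k S (nderiv F us)"
  using Ck_on_nderiv Ck_on_mono by blast

lemma nderiv_differentiable:
  assumes "Ck_on n S F" "length us < n" "x \<in> S"
  shows "nderiv F us differentiable (at x)"
proof -
  have "Ck_on (Suc 0) S (nderiv F us)"
    by (rule Ck_on_nderiv'[OF assms(1)]) (use assms in auto)
  with assms show ?thesis by simp
qed

lemma mean_value_line:
  fixes F :: "'a::real_normed_vector \<Rightarrow> real"
  assumes "0 < t" "\<And>s. 0 \<le> s \<Longrightarrow> s \<le> t \<Longrightarrow> F differentiable (at (y + s *\<^sub>R w))"
  shows "\<exists>s\<in>{0<..<t}. F (y + t *\<^sub>R w) - F y = t * frechet_derivative F (at (y + s *\<^sub>R w)) w"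
proof -
  let ?h = "\<lambda>s. F (y + s *\<^sub>R w)"
  have d: "(?h has_derivative (\<lambda>h. h * frechet_derivative F (at (y + s *\<^sub>R w)) w)) (at s)"
    if "0 \<le> s" "s \<le> t" for s
  proof -
    have D: "(F has_derivative frechet_derivative F (at (y + s *\<^sub>R w))) (at (y + s *\<^sub>R w))"
      using assms(2)[OF that] differentiable_has_frechet by blast
    have "(?h has_derivative (\<lambda>h. frechet_derivative F (at (y + s *\<^sub>R w)) (h *\<^sub>R w))) (at s)"
      by (rule has_derivative_compose[where g = F and f = "\<lambda>s. y + s *\<^sub>R w", OF _ D]) (auto intro!: derivative_eq_intros)
    then show ?thesis
      using linear_scale[OF linear_frechet_derivative[OF assms(2)[OF that]]] by simp
  qed
  have "\<exists>s\<in>{0<..<t}. ?h t - ?h 0 = (\<lambda>h. h * frechet_derivative F (at (y + s *\<^sub>R w)) w) (t - 0)"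
  proof (rule mvt_simple)
    show "0 < t" by fact
  next
    fix s assume "0 \<le> s" "s \<le> t"
    then show "(?h has_derivative (\<lambda>h. h * frechet_derivative F (at (y + s *\<^sub>R w)) w)) (at s within {0..t})"
      using has_derivative_at_withinI[OF d] by auto
  qed
  then show ?thesis by simp
qed

text \<open>The second difference below is symmetric in \<open>u\<close> and \<open>w\<close>, so its rescaled limit is the second
  derivative in either order.\<close>

lemma second_difference_mean_value:
  fixes F :: "'a::real_normed_vector \<Rightarrow> real"
  assumes "0 < t" and S: "\<And>s s'. 0 \<le> s \<Longrightarrow> s \<le> t \<Longrightarrow> 0 \<le> s' \<Longrightarrow> s' \<le> t \<Longrightarrow> x + s *\<^sub>R u + s' *\<^sub>R w \<in> S"
    and "Ck_on 2 S F"
  shows "\<exists>s\<in>{0<..<t}. \<exists>s'\<in>{0<..<t}.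
    F (x + t *\<^sub>R u + t *\<^sub>R w) - F (x + t *\<^sub>R u) - F (x + t *\<^sub>R w) + F x
      = t * t * nderiv F [w, u] (x + s *\<^sub>R u + s' *\<^sub>R w)"
proof -
  have dF: "F differentiable (at z)" if "z \<in> S" for z
    using nderiv_differentiable[OF assms(3), of "[]"] that by simp
  have dF1: "nderiv F [u] differentiable (at z)" if "z \<in> S" for z
    using nderiv_differentiable[OF assms(3), of "[u]"] that by simp
  \<comment> \<open>The mean value theorem is used twice: for this increment in direction
    \<open>w\<close>, regarded as a function along \<open>u\<close>, and then for
    \<open>nderiv F [u]\<close> along \<open>w\<close>.\<close>
  define K where "K = (\<lambda>z. F (z + t *\<^sub>R w) - F z)"
  have K: "(K has_derivative (\<lambda>h. frechet_derivative F (at (z + t *\<^sub>R w)) h - frechet_derivative F (at z) h)) (at z)"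
    if "z \<in> S" "z + t *\<^sub>R w \<in> S" for z
    unfolding K_def
  proof (intro has_derivative_diff)
    show "((\<lambda>z. F (z + t *\<^sub>R w)) has_derivative frechet_derivative F (at (z + t *\<^sub>R w))) (at z)"
      by (rule has_derivative_compose[where g = F and f = "\<lambda>z. z + t *\<^sub>R w", OF _ differentiable_has_frechet[OF dF[OF that(2)]]])
        (auto intro!: derivative_eq_intros)
  qed (simp add: differentiable_has_frechet dF that)
  have "\<exists>s\<in>{0<..<t}. K (x + t *\<^sub>R u) - K x = t * frechet_derivative K (at (x + s *\<^sub>R u)) u"
  proof (rule mean_value_line[OF assms(1)])
    fix s assume "0 \<le> s" "s \<le> t"
    then show "K differentiable (at (x + s *\<^sub>R u))"
      using K S[of s 0] S[of s t] assms(1) by (auto simp: differentiable_def)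
  qed
  then obtain s where s: "s \<in> {0<..<t}"
    "K (x + t *\<^sub>R u) - K x = t * frechet_derivative K (at (x + s *\<^sub>R u)) u" by blast
  have eq: "frechet_derivative K (at (x + s *\<^sub>R u)) u
    = nderiv F [u] (x + s *\<^sub>R u + t *\<^sub>R w) - nderiv F [u] (x + s *\<^sub>R u)"
    using frechet_eqI[OF K[of "x + s *\<^sub>R u"]] S[of s 0] S[of s t] assms(1) s(1) by simp
  have "\<exists>s'\<in>{0<..<t}. nderiv F [u] (x + s *\<^sub>R u + t *\<^sub>R w) - nderiv F [u] (x + s *\<^sub>R u)
      = t * frechet_derivative (nderiv F [u]) (at (x + s *\<^sub>R u + s' *\<^sub>R w)) w"
    using s(1) by (intro mean_value_line[OF assms(1)] dF1 S) auto
  then obtain s' where "s' \<in> {0<..<t}" "nderiv F [u] (x + s *\<^sub>R u + t *\<^sub>R w) - nderiv F [u] (x + s *\<^sub>R u)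
      = t * nderiv F [w, u] (x + s *\<^sub>R u + s' *\<^sub>R w)" by auto
  with s eq show ?thesis
    by (intro bexI[of _ s] bexI[of _ s']) (auto simp: K_def)
qed

lemma second_difference_limit:
  fixes F :: "'a::real_normed_vector \<Rightarrow> real"
  assumes "open S" "x \<in> S" "Ck_on 2 S F"
  shows "((\<lambda>t. (F (x + t *\<^sub>R u + t *\<^sub>R w) - F (x + t *\<^sub>R u) - F (x + t *\<^sub>R w) + F x) / (t * t))
    \<longlongrightarrow> nderiv F [w, u] x) (at_right 0)"
proof (rule tendstoI)
  fix e :: real assume "0 < e"
  have "Ck_on 0 S (nderiv F [w, u])" by (rule Ck_on_nderiv'[OF assms(3)]) simp
  then have "isCont (nderiv F [w, u]) x"
    using assms(1,2) by (simp add: continuous_on_eq_continuous_at)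
  then obtain d1 where d1: "d1 > 0" "\<And>z. dist z x < d1 \<Longrightarrow> dist (nderiv F [w, u] z) (nderiv F [w, u] x) < e"
    using \<open>0 < e\<close> unfolding continuous_at_eps_delta by blast
  obtain d2 where d2: "d2 > 0" "ball x d2 \<subseteq> S"
    using assms(1,2) openE by blast
  define d where "d = min d1 d2"
  have "0 < d" using d1 d2 by (simp add: d_def)
  \<comment> \<open>For t below \<open>q\<close> the whole parallelogram spanned by t u and t w
    stays within distance \<open>d\<close> of \<open>x\<close>; the summand 1 keeps the quotient
    defined when both directions vanish.\<close>
  define q where "q = d / (norm u + norm w + 1)"
  have q: "0 < q" using \<open>0 < d\<close> by (simp add: q_def add_nonneg_pos)
  have near: "dist (x + s *\<^sub>R u + s' *\<^sub>R w) x < d" if "0 \<le> s" "s \<le> t" "0 \<le> s'" "s' \<le> t" "t < q" "0 < t" for s s' t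
  proof -
    have "dist (x + s *\<^sub>R u + s' *\<^sub>R w) x = norm (s *\<^sub>R u + s' *\<^sub>R w)"
      by (simp add: dist_norm algebra_simps)
    also have "\<dots> \<le> s * norm u + s' * norm w"
      using norm_triangle_ineq[of "s *\<^sub>R u" "s' *\<^sub>R w"] that by simp
    also have "\<dots> \<le> t * norm u + t * norm w"
      using that by (intro add_mono mult_right_mono) auto
    also have "\<dots> \<le> t * (norm u + norm w + 1)" using that by (simp add: algebra_simps)
    also have "\<dots> < q * (norm u + norm w + 1)"
      using that by (intro mult_strict_right_mono) (auto simp: add_nonneg_pos)
    also have "\<dots> = d" by (simp add: q_def add_nonneg_eq_0_iff)
    finally show ?thesis .
  qed
  have "dist ((F (x + t *\<^sub>R u + t *\<^sub>R w) - F (x + t *\<^sub>R u) - F (x + t *\<^sub>R w) + F x) / (t * t))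
      (nderiv F [w, u] x) < e" if "0 < t" "t < q" for t
  proof -
    have "x + s *\<^sub>R u + s' *\<^sub>R w \<in> S" if "0 \<le> s" "s \<le> t" "0 \<le> s'" "s' \<le> t" for s s'
      using near[OF that \<open>t < q\<close> \<open>0 < t\<close>] d2(2) by (auto simp: d_def dist_commute)
    from second_difference_mean_value[OF \<open>0 < t\<close> this assms(3)]
    obtain s s' where s: "s \<in> {0<..<t}" "s' \<in> {0<..<t}"
      and eq: "F (x + t *\<^sub>R u + t *\<^sub>R w) - F (x + t *\<^sub>R u) - F (x + t *\<^sub>R w) + F x
        = t * t * nderiv F [w, u] (x + s *\<^sub>R u + s' *\<^sub>R w)" by blast
    have "dist (x + s *\<^sub>R u + s' *\<^sub>R w) x < d1"
      using near[of s t s'] s that by (auto simp: d_def)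
    with d1(2) show ?thesis unfolding eq using that by simp
  qed
  then show "\<forall>\<^sub>F t in at_right 0. dist ((F (x + t *\<^sub>R u + t *\<^sub>R w) - F (x + t *\<^sub>R u) - F (x + t *\<^sub>R w) + F x) / (t * t))
      (nderiv F [w, u] x) < e"
    unfolding eventually_at_right_field using q by auto
qed

lemma second_derivative_symmetric:
  fixes F :: "'a::real_normed_vector \<Rightarrow> real"
  assumes "open S" "x \<in> S" "Ck_on 2 S F"
  shows "nderiv F [u, w] x = nderiv F [w, u] x"
proof -
  have "((\<lambda>t. (F (x + t *\<^sub>R u + t *\<^sub>R w) - F (x + t *\<^sub>R u) - F (x + t *\<^sub>R w) + F x) / (t * t))
    \<longlongrightarrow> nderiv F [u, w] x) (at_right 0)"
    using second_difference_limit[OF assms, of w u] by (simp add: algebra_simps)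
  from tendsto_unique[OF _ this second_difference_limit[OF assms, of u w]]
  show ?thesis by simp
qed

lemma nderiv_swap:
  fixes F :: "'a::real_normed_vector \<Rightarrow> real"
  assumes "open S" "x \<in> S" "Ck_on n S F" "length us + 2 \<le> n"
  shows "nderiv F (u # w # us) x = nderiv F (w # u # us) x"
  using second_derivative_symmetric[OF assms(1,2) Ck_on_nderiv'[OF assms(3,4)], of u w] by simp

lemma nderiv_move_front:
  fixes F :: "'a::real_normed_vector \<Rightarrow> real"
  assumes "open S" "Ck_on n S F"
  shows "x \<in> S \<Longrightarrow> length us \<le> n \<Longrightarrow> u \<in> set us \<Longrightarrow> nderiv F us x = nderiv F (u # remove1 u us) x"
proof (induction us arbitrary: x)
  case (Cons w us)
  show ?case
  proof (cases "u = w")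
    case False
    then have u: "u \<in> set us" using Cons.prems by auto
    have "nderiv F (w # us) x = nderiv F (w # u # remove1 u us) x"
      unfolding nderiv.simps(2)[of F w]
      using Cons u frechet_derivative_cong_open[OF assms(1) Cons.prems(1), of "nderiv F us" "nderiv F (u # remove1 u us)"]
      by auto
    also have "\<dots> = nderiv F (u # w # remove1 u us) x"
      using Cons.prems u False length_pos_if_in_set[OF u]
      by (intro nderiv_swap[OF assms(1) _ assms(2)]) (auto simp: length_remove1)
    finally show ?thesis using False by simp
  qed simp
qed simp

text \<open>Needed because differentiating a Taylor polynomial puts the new direction in front of
  the repeated ones, whereas the expansion of the differentiated function has it behind
  them.\<close>

lemma nderiv_perm:
  fixes F :: "'a::real_normed_vector \<Rightarrow> real"
  assumes "open S" "Ck_on n S F"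
  shows "x \<in> S \<Longrightarrow> length us \<le> n \<Longrightarrow> mset us = mset vs \<Longrightarrow> nderiv F us x = nderiv F vs x"
proof (induction us arbitrary: vs x)
  case (Cons u us)
  have u: "u \<in> set vs" using Cons.prems(3) by (metis list.set_intros(1) mset_eq_setD)
  have l: "length vs \<le> n" using Cons.prems mset_eq_length by fastforce
  have "nderiv F us y = nderiv F (remove1 u vs) y" if "y \<in> S" for y
    using Cons.prems that u by (intro Cons.IH) (auto, metis add_mset_remove_trivial)
  then have "nderiv F (u # us) x = nderiv F (u # remove1 u vs) x"
    using frechet_derivative_cong_open[OF assms(1) Cons.prems(1), of "nderiv F us" "nderiv F (remove1 u vs)"]
    by simp
  then show ?case using nderiv_move_front[OF assms Cons.prems(1) l u] by simp
qed simp

lemma nderiv_linear_head: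
  assumes "Ck_on n S F" "length us < n" "x \<in> S"
  shows "linear (\<lambda>u. nderiv F (u # us) x)"
  using linear_frechet_derivative[OF nderiv_differentiable[OF assms]] by simp

section \<open>Derivatives of Taylor polynomials in their argument\<close>

context
  fixes F :: "'a::euclidean_space \<Rightarrow> real" and n :: nat and S :: "'a set"
  assumes op: "open S" and C: "Ck_on n S F" and z: "0 \<in> S"
begin

lemma nderiv_linear_mid:
  assumes "length us + length vs < n"
  shows "linear (\<lambda>u. nderiv F (us @ u # vs) 0)"
proof -
  have "nderiv F (us @ u # vs) 0 = nderiv F (u # us @ vs) 0" for u
    by (rule nderiv_perm[OF op C z]) (use assms in auto)
  then show ?thesis
    using nderiv_linear_head[OF C, of "us @ vs" 0] assms z by simp
qed

text \<open>The variable \<open>v\<close> fills j slots at once. One of them is expanded in the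
  basis and its basis vector moved behind the others, so that the product rule applies together with
  the induction hypothesis for the longer tail \<open>b # us\<close>.\<close>

lemma has_derivative_nderiv_replicate:
  assumes "j + length us \<le> n"
  shows "((\<lambda>v. nderiv F (replicate j v @ us) 0) has_derivative
     (\<lambda>h. real j * nderiv F (h # replicate (j - 1) v @ us) 0)) (at v)"
  using assms
proof (induction j arbitrary: us)
  case (Suc j)
  have lin: "linear (\<lambda>u. nderiv F (u # ws) 0)" if "length ws < n" for ws
    using nderiv_linear_head[OF C that z] .
  have expand: "nderiv F (u # ws) 0 = (\<Sum>b\<in>Basis. (u \<bullet> b) * nderiv F (b # ws) 0)" if "length ws < n" for u ws
    using linear_euclidean_sum[OF lin[OF that], of u] by simp
  have swap: "nderiv F (b # replicate i u @ ws) 0 = nderiv F (replicate i u @ b # ws) 0"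
    if "length ws + i < n" for b i u ws
    by (rule nderiv_perm[OF op C z]) (use that in auto)
  have "((\<lambda>v. \<Sum>b\<in>Basis. (v \<bullet> b) * nderiv F (replicate j v @ b # us) 0) has_derivative
     (\<lambda>h. \<Sum>b\<in>Basis. (v \<bullet> b) * (real j * nderiv F (h # replicate (j - 1) v @ b # us) 0)
        + (h \<bullet> b) * nderiv F (replicate j v @ b # us) 0)) (at v)"
    using Suc.prems by (intro has_derivative_sum has_derivative_mult Suc.IH has_derivative_inner_left has_derivative_ident) auto
  moreover have e: "(\<Sum>b\<in>Basis. (h \<bullet> b) * nderiv F (replicate j v @ b # us) 0)
      = nderiv F (h # replicate j v @ us) 0" for v h
  proof -
    have "nderiv F (h # replicate j v @ us) 0 = (\<Sum>b\<in>Basis. (h \<bullet> b) * nderiv F (b # replicate j v @ us) 0)"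
      using Suc.prems by (intro expand) simp
    also have "\<dots> = (\<Sum>b\<in>Basis. (h \<bullet> b) * nderiv F (replicate j v @ b # us) 0)"
      using Suc.prems by (intro sum.cong refl arg_cong2[where f = times] swap) simp
    finally show ?thesis by simp
  qed
  moreover have "(\<Sum>b\<in>Basis. (v \<bullet> b) * (real j * nderiv F (h # replicate (j - 1) v @ b # us) 0)
        + (h \<bullet> b) * nderiv F (replicate j v @ b # us) 0)
      = real (Suc j) * nderiv F (h # replicate (Suc j - 1) v @ us) 0" for h
  proof -
    \<comment> \<open>The terms in which the product rule differentiates the remaining j slots
      recombine, by linearity and symmetry, into j equal derivatives. For j = 0 the factor
      \<open>real j\<close> kills the term with the truncated \<open>j - 1\<close>.\<close>
    have "real j * (\<Sum>b\<in>Basis. (v \<bullet> b) * nderiv F (h # replicate (j - 1) v @ b # us) 0)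
        = real j * nderiv F (h # replicate j v @ us) 0"
    proof (cases j)
      case (Suc i)
      have "nderiv F (h # replicate i v @ b # us) 0 = nderiv F (b # h # replicate i v @ us) 0" for b
        by (rule nderiv_perm[OF op C z]) (use Suc.prems Suc in auto)
      then have "(\<Sum>b\<in>Basis. (v \<bullet> b) * nderiv F (h # replicate i v @ b # us) 0)
          = nderiv F (v # h # replicate i v @ us) 0"
        using Suc.prems Suc by (subst expand) (simp_all del: nderiv.simps)
      also have "\<dots> = nderiv F (h # v # replicate i v @ us) 0"
        by (rule nderiv_perm[OF op C z]) (use Suc.prems Suc in auto)
      finally show ?thesis using Suc by (simp del: nderiv.simps)
    qed simp
    then show ?thesis
      using e[of h v]
      by (simp add: sum.distrib sum_distrib_left algebra_simps del: nderiv.simps)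
  qed
  ultimately show ?case by (simp del: nderiv.simps)
qed simp

text \<open>The factor j from the j equal slots turns 1 / j! into 1 / (j - 1)! and removes the
  constant term. Hence differentiating an expansion gives the expansion of the derivative, one order
  lower.\<close>

lemma has_derivative_taylor:
  assumes "Suc q + length us \<le> n"
  shows "((\<lambda>v. taylor (Suc q) (nderiv F us) v) has_derivative
     (\<lambda>h. taylor q (nderiv F (h # us)) v)) (at v)"
proof -
  have "((\<lambda>v. \<Sum>j\<le>Suc q. nderiv F (replicate j v @ us) 0 / fact j) has_derivative
     (\<lambda>h. \<Sum>j\<le>Suc q. (real j * nderiv F (h # replicate (j - 1) v @ us) 0) / fact j)) (at v)"
    using assms
    by (intro has_derivative_sum bounded_linear.has_derivative[OF bounded_linear_divide]
        has_derivative_nderiv_replicate) auto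
  moreover have "(\<Sum>j\<le>Suc q. (real j * nderiv F (h # replicate (j - 1) v @ us) 0) / fact j)
      = taylor q (nderiv F (h # us)) v" for h
  proof -
    have "nderiv F (h # replicate j v @ us) 0 = nderiv F (replicate j v @ h # us) 0" if "j \<le> q" for j
      by (rule nderiv_perm[OF op C z]) (use assms that in auto)
    then show ?thesis
      unfolding taylor_def nderiv_append[symmetric] sum.atMost_Suc_shift
      by (auto intro!: sum.cong simp: field_simps simp del: nderiv.simps of_nat_Suc)
  qed
  ultimately show ?thesis by (simp add: taylor_def nderiv_append)
qed

text \<open>Together with the bilinear and symmetric versions below, this makes the operator norm
  and eigenvalue bounds applicable to the model derivatives and to the transport errors.\<close>

lemma taylor_nderiv1_linear:
  assumes "q < n" shows "linear (\<lambda>u. taylor q (nderiv F [u]) v)"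
proof -
  have "linear (\<lambda>u. \<Sum>j\<le>q. nderiv F (replicate j v @ [u]) 0 / fact j)"
  proof (rule linear_compose_sum, intro ballI)
    fix j assume "j \<in> {..q}"
    then show "linear (\<lambda>u. nderiv F (replicate j v @ [u]) 0 / fact j)"
      using nderiv_linear_mid[of "replicate j v" "[]"] assms
      by (auto simp: linear_iff add_divide_distrib)
  qed
  then show ?thesis by (simp only: taylor_def nderiv_append)
qed

lemma taylor_nderiv2_bilinear:
  assumes "q + 1 < n" shows "bilinear (\<lambda>u w. taylor q (nderiv F [u, w]) v)"
  unfolding bilinear_def
proof safe
  have e: "taylor q (nderiv F [u, w]) v = (\<Sum>j\<le>q. nderiv F (replicate j v @ [u, w]) 0 / fact j)" for u w
    by (simp only: taylor_def nderiv_append)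
  fix u
  show "linear (\<lambda>w. taylor q (nderiv F [u, w]) v)" unfolding e
  proof (rule linear_compose_sum, intro ballI)
    fix j assume "j \<in> {..q}"
    then show "linear (\<lambda>w. nderiv F (replicate j v @ [u, w]) 0 / fact j)"
      using nderiv_linear_mid[of "replicate j v @ [u]" "[]"] assms
      by (auto simp: linear_iff add_divide_distrib)
  qed
  show "linear (\<lambda>w. taylor q (nderiv F [w, u]) v)" unfolding e
  proof (rule linear_compose_sum, intro ballI)
    fix j assume "j \<in> {..q}"
    then show "linear (\<lambda>w. nderiv F (replicate j v @ [w, u]) 0 / fact j)"
      using nderiv_linear_mid[of "replicate j v" "[u]"] assms
      by (auto simp: linear_iff add_divide_distrib)
  qed
qed

lemma taylor_nderiv2_symmetric:
  assumes "q + 2 \<le> n" shows "taylor q (nderiv F [u, w]) v = taylor q (nderiv F [w, u]) v"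
  unfolding taylor_def nderiv_append[symmetric]
  by (intro sum.cong arg_cong2[of _ _ _ _ "(/)"] nderiv_perm[OF op C z]) (use assms in auto)

end

section \<open>Inner products and symmetric forms\<close>

text \<open>A product rule in which the scalar factor is merely continuous, because the other factor
  vanishes at the point. It serves powers of the norm at 0, where the norm is not differentiable,
  and the field in \<open>implicit_linear_solution_derivative\<close> before its differentiability
  is known.\<close>

lemma has_derivative_scaleR_vanishing:
  fixes s :: "'a::real_normed_vector \<Rightarrow> real" and A :: "'a \<Rightarrow> 'b::real_normed_vector"
  assumes s: "isCont s a" and A: "(A has_derivative A') (at a)" and "A a = 0"
  shows "((\<lambda>x. s x *\<^sub>R A x) has_derivative (\<lambda>h. s a *\<^sub>R A' h)) (at a)"
proof -
  interpret A': bounded_linear A' using A by (rule has_derivative_bounded_linear)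
  obtain K where K: "K > 0" "\<And>h. norm (A' h) \<le> norm h * K"
    using A'.pos_bounded by blast
  have s_lim: "(s \<longlongrightarrow> s a) (at a)" using s by (simp add: isCont_def)
  have A_lim: "((\<lambda>x. norm (A x - A' (x - a)) / norm (x - a)) \<longlongrightarrow> 0) (at a)"
    using A \<open>A a = 0\<close> by (simp add: has_derivative_iff_norm)
  have "((\<lambda>x. \<bar>s x\<bar> * (norm (A x - A' (x - a)) / norm (x - a)) + \<bar>s x - s a\<bar> * K) \<longlongrightarrow>
      \<bar>s a\<bar> * 0 + \<bar>s a - s a\<bar> * K) (at a)"
    by (intro tendsto_intros s_lim A_lim)
  then have lim: "((\<lambda>x. \<bar>s x\<bar> * (norm (A x - A' (x - a)) / norm (x - a)) + \<bar>s x - s a\<bar> * K) \<longlongrightarrow> 0) (at a)"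
    by simp
  have bound: "norm (s x *\<^sub>R A x - s a *\<^sub>R A' (x - a)) / norm (x - a)
      \<le> \<bar>s x\<bar> * (norm (A x - A' (x - a)) / norm (x - a)) + \<bar>s x - s a\<bar> * K" if "x \<noteq> a" for x
  proof -
    have "s x *\<^sub>R A x - s a *\<^sub>R A' (x - a) = s x *\<^sub>R (A x - A' (x - a)) + (s x - s a) *\<^sub>R A' (x - a)"
      by (simp add: algebra_simps)
    then have "norm (s x *\<^sub>R A x - s a *\<^sub>R A' (x - a))
        \<le> \<bar>s x\<bar> * norm (A x - A' (x - a)) + \<bar>s x - s a\<bar> * norm (A' (x - a))"
      by (metis norm_scaleR norm_triangle_ineq)
    also have "\<dots> \<le> \<bar>s x\<bar> * norm (A x - A' (x - a)) + \<bar>s x - s a\<bar> * (norm (x - a) * K)"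
      by (intro add_left_mono mult_left_mono K) auto
    finally show ?thesis using that by (simp add: field_simps)
  qed
  have "\<forall>\<^sub>F x in at a. norm (s x *\<^sub>R A x - s a *\<^sub>R A' (x - a)) / norm (x - a)
      \<le> \<bar>s x\<bar> * (norm (A x - A' (x - a)) / norm (x - a)) + \<bar>s x - s a\<bar> * K"
    unfolding eventually_at_filter by (intro always_eventually) (use bound in blast)
  then have "((\<lambda>x. norm (s x *\<^sub>R A x - s a *\<^sub>R A' (x - a)) / norm (x - a)) \<longlongrightarrow> 0) (at a)"
    by (intro tendsto_sandwich[OF _ _ tendsto_const lim]) auto
  then show ?thesis
    using \<open>A a = 0\<close> A'.bounded_linear_axioms
    by (simp add: has_derivative_iff_norm bounded_linear_scaleR_right bounded_linear_compose[OF bounded_linear_scaleR_right])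
qed

text \<open>First-order optimality at a minimum: for small t of sign opposite to \<open>a\<close>
  the linear term would win. The value t = - a / (\<bar>b\<bar> + 1) is small enough.\<close>

lemma linear_nonneg_perturbation_zero:
  fixes a b :: real
  assumes "\<And>t. 0 \<le> 2 * t * a + t\<^sup>2 * b"
  shows "a = 0"
proof (rule ccontr)
  assume "a \<noteq> 0"
  define t where "t = - a / (\<bar>b\<bar> + 1)"
  have "t\<^sup>2 * b \<le> t\<^sup>2 * (\<bar>b\<bar> + 1)" by (intro mult_left_mono) auto
  also have "t\<^sup>2 * (\<bar>b\<bar> + 1) = - t * a"
  proof -
    have "t * (\<bar>b\<bar> + 1) = - a" by (simp add: t_def add_nonneg_eq_0_iff)
    then show ?thesis by (simp add: power2_eq_square mult.assoc)
  qed
  finally have "0 \<le> t * a" using assms[of t] by simp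
  moreover have "t * a < 0"
    using \<open>a \<noteq> 0\<close> unfolding t_def
    by (simp add: divide_less_0_iff add_nonneg_pos power2_eq_square[symmetric])
  ultimately show False by simp
qed

section \<open>Norm, Riesz representation and eigenvalues for an inner product\<close>

locale inner_form =
  fixes G :: "'e::euclidean_space \<Rightarrow> 'e \<Rightarrow> real"
  assumes bil: "bilinear G" and sym: "G u w = G w u" and pos: "u \<noteq> 0 \<Longrightarrow> 0 < G u u"
begin

abbreviation gnorm :: "'e \<Rightarrow> real" where "gnorm u \<equiv> sqrt (G u u)"

lemma bounded_bil: "bounded_bilinear G"
  using bil bilinear_conv_bounded_bilinear by auto

lemmas has_derivative_form = bounded_bilinear.FDERIV[OF bounded_bil]
lemmas form_simps = bilinear_ladd[OF bil] bilinear_radd[OF bil] bilinear_lmul[OF bil]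
  bilinear_rmul[OF bil] bilinear_lsub[OF bil] bilinear_rsub[OF bil] bilinear_lzero[OF bil]
  bilinear_rzero[OF bil] bilinear_lneg[OF bil] bilinear_rneg[OF bil]

lemma nonneg: "0 \<le> G u u"
  using pos[of u] by (cases "u = 0") (auto simp: less_imp_le bilinear_lzero[OF bil])

lemma form_eq_0_iff: "G u u = 0 \<longleftrightarrow> u = 0"
  using pos[of u] by (cases "u = 0") (auto simp: bilinear_lzero[OF bil])

lemma gnorm_scale: "gnorm (t *\<^sub>R u) = \<bar>t\<bar> * gnorm u"
  by (simp add: form_simps real_sqrt_mult mult.assoc[symmetric])

lemma continuous_form: "continuous_on A (\<lambda>u. G u u)"
  by (intro bounded_bilinear.continuous_on[OF bounded_bil] continuous_on_id)

lemma unit_sphere_nonempty: "\<exists>u::'e. norm u = 1"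
  using vector_choose_size[of 1] by auto

text \<open>\<open>G\<close> attains a positive minimum on the compact Euclidean unit sphere. This
  transfers boundedness between the two norms, as needed for the compactness of the
  \<open>G\<close>-sphere and for finite operator norms.\<close>

lemma gnorm_lower_bound: "\<exists>c>0. \<forall>u. c * norm u \<le> gnorm u"
proof -
  obtain u0 where u0: "u0 \<in> sphere 0 1" "\<And>u. u \<in> sphere 0 1 \<Longrightarrow> G u0 u0 \<le> G u u"
    using continuous_attains_inf[OF compact_sphere _ continuous_form, of 0 1] unit_sphere_nonempty
    by auto
  have "u0 \<noteq> 0" using u0(1) by auto
  have "gnorm u0 * norm u \<le> gnorm u" for u
  proof (cases "u = 0")
    case False
    then have "gnorm u0 \<le> gnorm ((1 / norm u) *\<^sub>R u)"
      by (intro real_sqrt_le_mono u0(2)) simp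
    also have "\<dots> = gnorm u / norm u" by (simp add: gnorm_scale)
    finally show ?thesis using False by (simp add: field_simps)
  qed (simp add: form_simps)
  moreover have "0 < gnorm u0" using pos[OF \<open>u0 \<noteq> 0\<close>] by simp
  ultimately show ?thesis by blast
qed

lemma cauchy_schwarz: "(G u w)\<^sup>2 \<le> G u u * G w w"
proof (cases "w = 0")
  case False
  then have w: "0 < G w w" by (rule pos)
  define t where "t = G u w / G w w"
  have t: "t * G w w = G u w" using w by (simp add: t_def)
  have "0 \<le> G (u - t *\<^sub>R w) (u - t *\<^sub>R w)" by (rule nonneg)
  also have "\<dots> = G u u - 2 * (t * G u w) + t * (t * G w w)"
    using sym[of w u] by (simp add: form_simps algebra_simps)
  also have "\<dots> = G u u - t * G u w" by (simp add: t)
  finally have "t * G u w * G w w \<le> G u u * G w w"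
    using w by (intro mult_right_mono) auto
  moreover have "t * G u w * G w w = (G u w)\<^sup>2"
    using w by (simp add: t_def power2_eq_square)
  ultimately show ?thesis by simp
qed (simp add: form_simps)

text \<open>Justifies the definite descriptions in \<open>grad\<close> and
  \<open>christoffel\<close>. The map \<open>T\<close> collects the coordinates
  \<open>G w b\<close>; it is injective by definiteness, hence surjective in finite
  dimension.\<close>

lemma riesz:
  assumes "linear l" shows "\<exists>!w. \<forall>u. G w u = l u"
proof -
  define T where "T w = (\<Sum>b\<in>Basis. G w b *\<^sub>R b)" for w
  have "linear T" unfolding T_def
    by (rule linear_compose_sum) (auto simp: linear_iff form_simps scaleR_add_left)
  have T: "T w \<bullet> b = G w b" if "b \<in> Basis" for w b
    using that by (simp add: T_def inner_sum_left inner_Basis if_distrib cong: if_cong)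
  have ext: "(\<forall>u. G w u = k u) \<longleftrightarrow> (\<forall>b\<in>Basis. T w \<bullet> b = k b)" if "linear k" for k w
  proof
    assume a: "\<forall>b\<in>Basis. T w \<bullet> b = k b"
    have lin: "linear (G w)" using bil by (simp add: bilinear_def)
    show "\<forall>u. G w u = k u"
    proof
      fix u
      have "G w u = (\<Sum>b\<in>Basis. (u \<bullet> b) *\<^sub>R G w b)" by (rule linear_euclidean_sum[OF lin])
      also have "\<dots> = (\<Sum>b\<in>Basis. (u \<bullet> b) *\<^sub>R k b)" using a T by (intro sum.cong) auto
      also have "\<dots> = k u" by (rule linear_euclidean_sum[OF that, symmetric])
      finally show "G w u = k u" .
    qed
  qed (simp add: T)
  have "inj T"
  proof -
    have "w = 0" if "T w = 0" for w
    proof -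
      have "linear (\<lambda>u. 0 :: real)" by (rule linear_zero)
      from ext[OF this, of w] have "\<forall>u. G w u = 0" using that by simp
      then show ?thesis using form_eq_0_iff by blast
    qed
    then show ?thesis using \<open>linear T\<close> linear_injective_0 by blast
  qed
  then have "surj T" using \<open>linear T\<close> linear_injective_imp_surjective by blast
  define y where "y = (\<Sum>b\<in>Basis. l b *\<^sub>R b)"
  have y: "y \<bullet> b = l b" if "b \<in> Basis" for b
    using that by (simp add: y_def inner_sum_left inner_Basis if_distrib cong: if_cong)
  have "(\<forall>u. G w u = l u) \<longleftrightarrow> T w = y" for w
    unfolding ext[OF assms] using y euclidean_eq_iff[of "T w" y] by simp
  then show ?thesis
    using \<open>inj T\<close> \<open>surj T\<close> by (metis injD surjD)
qed

lemma form_eq_imp_eq: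
  assumes "\<And>u. G w u = G z u" shows "w = z"
proof -
  have "G (w - z) (w - z) = 0" using assms[of "w - z"] by (simp add: bilinear_lsub[OF bil])
  then show ?thesis by (simp add: form_eq_0_iff)
qed

text \<open>Eigenvectors of different eigenvalues are \<open>G\<close>-orthogonal and therefore
  independent. Finiteness gives \<open>Min\<close> in \<open>lambda_min_form\<close> its intended
  meaning.\<close>

lemma finite_eigenvalues:
  assumes "bilinear B" "\<And>u w. B u w = B w u"
  shows "finite {l. \<exists>u. u \<noteq> 0 \<and> (\<forall>w. B u w = l * G u w)}" (is "finite ?E")
proof -
  obtain f where f: "\<And>l. l \<in> ?E \<Longrightarrow> f l \<noteq> 0 \<and> (\<forall>w. B (f l) w = l * G (f l) w)"
  proof (rule that[of "\<lambda>l. SOME u. u \<noteq> 0 \<and> (\<forall>w. B u w = l * G u w)"])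
    fix l assume "l \<in> ?E"
    then show "(SOME u. u \<noteq> 0 \<and> (\<forall>w. B u w = l * G u w)) \<noteq> 0 \<and>
        (\<forall>w. B (SOME u. u \<noteq> 0 \<and> (\<forall>w. B u w = l * G u w)) w
          = l * G (SOME u. u \<noteq> 0 \<and> (\<forall>w. B u w = l * G u w)) w)"
      by (intro someI_ex[of "\<lambda>u. u \<noteq> 0 \<and> (\<forall>w. B u w = l * G u w)"]) simp
  qed
  have orth: "G (f l) (f k) = 0" if "l \<in> ?E" "k \<in> ?E" "l \<noteq> k" for l k
  proof -
    have "l * G (f l) (f k) = k * G (f l) (f k)"
    proof -
      have "B (f l) (f k) = l * G (f l) (f k)" "B (f k) (f l) = k * G (f k) (f l)"
        using f[OF that(1)] f[OF that(2)] by blast+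
      then show ?thesis using assms(2)[of "f l" "f k"] sym[of "f l" "f k"] by metis
    qed
    then show ?thesis using that(3) by simp
  qed
  have inj: "inj_on f ?E"
  proof (rule inj_onI, rule ccontr)
    fix l k assume "l \<in> ?E" "k \<in> ?E" "f l = f k" "l \<noteq> k"
    with orth[of l k] f[of l] show False by (simp add: form_eq_0_iff)
  qed
  have "independent (f ` ?E)"
    unfolding dependent_explicit
  proof safe
    fix S u v assume S: "finite S" "S \<subseteq> f ` ?E" "(\<Sum>w\<in>S. u w *\<^sub>R w) = 0" "v \<in> S" "u v \<noteq> 0"
    have lin: "linear (\<lambda>w. G w v)" using bil by (simp add: bilinear_def)
    have "0 = G (\<Sum>w\<in>S. u w *\<^sub>R w) v" using S(3) by (simp add: form_simps)
    also have "\<dots> = (\<Sum>w\<in>S. u w * G w v)"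
      by (simp add: linear_sum[OF lin] bilinear_lmul[OF bil])
    also have "\<dots> = (\<Sum>w\<in>S. if w = v then u v * G v v else 0)"
    proof (intro sum.cong refl)
      fix w assume "w \<in> S"
      then obtain l k where "l \<in> ?E" "k \<in> ?E" "w = f l" "v = f k" using S(2,4) by blast
      then show "u w * G w v = (if w = v then u v * G v v else 0)"
        using orth[of l k] by auto
    qed
    also have "\<dots> = u v * G v v" using S(1,4) by simp
    finally have "G v v = 0" using S(5) by simp
    then have "v = 0" by (simp only: form_eq_0_iff)
    moreover obtain l where "l \<in> ?E" "v = f l" using S(2,4) by blast
    ultimately show False using f[of l] by simp
  qed
  then have "finite (f ` ?E)" by (rule independent_imp_finite)
  then show ?thesis using inj finite_imageD by blast
qed

text \<open>A minimizer of \<open>B\<close> on the compact \<open>G\<close>-unit sphere is an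
  eigenvector by first-order optimality, and the Rayleigh inequality makes its eigenvalue the least
  one.\<close>

lemma lambda_min_form_rayleigh:
  assumes "bilinear B" "\<And>u w. B u w = B w u"
  shows "lambda_min_form G B * G u u \<le> B u u"
    and "\<exists>u. G u u = 1 \<and> B u u = lambda_min_form G B"
proof -
  obtain c where c: "c > 0" "\<And>u. c * norm u \<le> gnorm u" using gnorm_lower_bound by blast
  define K where "K = {u. G u u = 1}"
  have "closed K"
    using continuous_closed_preimage_constant[OF continuous_form[of UNIV] closed_UNIV, of 1]
    by (simp add: K_def)
  moreover have "bounded K"
    unfolding bounded_iff using c by (intro exI[of _ "1 / c"]) (auto simp: K_def field_simps, metis real_sqrt_one)
  ultimately have "compact K" by (simp add: compact_eq_bounded_closed)
  have normalize: "(1 / gnorm u) *\<^sub>R u \<in> K" if "u \<noteq> 0" for u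
    using pos[OF that] by (simp add: K_def form_simps field_simps flip: power2_eq_square)
  obtain v :: 'e where "v \<noteq> 0" using unit_sphere_nonempty by fastforce
  with normalize have "K \<noteq> {}" by blast
  moreover have "continuous_on K (\<lambda>u. B u u)"
    using bounded_bilinear.continuous_on[OF _ continuous_on_id continuous_on_id] assms(1)
      bilinear_conv_bounded_bilinear by blast
  ultimately obtain u0 where u0: "u0 \<in> K" "\<And>u. u \<in> K \<Longrightarrow> B u0 u0 \<le> B u u"
    using continuous_attains_inf[OF \<open>compact K\<close>] by blast
  define \<mu> where "\<mu> = B u0 u0"
  note Bs = bilinear_lmul[OF assms(1)] bilinear_rmul[OF assms(1)] bilinear_ladd[OF assms(1)]
    bilinear_radd[OF assms(1)] bilinear_lzero[OF assms(1)]
  have ray: "\<mu> * G u u \<le> B u u" for u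
  proof (cases "u = 0")
    case False
    then have "\<mu> \<le> B ((1 / gnorm u) *\<^sub>R u) ((1 / gnorm u) *\<^sub>R u)"
      unfolding \<mu>_def by (intro u0(2) normalize)
    also have "\<dots> = B u u / G u u" using nonneg[of u] by (simp add: Bs)
    finally show ?thesis using pos[OF False] by (simp add: field_simps)
  qed (simp add: Bs form_simps)
  have "B u0 w = \<mu> * G u0 w" for w
  proof -
    \<comment> \<open>This quadratic in t is the defect of the Rayleigh inequality at u0 + t w; its
      constant term vanishes since \<open>u0\<close> attains the minimum.\<close>
    have "0 \<le> 2 * t * (B u0 w - \<mu> * G u0 w) + t\<^sup>2 * (B w w - \<mu> * G w w)" for t
    proof -
      have "0 \<le> B (u0 + t *\<^sub>R w) (u0 + t *\<^sub>R w) - \<mu> * G (u0 + t *\<^sub>R w) (u0 + t *\<^sub>R w)"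
        using ray by simp
      also have "\<dots> = (B u0 u0 - \<mu> * G u0 u0) + 2 * t * (B u0 w - \<mu> * G u0 w) + t\<^sup>2 * (B w w - \<mu> * G w w)"
        using assms(2)[of w u0] sym[of w u0]
        by (simp add: Bs form_simps power2_eq_square algebra_simps)
      also have "B u0 u0 - \<mu> * G u0 u0 = 0" using u0(1) by (simp add: K_def \<mu>_def)
      finally show ?thesis by simp
    qed
    from linear_nonneg_perturbation_zero[OF this] show ?thesis by simp
  qed
  moreover have "u0 \<noteq> 0" using u0(1) by (auto simp: K_def form_simps)
  ultimately have in_E: "\<mu> \<in> {l. \<exists>u. u \<noteq> 0 \<and> (\<forall>w. B u w = l * G u w)}" by blast
  have least: "\<mu> \<le> l" if "l \<in> {l. \<exists>u. u \<noteq> 0 \<and> (\<forall>w. B u w = l * G u w)}" for l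
  proof -
    from that obtain u where u: "u \<noteq> 0" and eig: "\<forall>w. B u w = l * G u w"
      unfolding mem_Collect_eq by (elim exE conjE)
    have "\<mu> * G u u \<le> l * G u u" using ray[of u] eig[THEN spec, of u] by (simp only:)
    then show ?thesis using pos[OF u] by (rule mult_right_le_imp_le)
  qed
  have eq: "lambda_min_form G B = \<mu>"
    unfolding lambda_min_form_def by (rule Min_eqI[OF finite_eigenvalues[OF assms] least in_E])
  show "lambda_min_form G B * G u u \<le> B u u" unfolding eq by (rule ray)
  show "\<exists>u. G u u = 1 \<and> B u u = lambda_min_form G B"
    unfolding eq using u0(1) by (auto simp: K_def \<mu>_def)
qed

text \<open>The exponent has the form k + 2 so that a factor \<open>G v v\<close> splits off. It is
  differentiable and vanishes at 0, where the remaining power of the norm is only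
  continuous.\<close>

lemma has_derivative_gnorm_power:
  "((\<lambda>v. gnorm v ^ (k + 2)) has_derivative (\<lambda>h. real (k + 2) * gnorm v ^ k * G v h)) (at v)"
proof -
  have dG: "((\<lambda>v. G v v) has_derivative (\<lambda>h. 2 * G v h)) (at v)" for v
    using has_derivative_form[OF has_derivative_ident has_derivative_ident, of v UNIV] sym by simp
  have eq: "gnorm v ^ (k + 2) = gnorm v ^ k * G v v" for v
    using nonneg[of v] by (simp add: power_add)
  show ?thesis
  proof (cases "v = 0")
    case True
    have "isCont (\<lambda>v. gnorm v ^ k) 0"
      proof -
      have "isCont (\<lambda>v. G v v) 0" using has_derivative_continuous[OF dG] .
      then have "isCont (\<lambda>v. sqrt (G v v)) 0"
        by (rule continuous_real_sqrt)
      then show ?thesis by (rule isCont_power)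
    qed
    from has_derivative_scaleR_vanishing[OF this dG[of 0]]
    show ?thesis unfolding eq True by (simp add: form_simps)
  next
    case False
    have "((\<lambda>v. gnorm v) has_derivative (\<lambda>h. (2 * G v h) * (inverse (gnorm v) / 2))) (at v)"
      using pos[OF False] by (intro has_derivative_real_sqrt dG)
    from has_derivative_power[OF this, of "k + 2"]
    have "((\<lambda>v. gnorm v ^ (k + 2)) has_derivative
        (\<lambda>h. real (k + 2) * (2 * G v h * (inverse (gnorm v) / 2)) * gnorm v ^ (k + 2 - 1))) (at v)" .
    moreover have "real (k + 2) * (2 * G v h * (inverse (gnorm v) / 2)) * gnorm v ^ (k + 2 - 1)
        = real (k + 2) * gnorm v ^ k * G v h" for h
      using pos[OF False] by (simp add: field_simps)
    ultimately show ?thesis by (simp only:)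
  qed
qed

end

section \<open>Operator norms of linear and bilinear forms\<close>

lemma op_norm_bound1:
  assumes "inner_form (riem_metric M x)" "linear (\<lambda>u. T [u])"
  shows "\<bar>T [u]\<bar> \<le> op_norm M x 1 T * tnorm M x u"
proof -
  interpret inner_form "riem_metric M x" by fact
  have tn: "tnorm M x w = gnorm w" for w by (simp add: tnorm_def)
  have unit: "gnorm ((1 / gnorm u) *\<^sub>R u) \<le> 1" if "0 < gnorm u" for u
    using that unfolding gnorm_scale abs_of_pos[OF divide_pos_pos[OF zero_less_one that]]
    by (simp del: real_sqrt_gt_0_iff)
  obtain c where c: "c > 0" "\<And>u. c * norm u \<le> gnorm u" using gnorm_lower_bound by blast
  obtain K where K: "K > 0" "\<And>w. norm (T [w]) \<le> norm w * K"
    using bounded_linear.pos_bounded assms(2) linear_conv_bounded_linear by blast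
  \<comment> \<open>The real \<open>SUP\<close> in \<open>op_norm\<close> bounds its elements only
    if the set is bounded above; the unit ball of the metric is bounded in the Euclidean norm, on
    which the linear form is bounded.\<close>
  have bdd: "bdd_above ((\<lambda>us. \<bar>T us\<bar>) ` {us. length us = 1 \<and> (\<forall>u\<in>set us. tnorm M x u \<le> 1)})"
  proof (rule bdd_aboveI2)
    fix us assume "us \<in> {us. length us = 1 \<and> (\<forall>u\<in>set us. tnorm M x u \<le> 1)}"
    then obtain w where w: "us = [w]" "gnorm w \<le> 1" by (auto simp: length_Suc_conv tn)
    have "c * norm w \<le> 1" using c(2)[of w] w(2) by linarith
    then have "norm w \<le> 1 / c" using c(1) by (simp add: field_simps)
    then show "\<bar>T us\<bar> \<le> 1 / c * K"
      using K(2)[of w] K(1) mult_right_mono[of "norm w" "1 / c" K] w(1) by simp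
  qed
  show ?thesis
  proof (cases "u = 0")
    case False
    then have p: "0 < gnorm u" using pos by simp
    have "\<bar>T [(1 / gnorm u) *\<^sub>R u]\<bar> \<le> op_norm M x 1 T"
      unfolding op_norm_def
      by (rule cSUP_upper[OF _ bdd]) (use unit p in \<open>simp add: tn del: real_sqrt_gt_0_iff real_sqrt_le_1_iff\<close>)
    moreover have "T [(1 / gnorm u) *\<^sub>R u] = T [u] / gnorm u"
      using linear_scale[OF assms(2), of "1 / gnorm u" u] by simp
    ultimately have "\<bar>T [u]\<bar> / gnorm u \<le> op_norm M x 1 T"
      using p by (simp only: abs_divide abs_of_pos)
    then show ?thesis
      unfolding tn pos_divide_le_eq[OF p] .
  qed (use linear_0[OF assms(2)] in \<open>simp add: tn form_simps\<close>)
qed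

lemma op_norm_bound2:
  assumes "inner_form (riem_metric M x)" "bilinear (\<lambda>u w. T [u, w])"
  shows "\<bar>T [u, w]\<bar> \<le> op_norm M x 2 T * tnorm M x u * tnorm M x w"
proof -
  interpret inner_form "riem_metric M x" by fact
  have tn: "tnorm M x w = gnorm w" for w by (simp add: tnorm_def)
  have unit: "gnorm ((1 / gnorm u) *\<^sub>R u) \<le> 1" if "0 < gnorm u" for u
    using that unfolding gnorm_scale abs_of_pos[OF divide_pos_pos[OF zero_less_one that]]
    by (simp del: real_sqrt_gt_0_iff)
  obtain c where c: "c > 0" "\<And>u. c * norm u \<le> gnorm u" using gnorm_lower_bound by blast
  obtain K where K: "K > 0" "\<And>u w. norm (T [u, w]) \<le> norm u * norm w * K"
    using bounded_bilinear.pos_bounded assms(2) bilinear_conv_bounded_bilinear by blast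
  have bdd: "bdd_above ((\<lambda>us. \<bar>T us\<bar>) ` {us. length us = 2 \<and> (\<forall>u\<in>set us. tnorm M x u \<le> 1)})"
  proof (rule bdd_aboveI2)
    fix us assume "us \<in> {us. length us = 2 \<and> (\<forall>u\<in>set us. tnorm M x u \<le> 1)}"
    then obtain u w where w: "us = [u, w]" "gnorm u \<le> 1" "gnorm w \<le> 1"
      by (auto simp: length_Suc_conv numeral_2_eq_2 tn)
    have "c * norm u \<le> 1" "c * norm w \<le> 1" using c(2)[of u] c(2)[of w] w by linarith+
    then have "norm u \<le> 1 / c" "norm w \<le> 1 / c" using c(1) by (simp_all add: field_simps)
    then have "norm u * norm w \<le> 1 / c * (1 / c)" using c(1) by (intro mult_mono) auto
    then show "\<bar>T us\<bar> \<le> 1 / c * (1 / c) * K"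
      using K(2)[of u w] K(1) mult_right_mono[of "norm u * norm w" "1 / c * (1 / c)" K] w(1) by simp
  qed
  show ?thesis
  proof (cases "u = 0 \<or> w = 0")
    case False
    then have p: "0 < gnorm u" "0 < gnorm w" using pos by simp_all
    have "\<bar>T [(1 / gnorm u) *\<^sub>R u, (1 / gnorm w) *\<^sub>R w]\<bar> \<le> op_norm M x 2 T"
      unfolding op_norm_def
      by (rule cSUP_upper[OF _ bdd]) (use unit p in \<open>simp add: tn del: real_sqrt_gt_0_iff real_sqrt_le_1_iff\<close>)
    moreover have "T [(1 / gnorm u) *\<^sub>R u, (1 / gnorm w) *\<^sub>R w] = T [u, w] / (gnorm u * gnorm w)"
      using bilinear_lmul[OF assms(2), of "1 / gnorm u" u] bilinear_rmul[OF assms(2), of _ "1 / gnorm w" w] by simp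
    ultimately have "\<bar>T [u, w]\<bar> / (gnorm u * gnorm w) \<le> op_norm M x 2 T"
      using p by (simp only: abs_divide abs_of_pos mult_pos_pos)
    then show ?thesis
      unfolding tn pos_divide_le_eq[OF mult_pos_pos[OF p]] by (simp only: mult.assoc)
  next
    case True
    then show ?thesis
      using bilinear_lzero[OF assms(2), of w] bilinear_rzero[OF assms(2), of u]
      by (auto simp: tn bilinear_lzero[OF bil])
  qed
qed

section \<open>Charts and retractions\<close>

text \<open>Meant for the gradient field in a chart: \<open>g\<close> is the coordinate metric,
  \<open>h\<close> the differential of f and \<open>X\<close> the solution of the linear system
  between them. Nothing is assumed about the regularity of \<open>X\<close>. Its continuity follows
  from an estimate, then its differentiability from a representation by functions that vanish at
  \<open>a\<close>; the second claim is the differentiated equation.\<close>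

lemma implicit_linear_solution_derivative:
  fixes g :: "'a::real_normed_vector \<Rightarrow> 'e::euclidean_space \<Rightarrow> 'e \<Rightarrow> real"
    and h :: "'a \<Rightarrow> 'e \<Rightarrow> real" and X :: "'a \<Rightarrow> 'e"
  assumes V: "open V" "a \<in> V"
    and lin: "\<And>y w. y \<in> V \<Longrightarrow> linear (\<lambda>u. g y u w)"
    and nondeg: "\<And>u. (\<And>w. w \<in> Basis \<Longrightarrow> g a u w = 0) \<Longrightarrow> u = 0"
    and dg: "\<And>u w. (\<lambda>y. g y u w) differentiable (at a)"
    and dh: "\<And>w. (\<lambda>y. h y w) differentiable (at a)"
    and eq: "\<And>y w. y \<in> V \<Longrightarrow> g y (X y) w = h y w"
  shows "X differentiable (at a)"
    and "frechet_derivative (\<lambda>y. g y (X a) z) (at a) u + g a (frechet_derivative X (at a) u) z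
      = frechet_derivative (\<lambda>y. h y z) (at a) u"
proof -
  define T where "T w = (\<Sum>b\<in>Basis. g a w b *\<^sub>R b)" for w
  have "linear T" unfolding T_def
    by (rule linear_compose_sum) (use lin[OF V(2)] in \<open>auto simp: linear_iff scaleR_add_left\<close>)
  have "w = 0" if "T w = 0" for w
  proof (rule nondeg)
    fix b :: 'e assume "b \<in> Basis"
    then have "T w \<bullet> b = g a w b"
      by (simp add: T_def inner_sum_left inner_Basis if_distrib cong: if_cong)
    then show "g a w b = 0" using that by simp
  qed
  then have "inj T" using \<open>linear T\<close> linear_injective_0 by blast
  then obtain S where S: "linear S" "\<And>w. S (T w) = w"
    using linear_injective_left_inverse[OF \<open>linear T\<close>] by (auto simp: o_def fun_eq_iff)
  have S': "bounded_linear S" using S(1) by (simp add: linear_conv_bounded_linear)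
  then obtain K where K: "0 < K" "\<And>w. norm (S w) \<le> norm w * K"
    using bounded_linear.pos_bounded by blast
  \<comment> \<open>Subtracting the equations at y and at \<open>a\<close> gives
    \<open>g a (X y - X a) b = e b y\<close>. So X y - X a is the image of the vector with
    coordinates \<open>e b y\<close> under the left inverse \<open>S\<close>, which does not depend
    on y.\<close>
  define e where "e b y = h y b - h a b - (\<Sum>c\<in>Basis. (X y \<bullet> c) * (g y c b - g a c b))" for b y
  have expand: "g y w b = (\<Sum>c\<in>Basis. (w \<bullet> c) * g y c b)" if "y \<in> V" for y w b
    using linear_euclidean_sum[OF lin[OF that], of w b] by simp
  have T_diff: "T (X y - X a) = (\<Sum>b\<in>Basis. e b y *\<^sub>R b)" if "y \<in> V" for y
  proof -
    have "g a (X y - X a) b = e b y" for b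
    proof -
      have "g a (X y - X a) b = g a (X y) b - g a (X a) b"
        using linear_diff[OF lin[OF V(2)]] .
      also have "\<dots> = g y (X y) b - h a b - (g y (X y) b - g a (X y) b)"
        using eq[OF V(2), of b] by simp
      also have "g y (X y) b - g a (X y) b = (\<Sum>c\<in>Basis. (X y \<bullet> c) * (g y c b - g a c b))"
        unfolding expand[OF that, of "X y"] expand[OF V(2), of "X y"]
        by (simp add: sum_subtractf algebra_simps)
      finally show ?thesis using eq[OF that, of b] by (simp add: e_def)
    qed
    then show ?thesis by (simp add: T_def)
  qed
  have X_rep: "X y = X a + S (\<Sum>b\<in>Basis. e b y *\<^sub>R b)" if "y \<in> V" for y
    using S(2)[of "X y - X a"] T_diff[OF that] by simp
  define E where "E y = (\<Sum>b\<in>Basis. \<bar>h y b - h a b\<bar>) + (\<Sum>b\<in>Basis. \<Sum>c\<in>Basis. \<bar>g y c b - g a c b\<bar>)" for y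
  have "isCont (\<lambda>y. h y b) a" "isCont (\<lambda>y. g y c b) a" for b c
    using dh dg by (auto intro: differentiable_imp_continuous_within)
  then have tends: "((\<lambda>y. h y b) \<longlongrightarrow> h a b) (at a)" "((\<lambda>y. g y c b) \<longlongrightarrow> g a c b) (at a)" for b c
    by (simp_all add: isCont_def)
  have "(E \<longlongrightarrow> (\<Sum>b\<in>Basis. \<bar>h a b - h a b\<bar>) + (\<Sum>b\<in>Basis. \<Sum>c\<in>Basis. \<bar>g a c b - g a c b\<bar>)) (at a)"
    unfolding E_def by (intro tendsto_intros tends)
  then have E0: "(E \<longlongrightarrow> 0) (at a)" by simp
  have E_nonneg: "0 \<le> E y" for y unfolding E_def by (intro add_nonneg_nonneg sum_nonneg) auto
  have X_bound: "norm (X y - X a) \<le> K * E y * (1 + norm (X y))" if "y \<in> V" for y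
  proof -
    have eb: "\<bar>e b y\<bar> \<le> \<bar>h y b - h a b\<bar> + (\<Sum>c\<in>Basis. norm (X y) * \<bar>g y c b - g a c b\<bar>)" for b
    proof -
      have "\<bar>e b y\<bar> \<le> \<bar>h y b - h a b\<bar> + \<bar>\<Sum>c\<in>Basis. (X y \<bullet> c) * (g y c b - g a c b)\<bar>"
        unfolding e_def by (rule abs_triangle_ineq4)
      also have "\<bar>\<Sum>c\<in>Basis. (X y \<bullet> c) * (g y c b - g a c b)\<bar> \<le> (\<Sum>c\<in>Basis. norm (X y) * \<bar>g y c b - g a c b\<bar>)"
        by (rule order_trans[OF sum_abs]) (auto simp: abs_mult intro!: sum_mono mult_right_mono Basis_le_norm)
      finally show ?thesis by simp
    qed
    have "norm (X y - X a) \<le> norm (\<Sum>b\<in>Basis. e b y *\<^sub>R b) * K"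
      using K(2)[of "\<Sum>b\<in>Basis. e b y *\<^sub>R b"] X_rep[OF that] by simp
    also have "\<dots> \<le> (E y * (1 + norm (X y))) * K"
    proof (rule mult_right_mono)
      have "norm (\<Sum>b\<in>Basis. e b y *\<^sub>R b) \<le> (\<Sum>b\<in>Basis. \<bar>e b y\<bar>)"
        by (rule order_trans[OF norm_sum]) simp
      also have "\<dots> \<le> (\<Sum>b\<in>Basis. \<bar>h y b - h a b\<bar> + (\<Sum>c\<in>Basis. norm (X y) * \<bar>g y c b - g a c b\<bar>))"
        by (intro sum_mono eb)
      also have "\<dots> = (\<Sum>b\<in>Basis. \<bar>h y b - h a b\<bar>) * 1 + norm (X y) * (\<Sum>b\<in>Basis. \<Sum>c\<in>Basis. \<bar>g y c b - g a c b\<bar>)"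
        by (simp add: sum.distrib sum_distrib_left)
      also have "\<dots> \<le> E y * 1 + norm (X y) * E y"
        unfolding E_def by (intro add_mono mult_left_mono mult_right_mono) (auto intro!: sum_nonneg)
      finally show "norm (\<Sum>b\<in>Basis. e b y *\<^sub>R b) \<le> E y * (1 + norm (X y))"
        by (simp add: algebra_simps)
    qed (use K in simp)
    finally show ?thesis by (simp add: algebra_simps)
  qed
  have ev_V: "\<forall>\<^sub>F y in at a. y \<in> V" using V by (rule eventually_at_in_open')
  have "((\<lambda>y. K * E y) \<longlongrightarrow> K * 0) (at a)" by (intro tendsto_intros E0)
  then have "\<forall>\<^sub>F y in at a. K * E y < 1 / 2" by (rule order_tendstoD) simp
  \<comment> \<open>\<open>X_bound\<close> still contains X y on the right. Near \<open>a\<close>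
    the coefficient \<open>K * E y\<close> is below 1/2, so the share of norm (X y - X a) is
    absorbed into the left side.\<close>
  with ev_V have ev: "\<forall>\<^sub>F y in at a. norm (X y - X a) \<le> 2 * (K * E y * (1 + norm (X a)))"
  proof eventually_elim
    case (elim y)
    have "norm (X y) \<le> norm (X a) + norm (X y - X a)" using norm_triangle_sub by blast
    then have "norm (X y - X a) \<le> K * E y * (1 + (norm (X a) + norm (X y - X a)))"
      using order_trans[OF X_bound[OF elim(1)] mult_left_mono[of "1 + norm (X y)" _ "K * E y"]] K(1) E_nonneg[of y]
      by simp
    also have "\<dots> = K * E y * (1 + norm (X a)) + K * E y * norm (X y - X a)"
      by (simp add: algebra_simps)
    also have "K * E y * norm (X y - X a) \<le> 1 / 2 * norm (X y - X a)"
      using elim(2) by (intro mult_right_mono) auto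
    finally show ?case by simp
  qed
  have "((\<lambda>y. 2 * (K * E y * (1 + norm (X a)))) \<longlongrightarrow> 2 * (K * 0 * (1 + norm (X a)))) (at a)"
    by (intro tendsto_intros E0)
  then have lim: "((\<lambda>y. 2 * (K * E y * (1 + norm (X a)))) \<longlongrightarrow> 0) (at a)" by simp
  have "((\<lambda>y. norm (X y - X a)) \<longlongrightarrow> 0) (at a)"
    by (rule tendsto_sandwich[OF _ ev tendsto_const lim]) simp
  then have cont: "isCont X a"
    unfolding isCont_def using LIM_zero_iff tendsto_norm_zero_iff by blast
  \<comment> \<open>Each summand of \<open>e b\<close> is a continuous coordinate of
    \<open>X\<close> times a differentiable function vanishing at \<open>a\<close>, so continuity of
    \<open>X\<close> suffices here.\<close>
  have "\<exists>D. (e b has_derivative D) (at a)" for b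
  proof -
    have "((\<lambda>y. (X y \<bullet> c) *\<^sub>R (g y c b - g a c b)) has_derivative
        (\<lambda>k. (X a \<bullet> c) *\<^sub>R (frechet_derivative (\<lambda>y. g y c b) (at a) k - 0))) (at a)" for c
      using cont by (intro has_derivative_scaleR_vanishing has_derivative_diff has_derivative_const
          differentiable_has_frechet dg) (auto intro: continuous_intros)
    then have "(e b has_derivative (\<lambda>k. frechet_derivative (\<lambda>y. h y b) (at a) k - 0 -
        (\<Sum>c\<in>Basis. (X a \<bullet> c) *\<^sub>R (frechet_derivative (\<lambda>y. g y c b) (at a) k - 0)))) (at a)"
      unfolding e_def real_scaleR_def[symmetric]
      by (intro has_derivative_diff has_derivative_sum differentiable_has_frechet[OF dh] has_derivative_const)
    then show ?thesis by blast
  qed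
  then obtain D where D: "\<And>b. (e b has_derivative D b) (at a)" by metis
  have "((\<lambda>y. X a + S (\<Sum>b\<in>Basis. e b y *\<^sub>R b)) has_derivative (\<lambda>k. 0 + S (\<Sum>b\<in>Basis. D b k *\<^sub>R b))) (at a)"
    by (intro has_derivative_add has_derivative_const bounded_linear.has_derivative[OF S']
        has_derivative_sum has_derivative_scaleR_left D)
  then have "(X has_derivative (\<lambda>k. 0 + S (\<Sum>b\<in>Basis. D b k *\<^sub>R b))) (at a)"
    by (rule has_derivative_transform_within_open[OF _ V]) (simp add: X_rep)
  then show X_diff: "X differentiable (at a)" by (rule differentiableI)
  let ?X' = "frechet_derivative X (at a)"
  have "((\<lambda>y. \<Sum>c\<in>Basis. (X y \<bullet> c) * g y c z) has_derivative
      (\<lambda>k. \<Sum>c\<in>Basis. (X a \<bullet> c) * frechet_derivative (\<lambda>y. g y c z) (at a) k + (?X' k \<bullet> c) * g a c z)) (at a)"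
    by (intro has_derivative_sum has_derivative_mult has_derivative_inner_left
        differentiable_has_frechet X_diff dg)
  moreover have "(\<Sum>c\<in>Basis. (X y \<bullet> c) * g y c z) = h y z" if "y \<in> V" for y
    using eq[OF that, of z] expand[OF that, of "X y" z] by simp
  ultimately have 1: "((\<lambda>y. h y z) has_derivative
      (\<lambda>k. \<Sum>c\<in>Basis. (X a \<bullet> c) * frechet_derivative (\<lambda>y. g y c z) (at a) k + (?X' k \<bullet> c) * g a c z)) (at a)"
    using has_derivative_transform_within_open[OF _ V] by (metis (no_types, lifting))
  have "((\<lambda>y. \<Sum>c\<in>Basis. (X a \<bullet> c) * g y c z) has_derivative
      (\<lambda>k. \<Sum>c\<in>Basis. (X a \<bullet> c) * frechet_derivative (\<lambda>y. g y c z) (at a) k)) (at a)"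
    by (intro has_derivative_sum has_derivative_mult_right differentiable_has_frechet dg)
  then have 2: "((\<lambda>y. g y (X a) z) has_derivative
      (\<lambda>k. \<Sum>c\<in>Basis. (X a \<bullet> c) * frechet_derivative (\<lambda>y. g y c z) (at a) k)) (at a)"
    by (rule has_derivative_transform_within_open[OF _ V]) (simp add: expand)
  show "frechet_derivative (\<lambda>y. g y (X a) z) (at a) u + g a (?X' u) z
      = frechet_derivative (\<lambda>y. h y z) (at a) u"
    unfolding frechet_eqI[OF 1] frechet_eqI[OF 2] expand[OF V(2), of "?X' u"]
    by (simp add: sum.distrib)
qed

section \<open>Transition maps and charts of the tangent bundle\<close>

lemma chart_inv_eq: "inj_on (snd c) (fst c) \<Longrightarrow> x \<in> fst c \<Longrightarrow> chart_inv c (snd c x) = x"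
  by (simp add: chart_inv_def)

text \<open>Indexed by the point of the manifold instead of its coordinates, so that the cocycle
  rule \<open>transition_compose\<close> needs no change of argument. \<open>dchart\<close> and
  \<open>dchart_inv\<close> are the cases with a base chart on one side.\<close>

definition transition ::
  "('m, 'e::real_normed_vector) chart \<Rightarrow> ('m, 'e) chart \<Rightarrow> 'm \<Rightarrow> 'e \<Rightarrow> 'e" where
  "transition c d x = frechet_derivative (snd d \<circ> chart_inv c) (at (snd c x))"

locale manifold =
  fixes M :: "('m::{t2_space, second_countable_topology}, 'e::euclidean_space) riemannian"
  assumes smooth_manifold: "smooth_manifold M"
begin

abbreviation base :: "'m \<Rightarrow> ('m, 'e) chart" where "base \<equiv> base_chart M"

lemma base_atlas: "base x \<in> atlas M" and base_dom: "x \<in> fst (base x)"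
  using smooth_manifold by (auto simp: smooth_manifold_def)

lemma base_chart_at_base_pt: "chart_inv (base x) (base_pt M x) = x"
  unfolding base_pt_def using base_atlas[of x] base_dom[of x] smooth_manifold
  by (auto simp: smooth_manifold_def is_chart_def homeomorphism_def)

lemma
  assumes "c \<in> atlas M"
  shows chart_homeomorphism: "homeomorphism (fst c) (snd c ` fst c) (snd c) (chart_inv c)"
    and open_chart_dom: "open (fst c)"
    and open_chart_image: "open (snd c ` fst c)"
  using assms smooth_manifold by (auto simp: smooth_manifold_def is_chart_def)

lemma chart_inv_left: "c \<in> atlas M \<Longrightarrow> x \<in> fst c \<Longrightarrow> chart_inv c (snd c x) = x"
  using chart_homeomorphism by (auto simp: homeomorphism_def)

lemma inj_on_chart: "c \<in> atlas M \<Longrightarrow> inj_on (snd c) (fst c)"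
  by (metis chart_inv_left inj_onI)

lemma open_overlap:
  assumes "c \<in> atlas M" "d \<in> atlas M"
  shows "open (snd c ` (fst c \<inter> fst d))"
proof -
  have "snd c ` (fst c \<inter> fst d) = snd c ` fst c \<inter> chart_inv c -` fst d"
    using chart_inv_left[OF assms(1)] by force
  moreover have "open (snd c ` fst c \<inter> chart_inv c -` fst d)"
    using chart_homeomorphism[OF assms(1)] open_chart_image[OF assms(1)] open_chart_dom[OF assms(2)]
    by (intro continuous_open_preimage) (auto simp: homeomorphism_def)
  ultimately show ?thesis by simp
qed

lemma Ck_transition:
  "c \<in> atlas M \<Longrightarrow> d \<in> atlas M \<Longrightarrow> Ck_on k (snd c ` (fst c \<inter> fst d)) (snd d \<circ> chart_inv c)"
  using smooth_manifold by (auto simp: smooth_manifold_def)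

lemma has_derivative_transition:
  assumes "c \<in> atlas M" "d \<in> atlas M" "x \<in> fst c" "x \<in> fst d"
  shows "((snd d \<circ> chart_inv c) has_derivative transition c d x) (at (snd c x))"
proof -
  have "Ck_on 1 (snd c ` (fst c \<inter> fst d)) (snd d \<circ> chart_inv c)"
    using Ck_transition[OF assms(1,2)] .
  then show ?thesis
    unfolding transition_def using assms(3,4) by (intro differentiable_has_frechet) auto
qed

lemma linear_transition:
  "c \<in> atlas M \<Longrightarrow> d \<in> atlas M \<Longrightarrow> x \<in> fst c \<Longrightarrow> x \<in> fst d \<Longrightarrow> linear (transition c d x)"
  using has_derivative_transition has_derivative_linear by blast

lemma has_derivative_change_chart:
  assumes "c \<in> atlas M" "d \<in> atlas M" "x \<in> fst c" "x \<in> fst d"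
    and "(F \<circ> chart_inv d) differentiable (at (snd d x))"
  shows "((F \<circ> chart_inv c) has_derivative
    frechet_derivative (F \<circ> chart_inv d) (at (snd d x)) \<circ> transition c d x) (at (snd c x))"
proof (rule has_derivative_transform_within_open[OF _ open_overlap[OF assms(1,2)]])
  have x: "(snd d \<circ> chart_inv c) (snd c x) = snd d x"
    using chart_inv_left[OF assms(1,3)] by simp
  show "((F \<circ> chart_inv d) \<circ> (snd d \<circ> chart_inv c) has_derivative
      frechet_derivative (F \<circ> chart_inv d) (at (snd d x)) \<circ> transition c d x) (at (snd c x))"
    using has_derivative_transition[OF assms(1-4)] differentiable_has_frechet[OF assms(5)]
    by (intro diff_chain_at) (simp_all only: x)
  show "snd c x \<in> snd c ` (fst c \<inter> fst d)" using assms by blast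
  show "((F \<circ> chart_inv d) \<circ> (snd d \<circ> chart_inv c)) a = (F \<circ> chart_inv c) a"
    if "a \<in> snd c ` (fst c \<inter> fst d)" for a
    using that chart_inv_left[OF assms(1)] chart_inv_left[OF assms(2)] by auto
qed

lemma transition_compose:
  assumes "c \<in> atlas M" "d \<in> atlas M" "e \<in> atlas M" "x \<in> fst c" "x \<in> fst d" "x \<in> fst e"
  shows "transition d e x (transition c d x u) = transition c e x u"
proof -
  have "(snd e \<circ> chart_inv d) differentiable (at (snd d x))"
    using has_derivative_transition[OF assms(2,3,5,6)] by (rule differentiableI)
  from frechet_eqI[OF has_derivative_change_chart[OF assms(1,2,4,5) this]]
  show ?thesis by (simp add: transition_def)
qed

lemma transition_self:
  assumes "c \<in> atlas M" "x \<in> fst c"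
  shows "transition c c x u = u"
proof -
  have "((snd c \<circ> chart_inv c) has_derivative id) (at (snd c x))"
    by (rule has_derivative_transform_within_open[OF has_derivative_id open_chart_image[OF assms(1)]])
      (use assms chart_inv_left[OF assms(1)] in auto)
  from frechet_eqI[OF this] show ?thesis by (simp add: transition_def)
qed

lemma dchart_eq: "dchart M c x = transition (base x) c x"
  by (simp add: dchart_def transition_def base_pt_def)

lemma dchart_inv_eq:
  assumes "c \<in> atlas M" "x \<in> fst c"
  shows "dchart_inv M c (snd c x) = transition c (base x) x"
  using chart_inv_left[OF assms] by (simp add: dchart_inv_def transition_def)

lemma dchart_inverse:
  assumes "c \<in> atlas M" "x \<in> fst c"
  shows "dchart M c x (dchart_inv M c (snd c x) u) = u"
    and "dchart_inv M c (snd c x) (dchart M c x u) = u"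
  unfolding dchart_eq dchart_inv_eq[OF assms]
  using assms base_atlas base_dom by (simp_all add: transition_compose transition_self)

lemma linear_dchart: "c \<in> atlas M \<Longrightarrow> x \<in> fst c \<Longrightarrow> linear (dchart M c x)"
  unfolding dchart_eq using base_atlas base_dom by (intro linear_transition)

lemma linear_dchart_inv: "c \<in> atlas M \<Longrightarrow> x \<in> fst c \<Longrightarrow> linear (dchart_inv M c (snd c x))"
  by (simp add: dchart_inv_eq base_atlas base_dom linear_transition)

lemma tangent_chart_inv:
  assumes "c \<in> atlas M" "x \<in> fst c"
  shows "chart_inv (fst c \<times> UNIV, \<lambda>(x, u). (snd c x, dchart M c x u)) (snd c x, dchart M c x u) = (x, u)"
proof -
  have "inj_on (\<lambda>(x, u). (snd c x, dchart M c x u)) (fst c \<times> UNIV)"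
  proof (rule inj_onI, clarsimp)
    fix y u z w assume "y \<in> fst c" "z \<in> fst c" "snd c y = snd c z" "dchart M c y u = dchart M c z w"
    then show "y = z \<and> u = w"
      using assms(1) by (metis chart_inv_left dchart_inverse(2))
  qed
  from chart_inv_eq[of "(fst c \<times> UNIV, \<lambda>(x, u). (snd c x, dchart M c x u))" "(x, u)"] this
  show ?thesis using assms(2) by simp
qed

lemma tangent2_chart_inv:
  assumes "c \<in> atlas M" "x \<in> fst c"
  shows "chart_inv (fst c \<times> UNIV, \<lambda>(x, u, w). (snd c x, dchart M c x u, dchart M c x w))
    (snd c x, dchart M c x u, dchart M c x w) = (x, u, w)"
proof -
  have "inj_on (\<lambda>(x, u, w). (snd c x, dchart M c x u, dchart M c x w)) (fst c \<times> UNIV)"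
  proof (rule inj_onI, clarsimp)
    fix y u u' z w w' assume "y \<in> fst c" "z \<in> fst c" "snd c y = snd c z"
      "dchart M c y u = dchart M c z w" "dchart M c y u' = dchart M c z w'"
    then show "y = z \<and> u = w \<and> u' = w'"
      using assms(1) by (metis chart_inv_left dchart_inverse(2))
  qed
  from chart_inv_eq[of "(fst c \<times> UNIV, \<lambda>(x, u, w). (snd c x, dchart M c x u, dchart M c x w))" "(x, u, w)"] this
  show ?thesis using assms(2) by simp
qed

text \<open>\<open>Ck_map\<close> provides regularity only in some chart around each point; smooth
  transition maps carry it over to a prescribed chart.\<close>

lemma Ck_on_change_chart:
  assumes "c \<in> atlas M" "d \<in> atlas M" "x \<in> fst c" "x \<in> fst d"
    and "open W" "snd d x \<in> W" "Ck_on k W (F \<circ> chart_inv d)"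
  obtains V where "open V" "snd c x \<in> V" "V \<subseteq> snd c ` (fst c \<inter> fst d)" "Ck_on k V (F \<circ> chart_inv c)"
proof
  let ?O = "snd c ` (fst c \<inter> fst d)" and ?t = "snd d \<circ> chart_inv c"
  define V where "V = ?O \<inter> ?t -` W"
  show "open V" unfolding V_def
    using open_overlap[OF assms(1,2)] Ck_on_imp_continuous[OF Ck_transition[OF assms(1,2)]] assms(5)
    by (intro continuous_open_preimage)
  show "snd c x \<in> V" using assms chart_inv_left[OF assms(1,3)] by (auto simp: V_def)
  show "V \<subseteq> ?O" by (simp add: V_def)
  have "Ck_on k V ((F \<circ> chart_inv d) \<circ> ?t)"
    using \<open>open V\<close> Ck_on_subset[OF Ck_transition[OF assms(1,2)]] assms(7)
    by (intro Ck_on_compose[where T = W]) (auto simp: V_def)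
  then show "Ck_on k V (F \<circ> chart_inv c)"
    by (rule Ck_on_cong[OF \<open>open V\<close>, rotated]) (use chart_inv_left[OF assms(1)] chart_inv_left[OF assms(2)] in \<open>auto simp: V_def\<close>)
qed

lemma Ck_map_real_chart:
  assumes "Ck_map k (atlas M) real_atlas f" "c \<in> atlas M" "x \<in> fst c"
  obtains V where "open V" "snd c x \<in> V" "V \<subseteq> snd c ` fst c" "Ck_on k V (f \<circ> chart_inv c)"
proof -
  obtain d W where d: "d \<in> atlas M" "x \<in> fst d" "open W" "snd d x \<in> W" "Ck_on k W (f \<circ> chart_inv d)"
  proof -
    from assms(1) obtain d D W where "d \<in> atlas M" "D \<in> real_atlas" "x \<in> fst d" "open W" "snd d x \<in> W"
        "Ck_on k W (snd D \<circ> f \<circ> chart_inv d)"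
      unfolding Ck_map_def by blast
    with that show ?thesis by (simp add: real_atlas_def)
  qed
  obtain V where "open V" "snd c x \<in> V" "V \<subseteq> snd c ` (fst c \<inter> fst d)" "Ck_on k V (f \<circ> chart_inv c)"
    by (rule Ck_on_change_chart[OF assms(2) d(1) assms(3) d(2-5)])
  then show ?thesis by (intro that) auto
qed

text \<open>Smoothness of \<open>R\<close> refers to some chart of the tangent bundle around (x, 0).
  In it the fibre over x is an affine subspace, so the restriction of \<open>R\<close> to the fibre
  is again of class C^k; its values are then read in the base chart.\<close>

lemma retraction_chart:
  assumes "manifold_retraction M R"
  obtains U where "open U" "0 \<in> U" "\<And>u. u \<in> U \<Longrightarrow> R (x, u) \<in> fst (base x)"
    "Ck_on k U (\<lambda>u. snd (base x) (R (x, u)))"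
proof -
  have R0: "R (x, 0) = x" and "Ck_map k (tangent_atlas M) (atlas M) R"
    using assms by (auto simp: manifold_retraction_def smooth_map_def)
  then obtain C d W where C: "C \<in> tangent_atlas M" "d \<in> atlas M" "(x, 0) \<in> fst C" "R (x, 0) \<in> fst d"
      "open W" "snd C (x, 0) \<in> W" "R ` chart_inv C ` W \<subseteq> fst d" "Ck_on k W (snd d \<circ> R \<circ> chart_inv C)"
    unfolding Ck_map_def by blast
  obtain c where c: "c \<in> atlas M" and C_eq: "C = (fst c \<times> UNIV, \<lambda>(x, u). (snd c x, dchart M c x u))"
    using C(1) by (auto simp: tangent_atlas_def)
  have x: "x \<in> fst c" "x \<in> fst d" using C(3,4) R0 by (auto simp: C_eq)
  \<comment> \<open>The inclusion u \<mapsto> (x, u) of the fibre, in the coordinates of the chart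
    \<open>C\<close>.\<close>
  define L where "L u = (snd c x, 0) + (0, dchart M c x u)" for u
  have L: "chart_inv C (L u) = (x, u)" for u
    using tangent_chart_inv[OF c x(1), of u] by (simp add: C_eq L_def)
  have bl: "bounded_linear (\<lambda>u. (0 :: 'e, dchart M c x u))"
    using linear_dchart[OF c x(1)] by (intro bounded_linear_Pair bounded_linear_zero)
      (simp add: linear_conv_bounded_linear)
  have L_Ck: "Ck_on k S L" if "open S" for S k
    unfolding L_def using Ck_on_affine[OF that bl] .
  define U0 where "U0 = L -` W"
  have "open U0"
    using continuous_open_preimage[OF Ck_on_imp_continuous[OF L_Ck[of UNIV]] open_UNIV C(5)]
    by (simp add: U0_def)
  have "0 \<in> U0" using C(6) linear_0[OF linear_dchart[OF c x(1)]] by (simp add: U0_def L_def C_eq)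
  have in_d: "R (x, u) \<in> fst d" if "u \<in> U0" for u
  proof -
    have "R (chart_inv C (L u)) \<in> fst d" using that C(7) by (auto simp: U0_def)
    then show ?thesis by (simp add: L)
  qed
  have "Ck_on k U0 ((snd d \<circ> R \<circ> chart_inv C) \<circ> L)"
    using \<open>open U0\<close> by (intro Ck_on_compose[OF _ _ L_Ck C(8)]) (auto simp: U0_def)
  then have R_d: "Ck_on k U0 (\<lambda>u. snd d (R (x, u)))"
    by (rule Ck_on_cong[OF \<open>open U0\<close>, rotated]) (simp add: L)
  \<comment> \<open>The target chart \<open>d\<close> can be exchanged for the base chart only on
    their overlap; injectivity of \<open>d\<close> brings membership in \<open>D\<close> back to the
    manifold.\<close>
  define D where "D = snd d ` (fst d \<inter> fst (base x))"
  have "open D" using open_overlap C(2) base_atlas by (simp add: D_def)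
  define U where "U = U0 \<inter> (\<lambda>u. snd d (R (x, u))) -` D"
  show ?thesis
  proof
    show "open U" unfolding U_def
      by (rule continuous_open_preimage[OF Ck_on_imp_continuous[OF R_d] \<open>open U0\<close> \<open>open D\<close>])
    show "0 \<in> U" using \<open>0 \<in> U0\<close> x(2) base_dom R0 by (auto simp: U_def D_def)
    show in_base: "R (x, u) \<in> fst (base x)" if "u \<in> U" for u
    proof -
      have "u \<in> U0" "snd d (R (x, u)) \<in> D" using that by (simp_all add: U_def)
      moreover from this(2) obtain y where "y \<in> fst d" "y \<in> fst (base x)" "snd d (R (x, u)) = snd d y"
        unfolding D_def by blast
      ultimately have "R (x, u) = y" using inj_onD[OF inj_on_chart[OF C(2)] _ in_d] by blast
      then show ?thesis using \<open>y \<in> fst (base x)\<close> by simp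
    qed
    have "Ck_on k U ((snd (base x) \<circ> chart_inv d) \<circ> (\<lambda>u. snd d (R (x, u))))"
      using Ck_on_compose[OF \<open>open U\<close> _ Ck_on_subset[OF R_d] Ck_transition[OF C(2) base_atlas]]
      by (auto simp: U_def D_def)
    then show "Ck_on k U (\<lambda>u. snd (base x) (R (x, u)))"
      by (rule Ck_on_cong[OF \<open>open U\<close>, rotated]) (use in_d chart_inv_left[OF C(2)] in \<open>auto simp: U_def\<close>)
  qed
qed

end

section \<open>The Hessian and the pullback along a second-order retraction\<close>

locale riemannian = manifold M
  for M :: "('m::{t2_space, second_countable_topology}, 'e::euclidean_space) riemannian" +
  assumes riem_bilinear: "bilinear (riem_metric M x)"
    and riem_sym: "riem_metric M x u w = riem_metric M x w u"
    and riem_pos: "u \<noteq> 0 \<Longrightarrow> 0 < riem_metric M x u u"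
    and riem_smooth: "smooth_map (tangent2_atlas M) real_atlas (\<lambda>(x, u, w). riem_metric M x u w)"

lemma riemannian_manifold_locale: "riemannian_manifold M \<Longrightarrow> riemannian M"
  unfolding riemannian_manifold_def by unfold_locales auto

section \<open>The coordinate metric and its Christoffel map\<close>

context riemannian
begin

sublocale inner_form "riem_metric M x" for x
  by unfold_locales (simp_all add: riem_bilinear riem_sym riem_pos)

abbreviation cm :: "'m \<Rightarrow> 'e \<Rightarrow> 'e \<Rightarrow> 'e \<Rightarrow> real" where "cm \<equiv> coord_metric M"

lemma coord_metric_chart:
  assumes "y \<in> fst (base x)"
  shows "cm x u w (snd (base x) y)
    = riem_metric M y (dchart_inv M (base x) (snd (base x) y) u) (dchart_inv M (base x) (snd (base x) y) w)"
  using chart_inv_left[OF base_atlas assms] by (simp add: coord_metric_def Let_def)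

lemma coord_metric_sym: "cm x u w a = cm x w u a"
  by (simp add: coord_metric_def Let_def riem_sym)

lemma coord_metric_base: "cm x u w (base_pt M x) = riem_metric M x u w"
  using coord_metric_chart[OF base_dom, of x u w] dchart_inv_eq[OF base_atlas base_dom, of x]
  by (simp add: base_pt_def transition_self[OF base_atlas base_dom])

lemma open_base_image: "open (snd (base x) ` fst (base x))"
  and base_pt_in: "base_pt M x \<in> snd (base x) ` fst (base x)"
  using open_chart_image[OF base_atlas] base_dom by (auto simp: base_pt_def)

lemma linear_coord_metric:
  assumes "a \<in> snd (base x) ` fst (base x)"
  shows "linear (\<lambda>u. cm x u w a)"
proof -
  obtain y where y: "y \<in> fst (base x)" "a = snd (base x) y" using assms by blast
  have "linear (\<lambda>u. riem_metric M y (dchart_inv M (base x) a u) (dchart_inv M (base x) a w))"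
    using linear_dchart_inv[OF base_atlas y(1)] bilinear_ladd[OF riem_bilinear] bilinear_lmul[OF riem_bilinear]
    unfolding y(2) by (simp add: linear_iff)
  then show ?thesis using coord_metric_chart[OF y(1)] by (simp add: y(2))
qed

text \<open>Smoothness of the metric is available in some chart \<open>e\<close> near x. With t the
  transition from the base chart to \<open>e\<close>, the coordinate metric is that smooth
  expression after a \<mapsto> (t(a), Dt(a)u, Dt(a)w), which is the map \<open>h\<close>.\<close>

lemma coord_metric_differentiable: "cm x u w differentiable (at (base_pt M x))"
proof -
  let ?g = "\<lambda>(x, u, w). riem_metric M x u w"
  have "Ck_map 1 (tangent2_atlas M) real_atlas ?g"
    using riem_smooth by (simp add: smooth_map_def)
  then obtain C D W where C: "C \<in> tangent2_atlas M" "D \<in> real_atlas" "(x, u, w) \<in> fst C"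
      "open W" "snd C (x, u, w) \<in> W" "Ck_on 1 W (snd D \<circ> ?g \<circ> chart_inv C)"
    unfolding Ck_map_def by blast
  then obtain e where e: "e \<in> atlas M"
    and C_eq: "C = (fst e \<times> UNIV, \<lambda>(x, u, w). (snd e x, dchart M e x u, dchart M e x w))"
    by (auto simp: tangent2_atlas_def)
  have Ck: "Ck_on 1 W (?g \<circ> chart_inv C)" using C(2,6) by (simp add: real_atlas_def)
  have x: "x \<in> fst e" using C(3) by (simp add: C_eq)
  define t where "t = snd e \<circ> chart_inv (base x)"
  let ?O = "snd (base x) ` (fst (base x) \<inter> fst e)"
  define h where "h a = (t a, nderiv t [u] a, nderiv t [w] a)" for a
  have t: "Ck_on k ?O t" for k unfolding t_def using Ck_transition[OF base_atlas e] .
  have O: "open ?O" "base_pt M x \<in> ?O"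
    using open_overlap[OF base_atlas e] x base_dom by (auto simp: base_pt_def)
  have tr: "nderiv t [u] (snd (base x) y) = transition (base x) e y u" for y u
    by (simp add: t_def transition_def)
  have h_y: "h (snd (base x) y) = (snd e y, transition (base x) e y u, transition (base x) e y w)"
    if "y \<in> fst (base x)" for y
    using chart_inv_left[OF base_atlas that] by (simp only: h_def tr) (simp add: t_def)
  have h_base: "h (base_pt M x) = snd C (x, u, w)"
    using h_y[OF base_dom] by (simp add: base_pt_def C_eq dchart_eq)
  have d: "nderiv t us differentiable (at (base_pt M x))" for us
    using nderiv_differentiable[OF t[of "Suc (length us)"] _ O(2)] by simp
  obtain D1 D2 D3 where "(t has_derivative D1) (at (base_pt M x))"
      "(nderiv t [u] has_derivative D2) (at (base_pt M x))"
      "(nderiv t [w] has_derivative D3) (at (base_pt M x))"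
    using d[of "[]"] d[of "[u]"] d[of "[w]"] unfolding differentiable_def by auto
  then have "(h has_derivative (\<lambda>k. (D1 k, D2 k, D3 k))) (at (base_pt M x))"
    unfolding h_def by (intro has_derivative_Pair)
  then have h: "h differentiable (at (base_pt M x))" by (rule differentiableI)
  have "(?g \<circ> chart_inv C) differentiable (at (h (base_pt M x)))"
    using Ck C(5) h_base by simp
  then have "((?g \<circ> chart_inv C) \<circ> h) differentiable (at (base_pt M x))"
    using h by (rule differentiable_chain_at[rotated])
  moreover have "((?g \<circ> chart_inv C) \<circ> h) a = cm x u w a" if "a \<in> ?O" for a
  proof -
    obtain y where y: "y \<in> fst (base x)" "y \<in> fst e" "a = snd (base x) y" using \<open>a \<in> ?O\<close> by blast
    let ?i = "dchart_inv M (base x) a"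
    have "transition (base x) e y u = dchart M e y (?i u)" for u
      unfolding dchart_eq y(3) dchart_inv_eq[OF base_atlas y(1)]
      by (simp add: transition_compose base_atlas base_dom e y)
    then have "h a = (snd e y, dchart M e y (?i u), dchart M e y (?i w))"
      using h_y[OF y(1)] y(3) by simp
    then have "chart_inv C (h a) = (y, ?i u, ?i w)"
      using tangent2_chart_inv[OF e y(2)] by (simp add: C_eq)
    then show ?thesis using coord_metric_chart[OF y(1)] y(3) by simp
  qed
  ultimately show ?thesis using differentiable_cong_open[OF O] by blast
qed

abbreviation dcm :: "'m \<Rightarrow> 'e \<Rightarrow> 'e \<Rightarrow> 'e \<Rightarrow> real" where
  "dcm x u w \<equiv> frechet_derivative (cm x u w) (at (base_pt M x))"

lemma linear_dcm: "linear (dcm x u w)"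
  using coord_metric_differentiable by (rule linear_frechet_derivative)

lemma linear_dcm_left: "linear (\<lambda>u. dcm x u w k)"
proof -
  have d: "(cm x u w has_derivative dcm x u w) (at (base_pt M x))" for u w
    using coord_metric_differentiable by (rule differentiable_has_frechet)
  have "dcm x (u + v) w k = dcm x u w k + dcm x v w k" for u v
  proof -
    have "((\<lambda>a. cm x u w a + cm x v w a) has_derivative (\<lambda>k. dcm x u w k + dcm x v w k)) (at (base_pt M x))"
      by (intro has_derivative_add d)
    then have "(cm x (u + v) w has_derivative (\<lambda>k. dcm x u w k + dcm x v w k)) (at (base_pt M x))"
      by (rule has_derivative_transform_within_open[OF _ open_base_image base_pt_in])
        (simp add: linear_add[OF linear_coord_metric])
    from frechet_eqI[OF this] show ?thesis by simp
  qed
  moreover have "dcm x (r *\<^sub>R u) w k = r * dcm x u w k" for r u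
  proof -
    have "((\<lambda>a. r * cm x u w a) has_derivative (\<lambda>k. r * dcm x u w k)) (at (base_pt M x))"
      by (intro has_derivative_mult_right d)
    then have "(cm x (r *\<^sub>R u) w has_derivative (\<lambda>k. r * dcm x u w k)) (at (base_pt M x))"
      by (rule has_derivative_transform_within_open[OF _ open_base_image base_pt_in])
        (simp add: linear_scale[OF linear_coord_metric])
    from frechet_eqI[OF this] show ?thesis by simp
  qed
  ultimately show ?thesis by (simp add: linear_iff)
qed

lemma linear_dcm_right: "linear (\<lambda>w. dcm x u w k)"
proof -
  have "cm x u w = cm x w u" for w by (rule ext) (rule coord_metric_sym)
  then show ?thesis using linear_dcm_left[of x u k] by simp
qed

text \<open>The right side is linear in \<open>z\<close>, so by \<open>riesz\<close> the definite
  description in \<open>christoffel\<close> is satisfied.\<close>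

lemma christoffel_eq:
  "2 * riem_metric M x (christoffel M x u w) z = dcm x w z u + dcm x u z w - dcm x u w z"
proof -
  define l where "l z = (dcm x w z u + dcm x u z w - dcm x u w z) / 2" for z
  have "linear l"
    unfolding l_def linear_iff
    using linear_dcm_right[of x w u] linear_dcm_right[of x u w] linear_dcm[of x u w]
    by (auto simp: linear_iff field_simps)
  then have ex: "\<exists>!y. \<forall>z. riem_metric M x y z = l z" by (rule riesz)
  have "(\<forall>z. 2 * riem_metric M x y z = dcm x w z u + dcm x u z w - dcm x u w z)
      \<longleftrightarrow> (\<forall>z. riem_metric M x y z = l z)" for y
    by (simp add: l_def field_simps)
  then have "christoffel M x u w = (THE y. \<forall>z. riem_metric M x y z = l z)"
    unfolding christoffel_def by simp
  then have "riem_metric M x (christoffel M x u w) z = l z"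
    using theI'[OF ex] by simp
  then show ?thesis by (simp add: l_def)
qed

section \<open>Gradient, Hessian and pullback in the base chart\<close>

context
  fixes f :: "'m \<Rightarrow> real" and p :: nat
  assumes f: "Ck_map p (atlas M) real_atlas f" and p: "2 \<le> p"
begin

abbreviation coord_f :: "'m \<Rightarrow> 'e \<Rightarrow> real" where "coord_f x \<equiv> f \<circ> chart_inv (base x)"

lemma f_chart_differentiable:
  assumes "c \<in> atlas M" "y \<in> fst c"
  shows "(f \<circ> chart_inv c) differentiable (at (snd c y))"
proof -
  obtain V where "snd c y \<in> V" "Ck_on p V (f \<circ> chart_inv c)"
    by (rule Ck_map_real_chart[OF f assms])
  then show ?thesis using nderiv_differentiable[of p V _ "[]"] p by simp
qed

lemma coord_f_Ck:
  obtains V where "open V" "base_pt M x \<in> V" "V \<subseteq> snd (base x) ` fst (base x)" "Ck_on p V (coord_f x)"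
  using Ck_map_real_chart[OF f base_atlas base_dom] unfolding base_pt_def by blast

lemma riem_grad:
  "riem_metric M x (grad M f x) u = nderiv (coord_f x) [u] (base_pt M x)"
proof -
  have "linear (frechet_derivative (coord_f x) (at (base_pt M x)))"
    using f_chart_differentiable[OF base_atlas base_dom] unfolding base_pt_def
    by (rule linear_frechet_derivative)
  from theI'[OF riesz[OF this]] show ?thesis unfolding grad_def by simp
qed

text \<open>The gradient field as read in the base chart at x: the function that
  \<open>cov_deriv\<close> differentiates in the Hessian.\<close>

definition coord_grad :: "'m \<Rightarrow> 'e \<Rightarrow> 'e" where
  "coord_grad x a = (let y = chart_inv (base x) a in dchart M (base x) y (grad M f y))"

lemma coord_grad_base: "coord_grad x (base_pt M x) = grad M f x"
  by (simp add: coord_grad_def base_chart_at_base_pt dchart_eq transition_self[OF base_atlas base_dom])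

text \<open>The gradient at a nearby point is defined through the base chart of that point. The
  chain rule for the change of charts yields one equation in the chart at x, valid on its whole
  domain and hence fit for differentiation.\<close>

lemma coord_grad_eq:
  assumes "a \<in> snd (base x) ` fst (base x)"
  shows "cm x (coord_grad x a) w a = nderiv (coord_f x) [w] a"
proof -
  obtain y where y: "y \<in> fst (base x)" "a = snd (base x) y" using assms by blast
  have "cm x (coord_grad x a) w a = riem_metric M y (grad M f y) (dchart_inv M (base x) a w)"
    using coord_metric_chart[OF y(1)] y(2) chart_inv_left[OF base_atlas y(1)]
      dchart_inverse(2)[OF base_atlas y(1)] by (simp add: coord_grad_def)
  also have "\<dots> = nderiv (coord_f x) [w] a"
    using frechet_eqI[OF has_derivative_change_chart[OF base_atlas base_atlas y(1) base_dom
        f_chart_differentiable[OF base_atlas base_dom]]]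
    unfolding riem_grad y(2) dchart_inv_eq[OF base_atlas y(1)] by (simp add: base_pt_def)
  finally show ?thesis .
qed

text \<open>Differentiating the gradient equation along \<open>u\<close> produces the derivative of
  the metric in direction \<open>u\<close>. By metric compatibility it equals <\<Gamma>(u, grad f),
  z> + <\<Gamma>(u, z), grad f>: adding the two instances of \<open>christoffel_eq\<close> cancels
  all other terms. The first summand is the one in the covariant derivative, so only the second
  survives.\<close>

lemma riem_hess:
  "riem_metric M x (hess M f x u) z
    = nderiv (coord_f x) [u, z] (base_pt M x) - riem_metric M x (grad M f x) (christoffel M x u z)"
proof -
  let ?a = "base_pt M x" and ?X = "coord_grad x"
  obtain V where V: "open V" "?a \<in> V" "V \<subseteq> snd (base x) ` fst (base x)" "Ck_on p V (coord_f x)"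
    by (rule coord_f_Ck)
  have nondeg: "u = 0" if "\<And>w. w \<in> Basis \<Longrightarrow> cm x u w ?a = 0" for u
  proof -
    have lin: "linear (riem_metric M x u)" using riem_bilinear by (simp add: bilinear_def)
    have "riem_metric M x u u = (\<Sum>b\<in>Basis. (u \<bullet> b) *\<^sub>R riem_metric M x u b)"
      by (rule linear_euclidean_sum[OF lin])
    also have "\<dots> = 0" using that by (intro sum.neutral) (simp add: coord_metric_base)
    finally show ?thesis by (simp add: form_eq_0_iff)
  qed
  have dh: "nderiv (coord_f x) [w] differentiable (at ?a)" for w
    using p by (intro nderiv_differentiable[OF V(4) _ V(2)]) simp
  note imp = implicit_linear_solution_derivative(2)[where g = "\<lambda>a u w. cm x u w a"
      and h = "\<lambda>a w. nderiv (coord_f x) [w] a" and X = ?X,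
      OF open_base_image base_pt_in linear_coord_metric nondeg coord_metric_differentiable dh coord_grad_eq]
  have hess: "hess M f x u = frechet_derivative ?X (at ?a) u + christoffel M x u (grad M f x)"
    unfolding hess_def cov_deriv_def coord_grad_def by (simp add: Let_def)
  have "dcm x (grad M f x) z u + riem_metric M x (frechet_derivative ?X (at ?a) u) z
      = nderiv (coord_f x) [u, z] ?a"
    using imp[of z u] by (simp add: coord_grad_base coord_metric_base)
  moreover have "dcm x z (grad M f x) = dcm x (grad M f x) z" for z
    by (rule arg_cong[where f = "\<lambda>F. frechet_derivative F (at ?a)"]) (rule ext, rule coord_metric_sym)
  ultimately show ?thesis
    using christoffel_eq[of x u "grad M f x" z] christoffel_eq[of x u z "grad M f x"]
      riem_sym[of x "grad M f x"]
    unfolding hess bilinear_ladd[OF riem_bilinear] by simp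
qed

lemma christoffel_sym: "christoffel M x u w = christoffel M x w u"
proof (rule form_eq_imp_eq)
  have "dcm x u w = dcm x w u"
    by (rule arg_cong[where f = "\<lambda>F. frechet_derivative F (at (base_pt M x))"]) (rule ext, rule coord_metric_sym)
  then show "riem_metric M x (christoffel M x u w) z = riem_metric M x (christoffel M x w u) z" for z
    using christoffel_eq[of x u w z] christoffel_eq[of x w u z] by simp
qed

lemma hess_self_adjoint: "riem_metric M x (hess M f x u) w = riem_metric M x (hess M f x w) u"
proof -
  obtain V where V: "open V" "base_pt M x \<in> V" "Ck_on p V (coord_f x)"
    by (rule coord_f_Ck)
  have "nderiv (coord_f x) [u, w] (base_pt M x) = nderiv (coord_f x) [w, u] (base_pt M x)"
    using p by (intro nderiv_swap[OF V]) simp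
  then show ?thesis unfolding riem_hess by (simp add: christoffel_sym[of x u])
qed

lemma hess_bilinear: "bilinear (\<lambda>u w. riem_metric M x (hess M f x u) w)"
proof -
  have 1: "linear (\<lambda>w. riem_metric M x (hess M f x u) w)" for u
    using riem_bilinear by (simp add: bilinear_def)
  moreover have "linear (\<lambda>u. riem_metric M x (hess M f x u) w)" for w
    using 1[of w] by (simp add: hess_self_adjoint[of x _ w])
  ultimately show ?thesis by (simp add: bilinear_def)
qed

text \<open>Nondegeneracy of the metric identifies the eigenvectors of the operator with those of
  its form, so the Rayleigh characterization covers the Hessian.\<close>

lemma lambda_min_hess:
  "lambda_min (hess M f x) = lambda_min_form (riem_metric M x) (\<lambda>u w. riem_metric M x (hess M f x u) w)"
proof -
  have "hess M f x u = l *\<^sub>R u \<longleftrightarrow> (\<forall>w. riem_metric M x (hess M f x u) w = l * riem_metric M x u w)" for l u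
    using form_eq_imp_eq[of x "hess M f x u" "l *\<^sub>R u"] by (auto simp: bilinear_lmul[OF riem_bilinear])
  then show ?thesis by (simp add: lambda_min_def lambda_min_form_def)
qed

lemma pullback_chart:
  assumes "manifold_retraction M R"
  obtains U V where "open U" "0 \<in> U" "open V" "base_pt M x \<in> V" "Ck_on p V (coord_f x)"
    "Ck_on p U (\<lambda>u. snd (base x) (R (x, u)))" "\<And>u. u \<in> U \<Longrightarrow> R (x, u) \<in> fst (base x)"
    "\<And>u. u \<in> U \<Longrightarrow> snd (base x) (R (x, u)) \<in> V"
    "\<And>u. u \<in> U \<Longrightarrow> pullback R f x u = coord_f x (snd (base x) (R (x, u)))"
proof -
  let ?\<psi> = "\<lambda>u. snd (base x) (R (x, u))"
  obtain V where V: "open V" "base_pt M x \<in> V" "Ck_on p V (coord_f x)"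
    by (rule coord_f_Ck)
  obtain U where U: "open U" "0 \<in> U" "\<And>u. u \<in> U \<Longrightarrow> R (x, u) \<in> fst (base x)" "Ck_on p U ?\<psi>"
    by (rule retraction_chart[OF assms]) blast
  show ?thesis
  proof (rule that[of "U \<inter> ?\<psi> -` V" V])
    show o: "open (U \<inter> ?\<psi> -` V)"
      by (rule continuous_open_preimage[OF Ck_on_imp_continuous[OF U(4)] U(1) V(1)])
    show "0 \<in> U \<inter> ?\<psi> -` V" using U(2) V(2) assms by (simp add: manifold_retraction_def base_pt_def)
    show "Ck_on p (U \<inter> ?\<psi> -` V) ?\<psi>" using Ck_on_subset[OF U(4)] by blast
    show "R (x, u) \<in> fst (base x)" if "u \<in> U \<inter> ?\<psi> -` V" for u
      using that U(3) by blast
    show "?\<psi> u \<in> V" if "u \<in> U \<inter> ?\<psi> -` V" for u using that by blast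
    show "pullback R f x u = coord_f x (?\<psi> u)" if "u \<in> U \<inter> ?\<psi> -` V" for u
      using that chart_inv_left[OF base_atlas U(3)] by (simp add: pullback_def)
  qed (use V in blast)+
qed

lemma pullback_Ck:
  assumes "manifold_retraction M R"
  obtains U where "open U" "0 \<in> U" "Ck_on p U (pullback R f x)"
proof -
  obtain U V where U: "open U" "0 \<in> U" "open V" "base_pt M x \<in> V" "Ck_on p V (coord_f x)"
    "Ck_on p U (\<lambda>u. snd (base x) (R (x, u)))" "\<And>u. u \<in> U \<Longrightarrow> R (x, u) \<in> fst (base x)"
    "\<And>u. u \<in> U \<Longrightarrow> snd (base x) (R (x, u)) \<in> V"
    "\<And>u. u \<in> U \<Longrightarrow> pullback R f x u = coord_f x (snd (base x) (R (x, u)))"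
    by (rule pullback_chart[OF assms, of x]) blast
  have "Ck_on p U (coord_f x \<circ> (\<lambda>u. snd (base x) (R (x, u))))"
    using U(8) by (intro Ck_on_compose[OF U(1) _ U(6,5)]) auto
  then have "Ck_on p U (pullback R f x)"
    by (rule Ck_on_cong[OF U(1), rotated]) (simp add: U(9))
  with U(1,2) that show ?thesis by blast
qed

text \<open>The chain rule for f in coordinates after the coordinate expression of the retraction,
  whose derivative at 0 is the identity. The last term of the second formula carries the
  acceleration of the retraction, which is where the second-order property can enter.\<close>

lemma pullback_deriv:
  assumes "manifold_retraction M R"
  shows "nderiv (pullback R f x) [u] 0 = riem_metric M x (grad M f x) u"
    and "nderiv (pullback R f x) [u, u] 0 = nderiv (coord_f x) [u, u] (base_pt M x)
      + riem_metric M x (grad M f x) (nderiv (\<lambda>u. snd (base x) (R (x, u))) [u, u] 0)"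
proof -
  let ?\<psi> = "\<lambda>u. snd (base x) (R (x, u))" and ?a = "base_pt M x" and ?F = "coord_f x"
  obtain U V where U: "open U" "0 \<in> U" "open V" "?a \<in> V" "Ck_on p V ?F"
    "Ck_on p U ?\<psi>" "\<And>u. u \<in> U \<Longrightarrow> R (x, u) \<in> fst (base x)" "\<And>u. u \<in> U \<Longrightarrow> ?\<psi> u \<in> V"
    "\<And>u. u \<in> U \<Longrightarrow> pullback R f x u = ?F (?\<psi> u)"
    by (rule pullback_chart[OF assms, of x]) blast
  have \<psi>0: "?\<psi> 0 = ?a" and d\<psi>: "(?\<psi> has_derivative id) (at 0)"
    using assms by (simp_all add: manifold_retraction_def base_pt_def)
  have dF: "nderiv ?F us differentiable (at a)" if "a \<in> V" "length us < 2" for a us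
    using that p by (intro nderiv_differentiable[OF U(5)]) auto
  have d: "nderiv ?\<psi> us differentiable (at u)" if "u \<in> U" "length us < 2" for u us
    using that p by (intro nderiv_differentiable[OF U(6)]) auto
  have first: "nderiv (pullback R f x) [u] y = (\<Sum>b\<in>Basis. (nderiv ?\<psi> [u] y \<bullet> b) * nderiv ?F [b] (?\<psi> y))"
    if "y \<in> U" for y
  proof -
    have "((?F \<circ> ?\<psi>) has_derivative (frechet_derivative ?F (at (?\<psi> y)) \<circ> frechet_derivative ?\<psi> (at y))) (at y)"
      using d[of y "[]"] dF[of "?\<psi> y" "[]"] U(8) that
      by (intro diff_chain_at differentiable_has_frechet) auto
    then have "(pullback R f x has_derivative (frechet_derivative ?F (at (?\<psi> y)) \<circ> frechet_derivative ?\<psi> (at y))) (at y)"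
      by (rule has_derivative_transform_within_open[OF _ U(1) that]) (simp add: U(9))
    from frechet_eqI[OF this]
    have "nderiv (pullback R f x) [u] y = frechet_derivative ?F (at (?\<psi> y)) (nderiv ?\<psi> [u] y)"
      by simp
    also have "\<dots> = (\<Sum>b\<in>Basis. (nderiv ?\<psi> [u] y \<bullet> b) *\<^sub>R frechet_derivative ?F (at (?\<psi> y)) b)"
      using dF[of "?\<psi> y" "[]"] U(8)[OF that] by (intro linear_euclidean_sum linear_frechet_derivative) simp
    finally show ?thesis by simp
  qed
  have \<psi>u: "nderiv ?\<psi> [u] 0 = u" using frechet_eqI[OF d\<psi>] by simp
  have lin1: "linear (\<lambda>w. nderiv ?F [w] ?a)"
    using nderiv_linear_head[OF U(5) _ U(4), of "[]"] p by simp
  have lin2: "linear (\<lambda>w. nderiv ?F [u, w] ?a)"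
  proof -
    have "nderiv ?F [u, w] ?a = nderiv ?F [w, u] ?a" for w
      using p by (intro nderiv_swap[OF U(3,4,5)]) simp
    then show ?thesis using nderiv_linear_head[OF U(5) _ U(4), of "[u]"] p by simp
  qed
  show "nderiv (pullback R f x) [u] 0 = riem_metric M x (grad M f x) u"
    using first[OF U(2)] linear_euclidean_sum[OF lin1, of u] unfolding \<psi>u \<psi>0 riem_grad by simp
  have "((\<lambda>y. \<Sum>b\<in>Basis. (nderiv ?\<psi> [u] y \<bullet> b) * nderiv ?F [b] (?\<psi> y)) has_derivative
     (\<lambda>h. \<Sum>b\<in>Basis. (nderiv ?\<psi> [u] 0 \<bullet> b) * frechet_derivative (nderiv ?F [b]) (at ?a) (id h)
        + (frechet_derivative (nderiv ?\<psi> [u]) (at 0) h \<bullet> b) * nderiv ?F [b] (?\<psi> 0))) (at 0)"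
  proof (intro has_derivative_sum has_derivative_mult has_derivative_inner_left)
    show "(nderiv ?\<psi> [u] has_derivative frechet_derivative (nderiv ?\<psi> [u]) (at 0)) (at 0)"
      using d[OF U(2), of "[u]"] by (intro differentiable_has_frechet) simp
    show "((\<lambda>y. nderiv ?F [b] (?\<psi> y)) has_derivative (\<lambda>h. frechet_derivative (nderiv ?F [b]) (at ?a) (id h))) (at 0)" for b
    proof (rule has_derivative_compose[OF d\<psi>])
      show "(nderiv ?F [b] has_derivative frechet_derivative (nderiv ?F [b]) (at ?a)) (at (?\<psi> 0))"
        unfolding \<psi>0 using dF[OF U(4), of "[b]"] by (intro differentiable_has_frechet) simp
    qed
  qed
  then have "(nderiv (pullback R f x) [u] has_derivative
     (\<lambda>h. \<Sum>b\<in>Basis. (nderiv ?\<psi> [u] 0 \<bullet> b) * frechet_derivative (nderiv ?F [b]) (at ?a) (id h)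
        + (frechet_derivative (nderiv ?\<psi> [u]) (at 0) h \<bullet> b) * nderiv ?F [b] (?\<psi> 0))) (at 0)"
    by (rule has_derivative_transform_within_open[OF _ U(1,2)]) (simp add: first del: nderiv.simps)
  from frechet_eqI[OF this]
  have "nderiv (pullback R f x) [u, u] 0 = (\<Sum>b\<in>Basis. (u \<bullet> b) * nderiv ?F [u, b] ?a)
      + (\<Sum>b\<in>Basis. (nderiv ?\<psi> [u, u] 0 \<bullet> b) * nderiv ?F [b] ?a)"
    unfolding nderiv.simps(2)[of "pullback R f x" u "[u]"] nderiv.simps(2)[of ?\<psi> u "[u]"] nderiv.simps(2)[of ?F u "[_]"]
    by (simp only: \<psi>u \<psi>0 id_apply sum.distrib)
  also have "\<dots> = nderiv ?F [u, u] ?a + nderiv ?F [nderiv ?\<psi> [u, u] 0] ?a"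
    using linear_euclidean_sum[OF lin1, of "nderiv ?\<psi> [u, u] 0"] linear_euclidean_sum[OF lin2, of u]
    by (simp only: real_scaleR_def)
  finally show "nderiv (pullback R f x) [u, u] 0 = nderiv ?F [u, u] ?a
      + riem_metric M x (grad M f x) (nderiv ?\<psi> [u, u] 0)"
    unfolding riem_grad .
qed

end

text \<open>In the base chart at \<open>x\<close> the acceleration of \<open>t \<mapsto> R(x, tu)\<close> at 0 is
  \<open>D\<^sup>2\<psi>(0)[u,u] + \<Gamma>(u,u)\<close>, where \<open>\<psi>\<close> is the coordinate expression of the retraction.\<close>

lemma second_order_retraction_christoffel:
  assumes "second_order_retraction M R"
  shows "nderiv (\<lambda>u. snd (base x) (R (x, u))) [u, u] 0 = - christoffel M x u u"
proof -
  let ?\<psi> = "\<lambda>u. snd (base x) (R (x, u))"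
  define \<gamma> where "\<gamma> t = R (x, t *\<^sub>R u)" for t
  have R: "manifold_retraction M R" and acc: "cov_deriv_along M \<gamma> (velocity M \<gamma>) 0 = 0"
    using assms by (simp_all add: second_order_retraction_def Let_def \<gamma>_def[abs_def])
  have R0: "R (x, 0) = x" and d\<psi>: "(?\<psi> has_derivative id) (at 0)"
    using R by (simp_all add: manifold_retraction_def)
  then have \<gamma>0: "\<gamma> 0 = x" by (simp add: \<gamma>_def)
  obtain U where U: "open U" "0 \<in> U" "\<And>u. u \<in> U \<Longrightarrow> R (x, u) \<in> fst (base x)" "Ck_on 2 U ?\<psi>"
    by (rule retraction_chart[OF R]) blast
  define I where "I = (\<lambda>t. t *\<^sub>R u) -` U"
  have "continuous_on UNIV (\<lambda>t::real. t *\<^sub>R u)" by (intro continuous_intros)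
  then have I: "open I" "0 \<in> I"
    using continuous_open_preimage[OF _ open_UNIV U(1), of "\<lambda>t. t *\<^sub>R u"] U(2)
    by (auto simp: I_def)
  have line: "((\<lambda>t. t *\<^sub>R u) has_vector_derivative u) (at t)" for t
    by (auto intro!: derivative_eq_intros simp: has_vector_derivative_def)
  have along: "((\<lambda>t. F (t *\<^sub>R u)) has_vector_derivative frechet_derivative F (at (t *\<^sub>R u)) u) (at t)"
    if "F differentiable (at (t *\<^sub>R u))" for F :: "'e \<Rightarrow> 'e" and t
    using vector_derivative_diff_chain_within[OF line[of t], of F "frechet_derivative F (at (t *\<^sub>R u))"]
      has_derivative_at_withinI[OF differentiable_has_frechet[OF that]] by (simp add: o_def)
  \<comment> \<open>\<open>velocity\<close> reads the curve in the base chart of the moving point.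
    The transition map found here is undone in \<open>field\<close>, leaving a function of t in the
    single chart at x that can be differentiated.\<close>
  have vel: "velocity M \<gamma> t = transition (base x) (base (\<gamma> t)) (\<gamma> t) (nderiv ?\<psi> [u] (t *\<^sub>R u))" if "t \<in> I" for t
  proof -
    let ?c = "base (\<gamma> t)"
    have dom: "\<gamma> t \<in> fst (base x)" using that U(3) by (simp add: I_def \<gamma>_def)
    have "(?\<psi> differentiable (at (t *\<^sub>R u)))"
      using nderiv_differentiable[OF U(4), of "[]"] that by (simp add: I_def)
    from along[OF this] have 1: "((\<lambda>t. ?\<psi> (t *\<^sub>R u)) has_vector_derivative nderiv ?\<psi> [u] (t *\<^sub>R u)) (at t)"
      by simp
    have 2: "((snd ?c \<circ> chart_inv (base x)) has_derivative transition (base x) ?c (\<gamma> t)) (at (?\<psi> (t *\<^sub>R u)))"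
      using has_derivative_transition[OF base_atlas base_atlas dom base_dom] by (simp add: \<gamma>_def)
    from vector_derivative_diff_chain_within[OF 1 has_derivative_at_withinI[OF 2]]
    have "((snd ?c \<circ> chart_inv (base x)) \<circ> (\<lambda>t. ?\<psi> (t *\<^sub>R u)) has_vector_derivative
        transition (base x) ?c (\<gamma> t) (nderiv ?\<psi> [u] (t *\<^sub>R u))) (at t)"
      .
    then have "((snd ?c \<circ> \<gamma>) has_vector_derivative
        transition (base x) ?c (\<gamma> t) (nderiv ?\<psi> [u] (t *\<^sub>R u))) (at t)"
      by (rule has_vector_derivative_transform_within_open[OF _ I(1) that])
        (use U(3) chart_inv_left[OF base_atlas] in \<open>simp add: I_def \<gamma>_def\<close>)
    then show ?thesis unfolding velocity_def by (rule vector_derivative_at)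
  qed
  have field: "dchart M (base x) (\<gamma> t) (velocity M \<gamma> t) = nderiv ?\<psi> [u] (t *\<^sub>R u)" if "t \<in> I" for t
  proof -
    have "\<gamma> t \<in> fst (base x)" using that U(3) by (simp add: I_def \<gamma>_def)
    then show ?thesis
      unfolding vel[OF that] dchart_eq
      by (simp add: transition_compose transition_self base_atlas base_dom del: nderiv.simps)
  qed
  have "nderiv ?\<psi> [u] differentiable (at (0 *\<^sub>R u))"
    using nderiv_differentiable[OF U(4), of "[u]"] U(2) by simp
  from along[OF this] have "((\<lambda>t. nderiv ?\<psi> [u] (t *\<^sub>R u)) has_vector_derivative nderiv ?\<psi> [u, u] 0) (at 0)"
    by simp
  then have "((\<lambda>t. dchart M (base x) (\<gamma> t) (velocity M \<gamma> t)) has_vector_derivative nderiv ?\<psi> [u, u] 0) (at 0)"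
    by (rule has_vector_derivative_transform_within_open[OF _ I]) (simp only: field)
  then have "vector_derivative (\<lambda>t. dchart M (base x) (\<gamma> t) (velocity M \<gamma> t)) (at 0) = nderiv ?\<psi> [u, u] 0"
    by (rule vector_derivative_at)
  moreover have "velocity M \<gamma> 0 = u"
    using vel[OF I(2)] frechet_eqI[OF d\<psi>] \<gamma>0 transition_self[OF base_atlas base_dom] by simp
  ultimately have "nderiv ?\<psi> [u, u] 0 + christoffel M x u u = 0"
    using acc unfolding cov_deriv_along_def \<gamma>0 by simp
  then show ?thesis by (simp add: eq_neg_iff_add_eq_0)
qed

lemma pullback_hess:
  assumes "Ck_map p (atlas M) real_atlas f" "2 \<le> p" "second_order_retraction M R"
  shows "nderiv (pullback R f x) [u, u] 0 = riem_metric M x (hess M f x u) u"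
proof -
  have "manifold_retraction M R" using assms(3) by (simp add: second_order_retraction_def)
  from pullback_deriv(2)[OF assms(1,2) this, of x u] show ?thesis
    unfolding riem_hess[OF assms(1,2)] second_order_retraction_christoffel[OF assms(3)]
    by (simp add: bilinear_rneg[OF riem_bilinear])
qed

end

section \<open>One step of the algorithm\<close>

context riemannian
begin

lemma tnorm_nonneg: "0 \<le> tnorm M x v" and tnorm_sq: "(tnorm M x v)\<^sup>2 = riem_metric M x v v"
  using nonneg by (simp_all add: tnorm_def)

lemma tnorm_pos: "v \<noteq> 0 \<Longrightarrow> 0 < tnorm M x v"
  using riem_pos by (simp add: tnorm_def)

lemma tnorm_0: "tnorm M x 0 = 0"
  by (simp add: tnorm_def bilinear_lzero[OF riem_bilinear])

lemma riem_cauchy: "\<bar>riem_metric M x u w\<bar> \<le> tnorm M x u * tnorm M x w"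
proof -
  have "(riem_metric M x u w)\<^sup>2 \<le> (tnorm M x u * tnorm M x w)\<^sup>2"
    using cauchy_schwarz by (simp add: power_mult_distrib tnorm_sq)
  then show ?thesis
    using tnorm_nonneg by (metis abs_le_square_iff abs_of_nonneg mult_nonneg_nonneg)
qed

text \<open>The Rayleigh bound for the form <A u, A w>. The expansion makes \<open>A\<close>
  injective, hence surjective by equal dimensions, so every direction at the new point is the image
  of a test direction at the old one.\<close>

lemma transport_expansion:
  assumes "0 < b" "b \<le> sigma_min M x y A" "linear A"
  shows "b * tnorm M x u \<le> tnorm M y (A u)" and "surj A"
proof -
  let ?B = "\<lambda>u w. riem_metric M y (A u) (A w)"
  have B: "bilinear ?B"
    using assms(3) bilinear_ladd[OF riem_bilinear] bilinear_lmul[OF riem_bilinear]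
      bilinear_radd[OF riem_bilinear] bilinear_rmul[OF riem_bilinear]
    by (simp add: bilinear_def linear_iff)
  have "b \<le> sqrt (lambda_min_form (riem_metric M x) ?B)"
    using assms(2) by (simp add: sigma_min_def)
  \<comment> \<open>Squaring is safe since 0 < b forces the eigenvalue under the root to be
    positive.\<close>
  then have "b\<^sup>2 \<le> lambda_min_form (riem_metric M x) ?B"
    using assms(1) by (metis less_eq_real_def less_le_trans real_sqrt_gt_0_iff real_sqrt_pow2 power_mono)
  then have "b\<^sup>2 * riem_metric M x u u \<le> riem_metric M y (A u) (A u)" for u
    using lambda_min_form_rayleigh(1)[OF B, of x u] riem_sym nonneg[of x u]
    by (meson mult_right_mono order_trans)
  then have *: "b * tnorm M x u \<le> tnorm M y (A u)" for u
    using assms(1) real_sqrt_le_mono[of "b\<^sup>2 * riem_metric M x u u"]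
    by (simp add: tnorm_def real_sqrt_mult)
  then show "b * tnorm M x u \<le> tnorm M y (A u)" .
  have "u = 0" if "A u = 0" for u
  proof (rule ccontr)
    assume "u \<noteq> 0"
    then have "0 < b * tnorm M x u" using assms(1) tnorm_pos by simp
    with *[of u] show False by (simp add: that tnorm_0)
  qed
  then have "inj A" using assms(3) linear_injective_0 by blast
  then show "surj A" using assms(3) linear_injective_imp_surjective by blast
qed

context
  fixes R :: "'m \<times> 'e \<Rightarrow> 'm" and f :: "'m \<Rightarrow> real" and p :: nat
  assumes R: "second_order_retraction M R" and f: "Ck_map p (atlas M) real_atlas f" and p: "3 \<le> p"
begin

lemma manifold_retraction: "manifold_retraction M R"
  using R by (simp add: second_order_retraction_def)

lemma retraction_0: "R (x, 0) = x"
  using manifold_retraction by (simp add: manifold_retraction_def)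

lemma pullback_Ck':
  obtains U where "open U" "0 \<in> U" "Ck_on p U (pullback R f x)"
  using pullback_Ck[OF f _ manifold_retraction] p by auto

lemma pullback_grad: "nderiv (pullback R f x) [u] 0 = riem_metric M x (grad M f x) u"
  using pullback_deriv(1)[OF f _ manifold_retraction] p by simp

lemma pullback_hess': "nderiv (pullback R f x) [u, u] 0 = riem_metric M x (hess M f x u) u"
  using pullback_hess[OF f _ R] p by simp

text \<open>Every term with j > 0 contains a zero direction and vanishes by linearity.\<close>

lemma taylor_pullback_0:
  assumes "q + length us \<le> p"
  shows "taylor q (nderiv (pullback R f x) us) 0 = nderiv (pullback R f x) us 0"
proof -
  let ?F = "pullback R f x"
  obtain U where U: "open U" "0 \<in> U" "Ck_on p U ?F" by (rule pullback_Ck')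
  have "nderiv ?F (replicate j 0 @ us) 0 / fact j = (if j = 0 then nderiv ?F us 0 else 0)" if "j \<le> q" for j
  proof (cases j)
    case (Suc i)
    have "linear (\<lambda>u. nderiv ?F (u # replicate i 0 @ us) 0)"
      using that Suc assms by (intro nderiv_linear_head[OF U(3) _ U(2)]) simp
    then show ?thesis using linear_0 Suc by fastforce
  qed simp
  then have "taylor q (nderiv ?F us) 0 = (\<Sum>j\<le>q. if j = 0 then nderiv ?F us 0 else 0)"
    unfolding taylor_def nderiv_append[symmetric] by (intro sum.cong) auto
  then show ?thesis by simp
qed

lemma has_derivative_tnorm_power:
  "((\<lambda>v. tnorm M x v ^ (k + 2)) has_derivative (\<lambda>h. real (k + 2) * tnorm M x v ^ k * riem_metric M x v h)) (at v)"
  unfolding tnorm_def by (rule has_derivative_gnorm_power)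

lemma model_deriv:
  "(model M R f p a x has_derivative (\<lambda>h. taylor (p - 1) (nderiv (pullback R f x) [h]) v
     + a * tnorm M x v ^ (p - 1) * riem_metric M x v h)) (at v)"
proof -
  obtain U where U: "open U" "0 \<in> U" "Ck_on p U (pullback R f x)" by (rule pullback_Ck')
  have 1: "(taylor p (pullback R f x) has_derivative (\<lambda>h. taylor (p - 1) (nderiv (pullback R f x) [h]) v)) (at v)"
    using has_derivative_taylor[OF U(1,3,2), of "p - 1" "[]" v] p by simp
  have pw: "p - 1 + 2 = p + 1" using p by simp
  have "((\<lambda>v. taylor p (pullback R f x) v + a / (real p + 1) * tnorm M x v ^ (p + 1)) has_derivative
      (\<lambda>h. taylor (p - 1) (nderiv (pullback R f x) [h]) v
        + a / (real p + 1) * (real (p + 1) * tnorm M x v ^ (p - 1) * riem_metric M x v h))) (at v)"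
    using has_derivative_tnorm_power[where k = "p - 1" and x = x and v = v] unfolding pw
    by (intro has_derivative_add 1 has_derivative_mult_right)
  moreover have "a / (real p + 1) * (real (p + 1) * t * s) = a * t * s" for t s
  proof -
    have "real p + 1 \<noteq> 0" by linarith
    then show ?thesis by (simp add: field_simps)
  qed
  ultimately show ?thesis by (simp only: model_def[abs_def])
qed

lemma nderiv_model1:
  "nderiv (model M R f p a x) [h] v = taylor (p - 1) (nderiv (pullback R f x) [h]) v
     + a * tnorm M x v ^ (p - 1) * riem_metric M x v h"
  using frechet_eqI[OF model_deriv[of a x v]] by (simp del: nderiv.simps(2) add: nderiv.simps(2)[of "model M R f p a x"])

text \<open>The first derivative of the regularizer contains the norm to the power p - 1. Here p
  \<ge> 3 enters: writing p - 1 = (p - 3) + 2 makes it differentiable at v = 0 as well.\<close>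

lemma nderiv_model2:
  "nderiv (model M R f p a x) [w, h] v = taylor (p - 2) (nderiv (pullback R f x) [w, h]) v
     + a * (tnorm M x v ^ (p - 1) * riem_metric M x w h
       + real (p - 1) * tnorm M x v ^ (p - 3) * riem_metric M x v w * riem_metric M x v h)"
proof -
  obtain U where U: "open U" "0 \<in> U" "Ck_on p U (pullback R f x)" by (rule pullback_Ck')
  have pw: "Suc (p - 2) = p - 1" "p - 3 + 2 = p - 1" using p by simp_all
  have 1: "(taylor (p - 1) (nderiv (pullback R f x) [h]) has_derivative
      (\<lambda>w. taylor (p - 2) (nderiv (pullback R f x) [w, h]) v)) (at v)"
    using has_derivative_taylor[OF U(1,3,2), of "p - 2" "[h]" v] p unfolding pw by (simp del: nderiv.simps)
  have 2: "((\<lambda>v. tnorm M x v ^ (p - 1)) has_derivative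
      (\<lambda>w. real (p - 1) * tnorm M x v ^ (p - 3) * riem_metric M x v w)) (at v)"
    using has_derivative_tnorm_power[where k = "p - 3" and x = x and v = v] unfolding pw .
  have 3: "((\<lambda>v. riem_metric M x v h) has_derivative (\<lambda>w. riem_metric M x w h)) (at v)"
    using riem_bilinear by (intro linear_imp_has_derivative) (simp add: bilinear_def)
  have "((\<lambda>v. taylor (p - 1) (nderiv (pullback R f x) [h]) v + a * (tnorm M x v ^ (p - 1) * riem_metric M x v h))
      has_derivative (\<lambda>w. taylor (p - 2) (nderiv (pullback R f x) [w, h]) v
        + a * (tnorm M x v ^ (p - 1) * riem_metric M x w h
          + real (p - 1) * tnorm M x v ^ (p - 3) * riem_metric M x v w * riem_metric M x v h))) (at v)"
    by (intro has_derivative_add 1 has_derivative_mult_right has_derivative_mult 2 3)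
  then have "(nderiv (model M R f p a x) [h] has_derivative (\<lambda>w. taylor (p - 2) (nderiv (pullback R f x) [w, h]) v
        + a * (tnorm M x v ^ (p - 1) * riem_metric M x w h
          + real (p - 1) * tnorm M x v ^ (p - 3) * riem_metric M x v w * riem_metric M x v h))) (at v)"
    unfolding nderiv_model1[abs_def] by (simp only: mult.assoc)
  from frechet_eqI[OF this] show ?thesis
    unfolding nderiv.simps(2)[of "model M R f p a x" w "[h]"] by (simp only:)
qed

section \<open>Consequences of the conditions on a selected step\<close>

context
  fixes P :: rar_params and a :: real and x :: 'm and v :: 'e
  assumes sel: "rar_select M R f p P a x v" and a: "0 < a"
begin

lemma select_decrease:
  "a / (real p + 1) * tnorm M x v ^ (p + 1) \<le> f x - taylor p (pullback R f x) v"
proof -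
  have "taylor p (pullback R f x) 0 = f x"
    using taylor_pullback_0[of p "[]" x] by (simp add: pullback_def retraction_0)
  then show ?thesis using sel by (simp add: rar_select_def Let_def model_def tnorm_0)
qed

lemma select_first_order:
  "\<bar>nderiv (model M R f p a x) [u] v\<bar> \<le> theta P * tnorm M x v ^ p * tnorm M x u"
proof -
  let ?m = "model M R f p a x"
  have "linear (\<lambda>u. nderiv ?m [u] v)"
    using has_derivative_linear[OF model_deriv[of a x v]] unfolding nderiv_model1 .
  from op_norm_bound1[OF inner_form_axioms, of "\<lambda>us. nderiv ?m us v", OF this, of u]
  have "\<bar>nderiv ?m [u] v\<bar> \<le> op_norm M x 1 (\<lambda>us. nderiv ?m us v) * tnorm M x u" .
  also have "\<dots> \<le> theta P * tnorm M x v ^ p * tnorm M x u"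
    using sel tnorm_nonneg by (intro mult_right_mono) (simp_all add: rar_select_def Let_def)
  finally show ?thesis .
qed

lemma select_second_order:
  "- theta P * tnorm M x v ^ (p - 1) * riem_metric M x u u \<le> nderiv (model M R f p a x) [u, u] v"
proof -
  let ?m = "model M R f p a x" and ?F = "pullback R f x"
  obtain U where U: "open U" "0 \<in> U" "Ck_on p U ?F" by (rule pullback_Ck')
  have "bilinear (\<lambda>u w. taylor (p - 2) (nderiv ?F [u, w]) v)"
    using p by (intro taylor_nderiv2_bilinear[OF U(1,3,2)]) simp
  then have bil: "bilinear (\<lambda>u w. nderiv ?m [u, w] v)"
    using bilinear_ladd[OF riem_bilinear] bilinear_lmul[OF riem_bilinear]
      bilinear_radd[OF riem_bilinear] bilinear_rmul[OF riem_bilinear]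
    unfolding nderiv_model2 by (simp add: bilinear_def linear_iff algebra_simps del: nderiv.simps)
  have sym: "nderiv ?m [u, w] v = nderiv ?m [w, u] v" for u w
    using taylor_nderiv2_symmetric[OF U(1,3,2), of "p - 2" u w v] p
    unfolding nderiv_model2 by (simp add: riem_sym[of x u w] del: nderiv.simps)
  have "- theta P * tnorm M x v ^ (p - 1) * riem_metric M x u u
      \<le> lambda_min_form (riem_metric M x) (\<lambda>u w. nderiv ?m [u, w] v) * riem_metric M x u u"
    using sel nonneg by (intro mult_right_mono) (simp_all add: rar_select_def Let_def del: nderiv.simps)
  also have "\<dots> \<le> nderiv ?m [u, u] v"
    using lambda_min_form_rayleigh(1)[OF bil] sym by blast
  finally show ?thesis .
qed

text \<open>At v = 0 the allowed residuals vanish, and the model has the gradient and Hessian of f,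
  so the optimality conditions hold exactly. At a nonstationary iterate the step is therefore
  nonzero, which makes the denominator of \<open>rho\<close> positive.\<close>

lemma zero_step_stationary:
  assumes "v = 0" "0 \<le> \<epsilon>1" "0 \<le> \<epsilon>2"
  shows "second_order_stationary M f \<epsilon>1 \<epsilon>2 x"
proof -
  have "riem_metric M x (grad M f x) u = 0" for u
  proof -
    have "nderiv (model M R f p a x) [u] 0 = riem_metric M x (grad M f x) u"
      unfolding nderiv_model1 using taylor_pullback_0[of "p - 1" "[u]" x] p
      by (simp add: pullback_grad bilinear_lzero[OF riem_bilinear] del: nderiv.simps)
    then show ?thesis using select_first_order[of u] p assms(1) by (simp add: tnorm_0 power_0_left del: nderiv.simps)
  qed
  then have "tnorm M x (grad M f x) = 0" by (simp add: tnorm_def)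
  moreover have hess_nonneg: "0 \<le> riem_metric M x (hess M f x u) u" for u
  proof -
    have "nderiv (model M R f p a x) [u, u] 0 = riem_metric M x (hess M f x u) u"
      unfolding nderiv_model2 using taylor_pullback_0[of "p - 2" "[u, u]" x] p
      by (simp add: pullback_hess' tnorm_0 bilinear_lzero[OF riem_bilinear] del: nderiv.simps)
    then show ?thesis using select_second_order[of u] p assms(1) by (simp add: tnorm_0 power_0_left del: nderiv.simps)
  qed
  moreover obtain u where "riem_metric M x (hess M f x u) u = lambda_min (hess M f x)"
    using lambda_min_form_rayleigh(2)[OF hess_bilinear[OF f] hess_self_adjoint[OF f], of x x] p
    by (auto simp: lambda_min_hess[OF f])
  then have "0 \<le> lambda_min (hess M f x)" using hess_nonneg[of u] by simp
  ultimately show ?thesis using assms by (simp add: second_order_stationary_def)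
qed

text \<open>By surjectivity the new gradient g is the transport of some u. Testing with u gives
  |g|^2 \<le> K |u|, while b |u| \<le> |g|. The summands of the coefficient stem from the transport
  error, the gradient of the regularizer and the residual allowed to the model gradient.\<close>

lemma grad_after_step:
  assumes "linear (VT (x, v))" "0 < b" "b \<le> sigma_min M x (R (x, v)) (VT (x, v))"
    and "transport_smooth M R VT L p f S" "(x, v) \<in> S"
  shows "b * tnorm M (R (x, v)) (grad M f (R (x, v)))
    \<le> (real p / (real p + 1) * L + a + theta P) * tnorm M x v ^ p"
proof -
  let ?y = "R (x, v)" and ?A = "VT (x, v)" and ?t = "tnorm M x v" and ?F = "pullback R f x"
  let ?K = "(real p / (real p + 1) * L + a + theta P) * ?t ^ p"
  obtain U where U: "open U" "0 \<in> U" "Ck_on p U ?F" by (rule pullback_Ck')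
  let ?T = "\<lambda>us. transport_pullback VT (x, v) (\<lambda>us. nderiv (pullback R f ?y) us 0) us
      - taylor (p - 1) (nderiv ?F us) v"
  have T: "?T [u] = riem_metric M ?y (grad M f ?y) (?A u) - taylor (p - 1) (nderiv ?F [u]) v" for u
    using pullback_grad[of ?y "?A u"] by (simp add: transport_pullback_def del: nderiv.simps)
  have "linear (\<lambda>u. taylor (p - 1) (nderiv ?F [u]) v)"
    using p by (intro taylor_nderiv1_linear[OF U(1,3,2)]) simp
  then have lin: "linear (\<lambda>u. ?T [u])"
    unfolding T using assms(1) bilinear_radd[OF riem_bilinear] bilinear_rmul[OF riem_bilinear]
    by (simp add: linear_iff algebra_simps)
  have bound: "\<bar>riem_metric M ?y (grad M f ?y) (?A u)\<bar> \<le> ?K * tnorm M x u" for u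
  proof -
    have "\<bar>?T [u]\<bar> \<le> op_norm M x 1 ?T * tnorm M x u"
      by (rule op_norm_bound1[OF inner_form_axioms lin])
    also have "\<dots> \<le> real p / (real p + 1) * L * ?t ^ p * tnorm M x u"
      using assms(4,5) tnorm_nonneg by (intro mult_right_mono) (auto simp: transport_smooth_def)
    finally have 1: "\<bar>riem_metric M ?y (grad M f ?y) (?A u) - taylor (p - 1) (nderiv ?F [u]) v\<bar>
      \<le> real p / (real p + 1) * L * ?t ^ p * tnorm M x u" unfolding T .
    have 2: "\<bar>taylor (p - 1) (nderiv ?F [u]) v + a * ?t ^ (p - 1) * riem_metric M x v u\<bar>
        \<le> theta P * ?t ^ p * tnorm M x u"
      using select_first_order[of u] unfolding nderiv_model1 .
    have "\<bar>a * ?t ^ (p - 1) * riem_metric M x v u\<bar> \<le> a * ?t ^ (p - 1) * (?t * tnorm M x u)"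
      using a tnorm_nonneg riem_cauchy[of x v u] by (simp add: abs_mult mult_left_mono)
    also have "\<dots> = a * ?t ^ p * tnorm M x u"
      using p by (simp add: power_eq_if)
    finally show ?thesis using 1 2 by (simp add: algebra_simps)
  qed
  obtain u where u: "?A u = grad M f ?y"
    using transport_expansion(2)[OF assms(2,3,1)] by (metis surjD)
  let ?g = "tnorm M ?y (grad M f ?y)"
  have K: "0 \<le> ?K * tnorm M x u"
    using bound[of u] by linarith
  have "?g * ?g \<le> ?K * tnorm M x u"
    using bound[of u] unfolding u by (simp add: tnorm_sq[unfolded power2_eq_square])
  moreover have e: "b * tnorm M x u \<le> ?g"
    using transport_expansion(1)[OF assms(2,3,1), of u] unfolding u .
  show ?thesis
  proof (cases "?g = 0")
    case False
    then have g: "0 < ?g" using tnorm_nonneg[of ?y "grad M f ?y"] by linarith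
    have "0 < ?K"
    proof (rule ccontr)
      assume "\<not> 0 < ?K"
      then have "?K * tnorm M x u \<le> 0" using tnorm_nonneg by (simp add: mult_nonpos_nonneg)
      moreover have "0 < ?g * ?g" using g by simp
      ultimately show False using \<open>?g * ?g \<le> ?K * tnorm M x u\<close> by linarith
    qed
    have "(b * ?g) * ?g \<le> ?K * (b * tnorm M x u)"
      using mult_left_mono[OF \<open>?g * ?g \<le> ?K * tnorm M x u\<close>, of b] assms(2) by (simp add: mult.assoc mult.left_commute)
    also have "\<dots> \<le> ?K * ?g" using e \<open>0 < ?K\<close> by (intro mult_left_mono) simp_all
    finally show ?thesis using g by (rule mult_right_le_imp_le)
  next
    \<comment> \<open>With a zero gradient the claim reduces to nonnegativity of the right side. As
      no sign of \<open>L\<close> is assumed, it is read off from \<open>bound\<close> in the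
      direction \<open>v\<close>.\<close>
    case True
    show ?thesis
    proof (cases "v = 0")
      case True
      have "0 \<le> ?K" using True p by (simp add: tnorm_0 power_0_left)
      then show ?thesis using \<open>?g = 0\<close> by simp
    next
      case False
      from \<open>v \<noteq> 0\<close> have "0 < tnorm M x v" by (rule tnorm_pos)
      moreover have "0 \<le> ?K * tnorm M x v" using bound[of v] by linarith
      ultimately have "0 \<le> ?K" by (simp only: zero_le_mult_iff) auto
      then show ?thesis using \<open>?g = 0\<close> by simp
    qed
  qed
qed

text \<open>A unit vector w at which the new Hessian form attains its smallest eigenvalue is the
  transport of some u with b |u| \<le> 1, and the curvature is tested along u. The coefficient p of
  \<open>a\<close> collects the two parts of the second derivative of the regularizer, with weights
  1 and p - 1.\<close>

lemma hess_after_step: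
  assumes "linear (VT (x, v))" "0 < b" "b \<le> sigma_min M x (R (x, v)) (VT (x, v))" "0 \<le> L" "0 \<le> theta P"
    and "transport_second_order_smooth M R VT L p f S" "(x, v) \<in> S"
  shows "- ((real p * (real p - 1) / (real p + 1) * L + real p * a + theta P) * tnorm M x v ^ (p - 1))
    \<le> b\<^sup>2 * lambda_min (hess M f (R (x, v)))"
proof -
  let ?y = "R (x, v)" and ?A = "VT (x, v)" and ?t = "tnorm M x v" and ?F = "pullback R f x"
  let ?c = "real p * (real p - 1) / (real p + 1) * L"
  let ?K = "(?c + real p * a + theta P) * ?t ^ (p - 1)"
  obtain U where U: "open U" "0 \<in> U" "Ck_on p U ?F" by (rule pullback_Ck')
  obtain U' where U': "open U'" "0 \<in> U'" "Ck_on p U' (pullback R f ?y)" by (rule pullback_Ck')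
  let ?T = "\<lambda>us. transport_pullback VT (x, v) (\<lambda>us. nderiv (pullback R f ?y) us 0) us
      - taylor (p - 2) (nderiv ?F us) v"
  have T: "?T [u, w] = nderiv (pullback R f ?y) [?A u, ?A w] 0 - taylor (p - 2) (nderiv ?F [u, w]) v" for u w
    by (simp add: transport_pullback_def del: nderiv.simps)
  have b1: "bilinear (\<lambda>u w. taylor (p - 2) (nderiv ?F [u, w]) v)"
    using p by (intro taylor_nderiv2_bilinear[OF U(1,3,2)]) simp
  have b2: "bilinear (\<lambda>u w. nderiv (pullback R f ?y) [u, w] 0)"
    using taylor_nderiv2_bilinear[OF U'(1,3,2), of 0] p by (simp add: taylor_def del: nderiv.simps(2))
  have bil: "bilinear (\<lambda>u w. ?T [u, w])"
    unfolding T using b1 b2 assms(1)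
    by (simp add: bilinear_def linear_iff algebra_simps del: nderiv.simps)
  have bound: "- (?K * riem_metric M x u u) \<le> riem_metric M ?y (hess M f ?y (?A u)) (?A u)" for u
  proof -
    have "\<bar>?T [u, u]\<bar> \<le> op_norm M x 2 ?T * tnorm M x u * tnorm M x u"
      by (rule op_norm_bound2[OF inner_form_axioms bil])
    also have "\<dots> \<le> ?c * ?t ^ (p - 1) * tnorm M x u * tnorm M x u"
      using assms(6,7) tnorm_nonneg by (intro mult_right_mono) (auto simp: transport_second_order_smooth_def)
    finally have 1: "\<bar>riem_metric M ?y (hess M f ?y (?A u)) (?A u) - taylor (p - 2) (nderiv ?F [u, u]) v\<bar>
      \<le> ?c * (?t ^ (p - 1) * riem_metric M x u u)"
      unfolding T pullback_hess' tnorm_sq[symmetric] power2_eq_square by (simp only: mult.assoc)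
    let ?s = "?t ^ (p - 1) * riem_metric M x u u"
      and ?q = "?t ^ (p - 3) * (riem_metric M x v u * riem_metric M x v u)"
    have 2: "- (theta P * ?s) \<le> taylor (p - 2) (nderiv ?F [u, u]) v + a * (?s + real (p - 1) * ?q)"
      using select_second_order[of u] unfolding nderiv_model2 minus_mult_left[symmetric]
      by (simp only: mult.assoc)
    \<comment> \<open>Cauchy-Schwarz bounds the rank-one part of the regularizer's second derivative
      by its isotropic part.\<close>
    have "?q \<le> ?t ^ (p - 3) * (?t\<^sup>2 * riem_metric M x u u)"
      using cauchy_schwarz[of x v u] tnorm_nonneg[of x v]
      by (intro mult_left_mono) (simp_all add: tnorm_sq power2_eq_square[symmetric])
    also have "\<dots> = ?s"
    proof -
      have "p - 1 = p - 3 + 2" using p by simp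
      then show ?thesis by (simp only: power_add mult.assoc)
    qed
    finally have m: "real (p - 1) * ?q \<le> real (p - 1) * ?s" by (rule mult_left_mono) simp
    have "a * (?s + real (p - 1) * ?q) \<le> a * (?s + real (p - 1) * ?s)"
      using a by (intro mult_left_mono[OF add_left_mono[OF m]]) simp
    also have "\<dots> = real p * a * ?s"
      using p by (simp add: of_nat_diff algebra_simps)
    finally have 3: "a * (?s + real (p - 1) * ?q) \<le> real p * a * ?s" .
    have "(c + d + e) * s * g = c * (s * g) + d * (s * g) + e * (s * g)" for c d e s g :: real
      by (simp add: algebra_simps)
    then have 4: "?K * riem_metric M x u u = ?c * ?s + real p * a * ?s + theta P * ?s" .
    have "- k \<le> X" if "k = c + d + e" "\<bar>X - T\<bar> \<le> c" "- e \<le> T + Y" "Y \<le> d" for k c d e X T Y :: real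
      using that by linarith
    from this[OF 4 1 2 3] show ?thesis .
  qed
  obtain w where w: "riem_metric M ?y w w = 1" "riem_metric M ?y (hess M f ?y w) w = lambda_min (hess M f ?y)"
    using lambda_min_form_rayleigh(2)[OF hess_bilinear[OF f] hess_self_adjoint[OF f], of ?y ?y] p
    by (auto simp: lambda_min_hess[OF f])
  obtain u where u: "?A u = w"
    using transport_expansion(2)[OF assms(2,3,1)] by (metis surjD)
  have "b * tnorm M x u \<le> 1"
    using transport_expansion(1)[OF assms(2,3,1), of u] w(1) unfolding u by (simp add: tnorm_def)
  then have "(b * tnorm M x u)\<^sup>2 \<le> 1"
    using assms(2) tnorm_nonneg by (intro power_le_one) simp_all
  then have bu: "b\<^sup>2 * riem_metric M x u u \<le> 1" by (simp add: power_mult_distrib tnorm_sq)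
  have "0 \<le> ?K"
    using assms(4,5) a p tnorm_nonneg[of x v]
    by (intro mult_nonneg_nonneg add_nonneg_nonneg) (simp_all add: divide_nonneg_nonneg)
  then have "?K * (b\<^sup>2 * riem_metric M x u u) \<le> ?K" using bu by (simp add: mult_left_le)
  moreover have "b\<^sup>2 * - (?K * riem_metric M x u u) \<le> b\<^sup>2 * lambda_min (hess M f ?y)"
    using bound[of u] w(2) unfolding u by (intro mult_left_mono) simp_all
  ultimately show ?thesis by (simp add: algebra_simps)
qed

end

end

end

section \<open>Iteration count\<close>

text \<open>Converts a lower bound for the power m of the step length into one for the power n. With
  n = p + 1, the cases m = p and m = p - 1 are the origin of the two exponents in the complexity
  bound.\<close>

lemma powr_root_bound:
  fixes t :: real
  assumes "0 \<le> t" "0 < m" "0 < c" "0 < q" "c / q \<le> t ^ m"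
  shows "c powr (real n / real m) / q powr (real n / real m) \<le> t ^ n"
proof -
  have t: "0 < t"
  proof (rule ccontr)
    assume "\<not> 0 < t"
    then have "t ^ m = 0" using assms(1,2) by simp
    with divide_pos_pos[OF assms(3,4)] show False using assms(5) by linarith
  qed
  have "c powr (real n / real m) / q powr (real n / real m) = (c / q) powr (real n / real m)"
    using assms by (simp add: powr_divide)
  also have "\<dots> \<le> (t ^ m) powr (real n / real m)"
    using assms by (intro powr_mono2) simp_all
  also have "\<dots> = t ^ n"
    using t assms(2) by (simp add: powr_realpow[symmetric] powr_powr)
  finally show ?thesis .
qed

text \<open>Away from 0 a power with exponent at least 1 dominates a linear function; this makes the
  complexity bound control \<open>L1\<close> itself.\<close>

lemma powr_ge_linear:
  fixes k y :: real
  assumes "0 < k" "k \<le> y" "1 \<le> a"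
  shows "k powr (a - 1) * y \<le> y powr a"
proof -
  have "k powr (a - 1) * y \<le> y powr (a - 1) * y powr 1"
    using assms by (intro mult_mono powr_mono2) auto
  also have "\<dots> = y powr a" unfolding powr_add[symmetric] by simp
  finally show ?thesis .
qed

text \<open>Rejected iterations are charged to the accepted ones through the growth of \<open>ln \<alpha>\<close>. The last
  accepted step is exempt from the decrease \<open>\<delta>\<close>, since its end point may be stationary.\<close>

lemma adaptive_iteration_count:
  fixes F \<alpha> :: "nat \<Rightarrow> real" and acc :: "nat \<Rightarrow> bool"
  assumes "0 < \<delta>" "0 < \<gamma>1" "\<gamma>1 < 1" "1 < \<gamma>2" "0 < \<alpha> 0" "\<alpha> n \<le> A"
    and "F 0 - F n \<le> D"
    and dec: "\<And>i. i < n \<Longrightarrow> acc i \<Longrightarrow> F (Suc i) \<le> F i"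
    and dec': "\<And>i. Suc i < n \<Longrightarrow> acc i \<Longrightarrow> F (Suc i) + \<delta> \<le> F i"
    and rej: "\<And>i. i < n \<Longrightarrow> \<not> acc i \<Longrightarrow> F (Suc i) = F i"
    and \<alpha>_acc: "\<And>i. i < n \<Longrightarrow> acc i \<Longrightarrow> \<gamma>1 * \<alpha> i \<le> \<alpha> (Suc i)"
    and \<alpha>_rej: "\<And>i. i < n \<Longrightarrow> \<not> acc i \<Longrightarrow> \<gamma>2 * \<alpha> i \<le> \<alpha> (Suc i)"
  shows "real n \<le> (D / \<delta> + 1) * (1 - ln \<gamma>1 / ln \<gamma>2) + ln (A / \<alpha> 0) / ln \<gamma>2"
proof -
  define N where "N m = real (card {i. i < m \<and> acc i})" for m
  have N_Suc: "N (Suc m) = N m + (if acc m then 1 else 0)" for m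
  proof -
    have "{i. i < Suc m \<and> acc i} = (if acc m then insert m {i. i < m \<and> acc i} else {i. i < m \<and> acc i})"
      by (auto simp: less_Suc_eq)
    then show ?thesis by (simp add: N_def)
  qed
  have N0: "N 0 = 0" by (simp add: N_def)
  have F1: "F m + \<delta> * N m \<le> F 0" if "m < n" for m
    using that
  proof (induction m)
    case (Suc m)
    then show ?case using dec'[of m] rej[of m] by (auto simp: N_Suc algebra_simps)
  qed (simp add: N0)
  \<comment> \<open>The step with index n - 1 contributes no \<delta>, whence
    \<open>N n - 1\<close>; for n = 0 this is a negative multiple of \<delta>, which does no
    harm.\<close>
  have F2: "F n + \<delta> * (N n - 1) \<le> F 0"
  proof (cases n)
    case (Suc m)
    then show ?thesis using F1[of m] dec[of m] rej[of m] assms(1) by (auto simp: N_Suc algebra_simps)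
  qed (use assms(1) in \<open>simp add: N0\<close>)
  have N_le: "N n \<le> D / \<delta> + 1"
    using F2 assms(1,7) by (simp add: field_simps)
  \<comment> \<open>Every accepted iteration lowers ln \<alpha> by at most - ln \<gamma>1, every
    rejected one raises it by at least ln \<gamma>2.\<close>
  have ln: "0 < \<alpha> m \<and> ln (\<alpha> 0) + N m * ln \<gamma>1 + (real m - N m) * ln \<gamma>2 \<le> ln (\<alpha> m)" if "m \<le> n" for m
    using that
  proof (induction m)
    case (Suc m)
    then have IH: "0 < \<alpha> m" "ln (\<alpha> 0) + N m * ln \<gamma>1 + (real m - N m) * ln \<gamma>2 \<le> ln (\<alpha> m)" by auto
    define g where "g = (if acc m then \<gamma>1 else \<gamma>2)"
    have g: "0 < g" using assms by (simp add: g_def)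
    have step: "g * \<alpha> m \<le> \<alpha> (Suc m)" using \<alpha>_acc[of m] \<alpha>_rej[of m] Suc.prems by (simp add: g_def)
    then have pos: "0 < \<alpha> (Suc m)" using mult_pos_pos[OF g IH(1)] by linarith
    have "ln g + ln (\<alpha> m) = ln (g * \<alpha> m)" using g IH(1) by (simp add: ln_mult)
    also have "\<dots> \<le> ln (\<alpha> (Suc m))" using step g IH(1) pos by (subst ln_le_cancel_iff) auto
    finally have "ln g + ln (\<alpha> m) \<le> ln (\<alpha> (Suc m))" .
    then show ?case using IH(2) pos by (auto simp: N_Suc g_def algebra_simps split: if_splits)
  qed (simp add: N0 assms)
  have "ln (\<alpha> n) \<le> ln A" using ln[of n] assms(6) by (subst ln_le_cancel_iff) auto
  then have "(real n - N n) * ln \<gamma>2 \<le> ln A - ln (\<alpha> 0) - N n * ln \<gamma>1"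
    using ln[of n] by simp
  moreover have "ln A - ln (\<alpha> 0) = ln (A / \<alpha> 0)"
    using ln[of n] assms(5,6) by (simp add: ln_div)
  moreover have l2: "0 < ln \<gamma>2" using assms(4) by simp
  ultimately have "real n \<le> N n + (ln (A / \<alpha> 0) - N n * ln \<gamma>1) / ln \<gamma>2"
    by (simp add: field_simps)
  also have "\<dots> = N n * (1 - ln \<gamma>1 / ln \<gamma>2) + ln (A / \<alpha> 0) / ln \<gamma>2"
    by (simp add: diff_divide_distrib algebra_simps)
  also have "N n * (1 - ln \<gamma>1 / ln \<gamma>2) \<le> (D / \<delta> + 1) * (1 - ln \<gamma>1 / ln \<gamma>2)"
  proof (rule mult_right_mono[OF N_le])
    have "ln \<gamma>1 / ln \<gamma>2 \<le> 0" using assms(2,3) l2 by (simp add: divide_le_0_iff)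
    then show "0 \<le> 1 - ln \<gamma>1 / ln \<gamma>2" by simp
  qed
  finally show ?thesis by simp
qed

lemma rar_queries_length: "length (rar_queries R p x v N) \<le> (p + 2) * (N + 1)"
proof -
  have "length (rar_queries R p x v N)
      = sum_list (map (\<lambda>i. p + 1 + (if i < N then 1 else 0)) [0..<N + 1])"
    unfolding rar_queries_def by (simp add: length_concat comp_def if_distrib cong: if_cong)
  also have "\<dots> \<le> sum_list (map (\<lambda>i. p + 2) [0..<N + 1])"
    by (rule sum_list_mono) simp
  also have "\<dots> = (p + 2) * (N + 1)" by (simp add: sum_list_triv)
  finally show ?thesis .
qed

text \<open>The factor of \<open>L1\<close> in the gradient estimate: transport error at most L1,
  regularization \<alpha> \<le> A L1, and theta \<le> (theta / \<kappa>) L1.\<close>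

definition grad_const :: "rar_params \<Rightarrow> real \<Rightarrow> real \<Rightarrow> real" where
  "grad_const P A \<kappa> = 1 + A + theta P / \<kappa>"

text \<open>The factor of \<open>L2\<close> in the curvature estimate: p (p - 1) / (p + 1) \<le> p,
  then p \<alpha> \<le> p A L1 \<le> (p A / \<kappa>) L2, and the term with theta through \<kappa>^2
  \<le> \<kappa> L1 \<le> L2.\<close>

definition hess_const :: "nat \<Rightarrow> rar_params \<Rightarrow> real \<Rightarrow> real \<Rightarrow> real" where
  "hess_const p P A \<kappa> = real p + real p * A / \<kappa> + theta P / \<kappa>\<^sup>2"

lemma grad_const_pos: "valid_params P \<Longrightarrow> 0 < A \<Longrightarrow> 0 < \<kappa> \<Longrightarrow> 0 < grad_const P A \<kappa>"
  by (simp add: valid_params_def grad_const_def add_pos_pos)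

lemma hess_const_pos: "valid_params P \<Longrightarrow> 0 < A \<Longrightarrow> 0 < \<kappa> \<Longrightarrow> 0 < hess_const p P A \<kappa>"
  by (simp add: valid_params_def hess_const_def add_nonneg_pos)

section \<open>Acceptance of steps, their length and the iteration bound\<close>

context riemannian
begin

text \<open>Majorization limits the excess of f over its Taylor polynomial to a share L / a of the
  guaranteed Taylor decrease. Once this share is at most 1 - \<eta>, the ratio is at least \<eta>;
  with \<eta> = \<open>eta2 P\<close> this stops the growth of \<alpha>.\<close>

lemma rho_large_regularization:
  assumes R: "second_order_retraction M R" and f: "Ck_map p (atlas M) real_atlas f" and p: "3 \<le> p"
    and sel: "rar_select M R f p P a x v" and a: "0 < a" and v: "v \<noteq> 0"
    and maj: "majorization_smooth M R L p f S" "(x, v) \<in> S"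
    and eta: "\<eta> < 1" "L \<le> (1 - \<eta>) * a"
  shows "\<eta> \<le> rho R f p x v"
proof -
  let ?T = "taylor p (pullback R f x) v" and ?t = "tnorm M x v ^ (p + 1)"
  have t: "0 < ?t" using tnorm_pos[OF v] by simp
  have D: "a / (real p + 1) * ?t \<le> f x - ?T"
    by (rule select_decrease[OF R f p sel a])
  have Dpos: "0 < f x - ?T"
    using D t a by (smt (verit) divide_pos_pos mult_pos_pos of_nat_0_le_iff)
  have "f (R (x, v)) - ?T \<le> L / (real p + 1) * ?t"
    using maj by (auto simp: majorization_smooth_def pullback_def[of R f x v])
  also have "\<dots> \<le> (1 - \<eta>) * a / (real p + 1) * ?t"
    by (intro mult_right_mono divide_right_mono eta(2)) (use t in simp_all)
  also have "\<dots> \<le> (1 - \<eta>) * (f x - ?T)"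
    using mult_left_mono[OF D, of "1 - \<eta>"] eta(1) by simp
  finally have "\<eta> * (f x - ?T) \<le> f x - f (R (x, v))" by (simp add: algebra_simps)
  then show ?thesis using Dpos by (simp add: rho_def pos_le_divide_eq)
qed

text \<open>Each of the two stationarity conditions that may fail at the end point yields one
  alternative. The nested quotients match the premise of \<open>powr_root_bound\<close>.\<close>

lemma step_length_lower_bound:
  assumes R: "second_order_retraction M R" and f: "Ck_map p (atlas M) real_atlas f" and p: "3 \<le> p"
    and sel: "rar_select M R f p P a x v" and a: "0 < a" "a \<le> A * L1" and P: "valid_params P"
    and VT: "linear (VT (x, v))" and b: "0 < b" "b \<le> sigma_min M x (R (x, v)) (VT (x, v))"
    and sm: "transport_smooth M R VT L1 p f S" "transport_second_order_smooth M R VT L2 p f S" "(x, v) \<in> S"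
    and L: "0 < \<kappa>" "\<kappa> \<le> L1" "\<kappa> * L1 \<le> L2" and \<epsilon>: "0 < \<epsilon>1" "0 < \<epsilon>2"
    and ns: "\<not> second_order_stationary M f \<epsilon>1 \<epsilon>2 (R (x, v))"
  shows "(b / grad_const P A \<kappa>) / (L1 / \<epsilon>1) \<le> tnorm M x v ^ p
    \<or> (b\<^sup>2 / hess_const p P A \<kappa>) / (L2 / \<epsilon>2) \<le> tnorm M x v ^ (p - 1)"
proof -
  let ?t = "tnorm M x v" and ?y = "R (x, v)"
  have L1: "0 < L1" and L2: "0 < L2" using L by (auto intro: less_le_trans[of 0 \<kappa>] less_le_trans[of 0 "\<kappa> * L1"])
  have A: "0 < A" using a L1 by (metis less_le_trans zero_less_mult_pos2)
  have t: "0 \<le> ?t ^ k" for k using tnorm_nonneg by simp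
  have \<theta>: "0 < theta P" using P by (simp add: valid_params_def)
  have c1: "theta P \<le> theta P / \<kappa> * L1" using L \<theta> by (simp add: field_simps)
  have K1: "0 < grad_const P A \<kappa>" using grad_const_pos P A L(1) .
  have K2: "0 < hess_const p P A \<kappa>" using hess_const_pos P A L(1) .
  from ns consider "\<epsilon>1 < tnorm M ?y (grad M f ?y)" | "lambda_min (hess M f ?y) < - \<epsilon>2"
    by (auto simp: second_order_stationary_def)
  then show ?thesis
  proof cases
    case 1
    have "real p / (real p + 1) * L1 \<le> 1 * L1" using L1 by (intro mult_right_mono) simp_all
    then have "real p / (real p + 1) * L1 + a + theta P \<le> grad_const P A \<kappa> * L1"
      unfolding grad_const_def using a(2) c1 by (simp only: distrib_right)
    then have "(real p / (real p + 1) * L1 + a + theta P) * ?t ^ p \<le> grad_const P A \<kappa> * L1 * ?t ^ p"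
      using t by (rule mult_right_mono)
    with grad_after_step[OF R f p sel a(1) VT b sm(1,3)]
    have "b * tnorm M ?y (grad M f ?y) \<le> grad_const P A \<kappa> * L1 * ?t ^ p" by linarith
    moreover have "b * \<epsilon>1 \<le> b * tnorm M ?y (grad M f ?y)" using 1 b(1) by (intro mult_left_mono) simp_all
    ultimately have "b * \<epsilon>1 \<le> grad_const P A \<kappa> * L1 * ?t ^ p" by linarith
    then show ?thesis using K1 L1 \<epsilon> by (simp add: field_simps)
  next
    case 2
    have k1: "real p * (real p - 1) / (real p + 1) * L2 \<le> real p * L2"
      using L2 p by (intro mult_right_mono) (simp_all add: field_simps)
    have k2: "real p * a \<le> real p * A / \<kappa> * L2"
    proof -
      have "real p * a \<le> real p * (A * L1)" using a(2) by (intro mult_left_mono) simp_all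
      also have "\<dots> = real p * A / \<kappa> * (\<kappa> * L1)" using L(1) by simp
      also have "\<dots> \<le> real p * A / \<kappa> * L2" using L A by (intro mult_left_mono) simp_all
      finally show ?thesis .
    qed
    have k3: "theta P \<le> theta P / \<kappa>\<^sup>2 * L2"
    proof -
      have "\<kappa>\<^sup>2 \<le> L2" using L by (metis less_imp_le mult_left_mono order_trans power2_eq_square)
      then show ?thesis using L(1) \<theta> by (simp add: field_simps)
    qed
    have "real p * (real p - 1) / (real p + 1) * L2 + real p * a + theta P \<le> hess_const p P A \<kappa> * L2"
      unfolding hess_const_def using k1 k2 k3 by (simp only: distrib_right)
    then have "(real p * (real p - 1) / (real p + 1) * L2 + real p * a + theta P) * ?t ^ (p - 1)
        \<le> hess_const p P A \<kappa> * L2 * ?t ^ (p - 1)"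
      using t by (rule mult_right_mono)
    with hess_after_step[OF R f p sel a(1) VT b _ _ sm(2,3)] L2 \<theta>
    have "- (hess_const p P A \<kappa> * L2 * ?t ^ (p - 1)) \<le> b\<^sup>2 * lambda_min (hess M f ?y)" by linarith
    moreover have "b\<^sup>2 * lambda_min (hess M f ?y) \<le> b\<^sup>2 * - \<epsilon>2"
      using 2 by (intro mult_left_mono) simp_all
    ultimately have "b\<^sup>2 * \<epsilon>2 \<le> hess_const p P A \<kappa> * L2 * ?t ^ (p - 1)" by simp
    then show ?thesis using K2 L2 \<epsilon> by (simp add: field_simps)
  qed
qed

end

context riemannian
begin

text \<open>\<open>A * L1\<close> caps \<alpha>: the first summand of \<open>A\<close> covers the
  start, since L1 \<ge> \<kappa>, the second a last increase from below L1 / (1 - eta2).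
  \<open>c / Q\<close> is the decrease per accepted step, with \<alpha> estimated by
  \<open>alpha_min P\<close>. The minimum in \<open>c\<close> ranges over the reasons for a step to
  be long: exceeding \<open>r\<close>, a large gradient or negative curvature at its end.\<close>

lemma rar_iterations:
  fixes p :: nat and P :: rar_params and \<kappa> L1 L2 \<epsilon>1 \<epsilon>2 q r b :: real
  defines "A \<equiv> alpha0 P / \<kappa> + gamma3 P / (1 - eta2 P)"
    and "Q \<equiv> max ((L1 / \<epsilon>1) powr ((real p + 1) / real p)) ((L2 / \<epsilon>2) powr ((real p + 1) / (real p - 1)))"
  defines "c \<equiv> eta1 P * (alpha_min P / (real p + 1)) * min (r ^ (p + 1) * q)
      (min ((b / grad_const P A \<kappa>) powr ((real p + 1) / real p))
        ((b\<^sup>2 / hess_const p P A \<kappa>) powr ((real p + 1) / (real p - 1))))"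
  assumes R: "second_order_retraction M R" and f: "Ck_map p (atlas M) real_atlas f" and p: "3 \<le> p"
    and P: "valid_params P" and VT: "vector_transport M R VT"
    and rb: "0 < r" "0 < b" and L: "0 < \<kappa>" "\<kappa> \<le> L1" "\<kappa> * L1 \<le> L2" and \<epsilon>: "0 < \<epsilon>1" "0 < \<epsilon>2"
    and bdd: "bdd_below (range f)" "f x0 - (INF y. f y) \<le> \<Delta>"
    and run: "rar_run M R f p P \<epsilon>1 \<epsilon>2 x0 x v \<alpha>"
    and maj: "majorization_smooth M R L1 p f (rar_increments M f \<epsilon>1 \<epsilon>2 x v)"
    and sm1: "transport_smooth M R VT L1 p f (rar_increments M f \<epsilon>1 \<epsilon>2 x v)"
    and sm2: "transport_second_order_smooth M R VT L2 p f (rar_increments M f \<epsilon>1 \<epsilon>2 x v)"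
    and short: "short_step_lower_bound M R VT r b (rar_increments M f \<epsilon>1 \<epsilon>2 x v)"
    and q: "0 < q" "q \<le> Q"
    and ns: "\<And>i. i < n \<Longrightarrow> \<not> second_order_stationary M f \<epsilon>1 \<epsilon>2 (x i)"
  shows "real n \<le> (\<Delta> / (c / Q) + 1) * (1 - ln (gamma1 P) / ln (gamma2 P))
    + ln (A * L1 / alpha0 P) / ln (gamma2 P)"
proof -
  let ?S = "rar_increments M f \<epsilon>1 \<epsilon>2 x v" and ?\<rho> = "\<lambda>i. rho R f p (x i) (v i)"
  let ?t = "\<lambda>i. tnorm M (x i) (v i)"
  have params: "0 < theta P" "0 < alpha_min P" "alpha_min P \<le> alpha0 P" "0 < eta1 P" "eta1 P \<le> eta2 P"
      "eta2 P < 1" "0 < gamma1 P" "gamma1 P < 1" "1 < gamma2 P" "gamma2 P < gamma3 P"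
    using P by (simp_all add: valid_params_def)
  have L1: "0 < L1" and L2: "0 < L2" using L by (auto intro: less_le_trans[of 0 \<kappa>] less_le_trans[of 0 "\<kappa> * L1"])
  have A: "0 < A" unfolding A_def using params L(1) by (intro add_pos_pos divide_pos_pos) simp_all
  have Q: "0 < Q" using q by linarith
  have act: "rar_active M f \<epsilon>1 \<epsilon>2 x i" if "i < n" for i
    using ns that by (simp add: rar_active_def)
  have inS: "(x i, v i) \<in> ?S" if "i < n" for i
    using act[OF that] by (auto simp: rar_increments_def)
  have sel: "rar_select M R f p P (\<alpha> i) (x i) (v i)"
    and x_Suc: "x (Suc i) = (if eta1 P \<le> ?\<rho> i then R (x i, v i) else x i)"
    and upd: "rar_alpha_update P (?\<rho> i) (\<alpha> i) (\<alpha> (Suc i))" if "i < n" for i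
    using run act[OF that] by (auto simp: rar_run_def)
  have start: "x 0 = x0" "\<alpha> 0 = alpha0 P" using run by (auto simp: rar_run_def)
  have upd_cases: "alpha_min P \<le> \<alpha> (Suc i) \<and> gamma1 P * \<alpha> i \<le> \<alpha> (Suc i) \<and>
      (?\<rho> i < eta1 P \<longrightarrow> gamma2 P * \<alpha> i \<le> \<alpha> (Suc i)) \<and>
      (eta2 P \<le> ?\<rho> i \<longrightarrow> \<alpha> (Suc i) \<le> \<alpha> i) \<and> \<alpha> (Suc i) \<le> gamma3 P * \<alpha> i"
    if "i < n" "alpha_min P \<le> \<alpha> i" for i
  proof -
    have a: "0 < \<alpha> i" using that(2) params by linarith
    have "gamma1 P * \<alpha> i \<le> 1 * \<alpha> i" "1 * \<alpha> i \<le> gamma2 P * \<alpha> i" "gamma2 P * \<alpha> i \<le> gamma3 P * \<alpha> i"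
      using a params by (auto intro!: mult_right_mono)
    then show ?thesis
      using upd[OF that(1)] that(2) params(5) unfolding rar_alpha_update_def
      by (auto split: if_splits)
  qed
  have v_nz: "v i \<noteq> 0" if "i < n" "0 < \<alpha> i" for i
    using zero_step_stationary[OF R f p sel[OF that(1)] that(2)] ns[OF that(1)] \<epsilon> by fastforce
  \<comment> \<open>If the ratio is below \<open>eta2 P\<close>, then \<alpha> was below L1 / (1 -
    eta2), and one update multiplies it by at most \<open>gamma3 P\<close>; otherwise it does not
    grow.\<close>
  have \<alpha>_bounds: "alpha_min P \<le> \<alpha> i \<and> \<alpha> i \<le> A * L1" if "i \<le> n" for i
    using that
  proof (induction i)
    case 0
    have "alpha0 P \<le> alpha0 P / \<kappa> * L1" using L params by (simp add: field_simps)
    also have "\<dots> \<le> A * L1" unfolding A_def using params L1 by (intro mult_right_mono) simp_all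
    finally show ?case using params start by simp
  next
    case (Suc i)
    then have IH: "alpha_min P \<le> \<alpha> i" "\<alpha> i \<le> A * L1" and i: "i < n" by auto
    have a: "0 < \<alpha> i" using IH(1) params by linarith
    note u = upd_cases[OF i IH(1)]
    show ?case
    proof (cases "eta2 P \<le> ?\<rho> i")
      case True
      then show ?thesis using u IH by linarith
    next
      case False
      have "\<not> L1 \<le> (1 - eta2 P) * \<alpha> i"
        using rho_large_regularization[OF R f p sel[OF i] a v_nz[OF i a] maj inS[OF i] params(6)] False
        by blast
      then have "\<alpha> i \<le> L1 / (1 - eta2 P)" using params(6) by (simp add: field_simps)
      then have "gamma3 P * \<alpha> i \<le> gamma3 P * (L1 / (1 - eta2 P))"
        using params by (intro mult_left_mono) simp_all
      also have "\<dots> = gamma3 P / (1 - eta2 P) * L1" by simp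
      also have "\<dots> \<le> A * L1" unfolding A_def using params L1 L(1) by (intro mult_right_mono) simp_all
      finally show ?thesis using u by linarith
    qed
  qed
  have \<alpha>_pos: "0 < \<alpha> i" if "i < n" for i using \<alpha>_bounds[of i] that params by linarith
  have decrease: "eta1 P * (alpha_min P / (real p + 1)) * ?t i ^ (p + 1) \<le> f (x i) - f (R (x i, v i))"
    if i: "i < n" and acc: "eta1 P \<le> ?\<rho> i" for i
  proof -
    let ?T = "taylor p (pullback R f (x i)) (v i)"
    have t: "0 < ?t i ^ (p + 1)" using tnorm_pos[OF v_nz[OF i \<alpha>_pos[OF i]]] by simp
    have D: "\<alpha> i / (real p + 1) * ?t i ^ (p + 1) \<le> f (x i) - ?T"
      by (rule select_decrease[OF R f p sel[OF i] \<alpha>_pos[OF i]])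
    have "0 < \<alpha> i / (real p + 1)" using \<alpha>_pos[OF i] by (intro divide_pos_pos) linarith+
    then have Dpos: "0 < f (x i) - ?T" using D mult_pos_pos[OF _ t] by (meson less_le_trans)
    have "alpha_min P / (real p + 1) * ?t i ^ (p + 1) \<le> \<alpha> i / (real p + 1) * ?t i ^ (p + 1)"
      using \<alpha>_bounds[of i] i t by (intro mult_right_mono divide_right_mono) simp_all
    then have "eta1 P * (alpha_min P / (real p + 1) * ?t i ^ (p + 1)) \<le> eta1 P * (f (x i) - ?T)"
      using D params(4) by (intro mult_left_mono) linarith+
    also have "\<dots> \<le> f (x i) - f (R (x i, v i))"
      using acc Dpos by (simp add: rho_def pos_le_divide_eq)
    finally show ?thesis by (simp only: mult.assoc)
  qed
  let ?m = "min (r ^ (p + 1) * q) (min ((b / grad_const P A \<kappa>) powr ((real p + 1) / real p))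
        ((b\<^sup>2 / hess_const p P A \<kappa>) powr ((real p + 1) / (real p - 1))))"
  have K: "0 < grad_const P A \<kappa>" "0 < hess_const p P A \<kappa>"
    using grad_const_pos[OF P A L(1)] hess_const_pos[OF P A L(1)] by simp_all
  then have m: "0 < ?m" using rb q by simp
  \<comment> \<open>The premise \<open>Suc i < n\<close> makes the end point of the step
    nonstationary. Steps longer than \<open>r\<close> are covered by q \<le> Q alone, as the
    short-step bound is available only up to length \<open>r\<close>.\<close>
  have long: "?m / Q \<le> ?t i ^ (p + 1)" if i: "Suc i < n" and acc: "eta1 P \<le> ?\<rho> i" for i
  proof (cases "?t i \<le> r")
    case False
    have "?m / Q \<le> r ^ (p + 1) * q / Q" using Q by (intro divide_right_mono) simp_all
    also have "\<dots> \<le> r ^ (p + 1)" using q Q rb by (simp add: field_simps)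
    also have "\<dots> \<le> ?t i ^ (p + 1)" using False rb by (intro power_mono) simp_all
    finally show ?thesis .
  next
    case True
    have i': "i < n" using i by simp
    have "ereal b \<le> ereal (sigma_min M (x i) (R (x i, v i)) (VT (x i, v i)))"
      using order_trans[OF short[unfolded short_step_lower_bound_def] INF_lower[of "(x i, v i)"]]
        inS[OF i'] True by simp
    then have \<sigma>: "b \<le> sigma_min M (x i) (R (x i, v i)) (VT (x i, v i))" by simp
    have lin: "linear (VT (x i, v i))" using VT by (simp add: vector_transport_def)
    have "\<not> second_order_stationary M f \<epsilon>1 \<epsilon>2 (R (x i, v i))"
      using ns[OF i] x_Suc[OF i'] acc by simp
    from step_length_lower_bound[OF R f p sel[OF i'] \<alpha>_pos[OF i'] _ P lin rb(2) \<sigma> sm1 sm2 inS[OF i'] L \<epsilon> this]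
      \<alpha>_bounds[of i] i'
    consider "(b / grad_const P A \<kappa>) / (L1 / \<epsilon>1) \<le> ?t i ^ p"
      | "(b\<^sup>2 / hess_const p P A \<kappa>) / (L2 / \<epsilon>2) \<le> ?t i ^ (p - 1)" by fastforce
    then show ?thesis
    proof cases
      case 1
      have "?m / Q \<le> (b / grad_const P A \<kappa>) powr ((real p + 1) / real p) / (L1 / \<epsilon>1) powr ((real p + 1) / real p)"
        using m L1 \<epsilon> Q by (intro frac_le) (simp_all add: Q_def)
      also have "\<dots> \<le> ?t i ^ (p + 1)"
        using powr_root_bound[OF tnorm_nonneg _ _ _ 1, of "p + 1"] p rb K L1 \<epsilon> by (simp add: add.commute)
      finally show ?thesis .
    next
      case 2
      have "?m / Q \<le> (b\<^sup>2 / hess_const p P A \<kappa>) powr ((real p + 1) / (real p - 1)) / (L2 / \<epsilon>2) powr ((real p + 1) / (real p - 1))"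
        using m L2 \<epsilon> Q by (intro frac_le) (simp_all add: Q_def)
      also have "\<dots> \<le> ?t i ^ (p + 1)"
        using powr_root_bound[OF tnorm_nonneg _ _ _ 2, of "p + 1"] p rb K L2 \<epsilon>
        by (simp add: add.commute of_nat_diff)
      finally show ?thesis .
    qed
  qed
  have c: "0 < c" unfolding c_def using m params by (intro mult_pos_pos divide_pos_pos) linarith+
  have "f (x n) \<ge> (INF y. f y)" using bdd(1) by (intro cINF_lower) auto
  then have total: "f (x 0) - f (x n) \<le> \<Delta>" using bdd(2) start by simp
  have "real n \<le> (\<Delta> / (c / Q) + 1) * (1 - ln (gamma1 P) / ln (gamma2 P)) + ln (A * L1 / \<alpha> 0) / ln (gamma2 P)"
  proof (rule adaptive_iteration_count[where F = "\<lambda>i. f (x i)" and acc = "\<lambda>i. eta1 P \<le> ?\<rho> i", OF _ params(7-9) _ _ total])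
    show "0 < c / Q" using c Q by simp
    show "0 < \<alpha> 0" using params start by simp
    show "\<alpha> n \<le> A * L1" using \<alpha>_bounds by simp
    show "gamma1 P * \<alpha> i \<le> \<alpha> (Suc i)" if "i < n" for i
      using upd_cases[OF that] \<alpha>_bounds[of i] that by simp
    show "gamma2 P * \<alpha> i \<le> \<alpha> (Suc i)" if "i < n" "\<not> eta1 P \<le> ?\<rho> i" for i
      using upd_cases[OF that(1)] \<alpha>_bounds[of i] that by simp
    show "f (x (Suc i)) = f (x i)" if "i < n" "\<not> eta1 P \<le> ?\<rho> i" for i
      using x_Suc[OF that(1)] that by simp
    show "f (x (Suc i)) \<le> f (x i)" if "i < n" "eta1 P \<le> ?\<rho> i" for i
    proof -
      have "0 \<le> eta1 P * (alpha_min P / (real p + 1)) * ?t i ^ (p + 1)"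
        using params tnorm_nonneg by (intro mult_nonneg_nonneg divide_nonneg_nonneg) simp_all
      then show ?thesis using decrease[OF that] x_Suc[OF that(1)] that by simp
    qed
    show "f (x (Suc i)) + c / Q \<le> f (x i)" if "Suc i < n" "eta1 P \<le> ?\<rho> i" for i
    proof -
      have "c / Q = eta1 P * (alpha_min P / (real p + 1)) * (?m / Q)" by (simp add: c_def)
      also have "\<dots> \<le> eta1 P * (alpha_min P / (real p + 1)) * ?t i ^ (p + 1)"
        using params by (intro mult_left_mono long that) simp_all
      finally show ?thesis using decrease[of i] x_Suc[of i] that by simp
    qed
  qed
  then show ?thesis using start by simp
qed

end

theorem theorem3p6:
  fixes p :: nat and P :: rar_params and r b \<Delta> \<kappa> \<epsilon>max :: real
  assumes "3 \<le> p" and "valid_params P" and "0 < r" and "0 < b"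
    and "0 < \<kappa>" and "0 < \<epsilon>max"
  shows "\<exists>C>0.
    \<forall>(M :: ('m::{t2_space, second_countable_topology}, 'e::euclidean_space) riemannian)
     R VT f L1 L2 \<epsilon>1 \<epsilon>2 x0 x v \<alpha>.
      riemannian_manifold M \<longrightarrow>
      manifold_retraction M R \<longrightarrow>
      vector_transport M R VT \<longrightarrow>
      Ck_map p (atlas M) real_atlas f \<longrightarrow>
      bdd_below (range f) \<longrightarrow> f x0 - (INF y. f y) \<le> \<Delta> \<longrightarrow>
      \<kappa> \<le> L1 \<longrightarrow> \<kappa> * L1 \<le> L2 \<longrightarrow>
      0 < \<epsilon>1 \<longrightarrow> 0 < \<epsilon>2 \<longrightarrow> min \<epsilon>1 \<epsilon>2 \<le> \<epsilon>max \<longrightarrow>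
      rar_run M R f p P \<epsilon>1 \<epsilon>2 x0 x v \<alpha> \<longrightarrow>
      majorization_smooth M R L1 p f (rar_increments M f \<epsilon>1 \<epsilon>2 x v) \<longrightarrow>
      transport_smooth M R VT L1 p f (rar_increments M f \<epsilon>1 \<epsilon>2 x v) \<longrightarrow>
      transport_second_order_smooth M R VT L2 p f (rar_increments M f \<epsilon>1 \<epsilon>2 x v) \<longrightarrow>
      second_order_retraction M R \<longrightarrow>
      short_step_lower_bound M R VT r b (rar_increments M f \<epsilon>1 \<epsilon>2 x v) \<longrightarrow>
      (\<exists>N. second_order_stationary M f \<epsilon>1 \<epsilon>2 (x N) \<and>
           (\<forall>i<N. \<not> second_order_stationary M f \<epsilon>1 \<epsilon>2 (x i)) \<and>
           real (N + 1) \<le> C * max ((L1 / \<epsilon>1) powr ((real p + 1) / real p))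
                                  ((L2 / \<epsilon>2) powr ((real p + 1) / (real p - 1))) \<and>
           real (length (rar_queries R p x v N))
             \<le> C * max ((L1 / \<epsilon>1) powr ((real p + 1) / real p))
                       ((L2 / \<epsilon>2) powr ((real p + 1) / (real p - 1))))"
proof -
  define a1 a2 where "a1 = (real p + 1) / real p" and "a2 = (real p + 1) / (real p - 1)"
  have a: "1 \<le> a1" "1 \<le> a2" using assms(1) by (simp_all add: a1_def a2_def)
  have params: "0 < alpha0 P" "0 < alpha_min P" "0 < eta1 P" "eta2 P < 1" "0 < gamma1 P" "gamma1 P < 1" "1 < gamma2 P" "0 < gamma3 P"
    using assms(2) by (auto simp: valid_params_def)
  \<comment> \<open>Chosen so that q1 L1 \<le> Q whichever tolerance lies below
    \<open>\<epsilon>max\<close>: apply \<open>powr_ge_linear\<close> to L1 / \<epsilon>max \<ge>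
    \<kappa> / \<epsilon>max or to \<kappa> L1 / \<epsilon>max \<ge> \<kappa>^2 / \<epsilon>max.
    Since L1 \<ge> \<kappa>, the number \<open>q\<close> below is then a lower bound of Q
    independent of the run.\<close>
  define q1 where "q1 = min ((\<kappa> / \<epsilon>max) powr (a1 - 1) / \<epsilon>max) ((\<kappa>\<^sup>2 / \<epsilon>max) powr (a2 - 1) * (\<kappa> / \<epsilon>max))"
  have q1: "0 < q1" using assms(5,6) by (simp add: q1_def)
  define q where "q = q1 * \<kappa>"
  have q: "0 < q" using q1 assms(5) by (simp add: q_def)
  define A where "A = alpha0 P / \<kappa> + gamma3 P / (1 - eta2 P)"
  have A: "0 < A" unfolding A_def using params assms(5) by (intro add_pos_pos divide_pos_pos) simp_all
  define c where "c = eta1 P * (alpha_min P / (real p + 1)) * min (r ^ (p + 1) * q)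
      (min ((b / grad_const P A \<kappa>) powr a1) ((b\<^sup>2 / hess_const p P A \<kappa>) powr a2))"
  have c: "0 < c"
    unfolding c_def using params assms q grad_const_pos[OF assms(2) A assms(5)] hess_const_pos[OF assms(2) A assms(5), of p]
    by (intro mult_pos_pos divide_pos_pos) simp_all
  define g where "g = 1 - ln (gamma1 P) / ln (gamma2 P)"
  have lg: "0 < ln (gamma2 P)" using params by simp
  have "ln (gamma1 P) / ln (gamma2 P) \<le> 0" using params lg by (simp add: divide_le_0_iff)
  then have g: "0 \<le> g" by (simp add: g_def)
  \<comment> \<open>Contributions per unit of Q: the total decrease divided by c / Q, the exempt
    last step as 1 \<le> Q / q, and the logarithm through ln y \<le> y and L1 \<le> Q / q1.\<close>
  define B where "B = (\<bar>\<Delta>\<bar> / c + 1 / q) * g + A / (alpha0 P * q1) / ln (gamma2 P)"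
  have B: "0 \<le> B" unfolding B_def using c q g A params q1 lg
    by (intro add_nonneg_nonneg mult_nonneg_nonneg divide_nonneg_nonneg) simp_all
  \<comment> \<open>N + 1 passes cost another 1 \<le> Q / q, and each pass makes at most p + 2
    queries.\<close>
  define C where "C = (real p + 2) * (B + 1 / q)"
  have BC: "0 < B + 1 / q" using B q by (intro add_nonneg_pos) simp_all
  have C: "0 < C" "B + 1 / q \<le> C"
    using BC mult_right_mono[of 1 "real p + 2" "B + 1 / q"] by (simp_all add: C_def)
  show ?thesis
  proof (intro exI[of _ C] conjI C(1) allI impI)
    fix M :: "('m, 'e) riemannian" and R VT f L1 L2 \<epsilon>1 \<epsilon>2 x0 x v \<alpha>
    assume H: "riemannian_manifold M" "manifold_retraction M R" "vector_transport M R VT"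
      "Ck_map p (atlas M) real_atlas f" "bdd_below (range f)" "f x0 - (INF y. f y) \<le> \<Delta>"
      "\<kappa> \<le> L1" "\<kappa> * L1 \<le> L2" "0 < \<epsilon>1" "0 < \<epsilon>2" "min \<epsilon>1 \<epsilon>2 \<le> \<epsilon>max"
      "rar_run M R f p P \<epsilon>1 \<epsilon>2 x0 x v \<alpha>"
      "majorization_smooth M R L1 p f (rar_increments M f \<epsilon>1 \<epsilon>2 x v)"
      "transport_smooth M R VT L1 p f (rar_increments M f \<epsilon>1 \<epsilon>2 x v)"
      "transport_second_order_smooth M R VT L2 p f (rar_increments M f \<epsilon>1 \<epsilon>2 x v)"
      "second_order_retraction M R"
      "short_step_lower_bound M R VT r b (rar_increments M f \<epsilon>1 \<epsilon>2 x v)"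
    interpret riemannian M by (rule riemannian_manifold_locale[OF H(1)])
    define Q where "Q = max ((L1 / \<epsilon>1) powr a1) ((L2 / \<epsilon>2) powr a2)"
    have L1: "0 < L1" using H(7) assms(5) by linarith
    \<comment> \<open>Only one tolerance is known to be at most \<open>\<epsilon>max\<close>. If it
      is \<epsilon>2, then \<open>L1\<close> is reached through \<kappa> L1 \<le> L2.\<close>
    have Q_L1: "q1 * L1 \<le> Q"
    proof (cases "\<epsilon>1 \<le> \<epsilon>max")
      case True
      have "q1 * L1 \<le> (\<kappa> / \<epsilon>max) powr (a1 - 1) / \<epsilon>max * L1"
        using L1 by (intro mult_right_mono) (simp_all add: q1_def)
      also have "\<dots> = (\<kappa> / \<epsilon>max) powr (a1 - 1) * (L1 / \<epsilon>max)" by simp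
      also have "\<dots> \<le> (L1 / \<epsilon>max) powr a1"
        using assms(5,6) H(7) a by (intro powr_ge_linear divide_right_mono) simp_all
      also have "\<dots> \<le> (L1 / \<epsilon>1) powr a1"
        using assms(6) L1 True H(9) a by (intro powr_mono2 divide_left_mono) simp_all
      finally show ?thesis by (simp add: Q_def)
    next
      case False
      then have \<epsilon>2: "\<epsilon>2 \<le> \<epsilon>max" using H(11) by linarith
      have \<kappa>L: "\<kappa>\<^sup>2 \<le> \<kappa> * L1" using assms(5) H(7) by (simp add: power2_eq_square)
      have L2: "0 < L2" using H(8) mult_pos_pos[OF assms(5) L1] by linarith
      have "q1 * L1 \<le> (\<kappa>\<^sup>2 / \<epsilon>max) powr (a2 - 1) * (\<kappa> / \<epsilon>max) * L1"
        using L1 by (intro mult_right_mono) (simp_all add: q1_def)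
      also have "\<dots> = (\<kappa>\<^sup>2 / \<epsilon>max) powr (a2 - 1) * (\<kappa> * L1 / \<epsilon>max)" by simp
      also have "\<dots> \<le> (\<kappa> * L1 / \<epsilon>max) powr a2"
        using assms(5,6) \<kappa>L a by (intro powr_ge_linear divide_right_mono) simp_all
      also have "\<dots> \<le> (L2 / \<epsilon>2) powr a2"
        using assms(5,6) L1 L2 \<epsilon>2 H(8,10) a by (intro powr_mono2 frac_le) simp_all
      finally show ?thesis by (simp add: Q_def)
    qed
    have qQ: "q \<le> Q"
      using order_trans[OF mult_left_mono[OF H(7), of q1] Q_L1] q1 by (simp add: q_def)
    then have Q: "0 < Q" using q by linarith
    have \<Delta>: "\<Delta> \<le> \<bar>\<Delta>\<bar>" by simp
    have bound: "real n \<le> B * Q" if "\<And>i. i < n \<Longrightarrow> \<not> second_order_stationary M f \<epsilon>1 \<epsilon>2 (x i)" for n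
    proof -
      have "real n \<le> (\<bar>\<Delta>\<bar> / (c / Q) + 1) * g + ln (A * L1 / alpha0 P) / ln (gamma2 P)"
        using rar_iterations[OF H(16,4) assms(1,2) H(3) assms(3,4,5) H(7,8,9,10,5) order_trans[OF H(6) \<Delta>]
            H(12-15,17) q _ that] qQ
        unfolding A_def c_def Q_def a1_def a2_def g_def by blast
      also have "\<dots> \<le> (\<bar>\<Delta>\<bar> / c * Q + 1 / q * Q) * g + A / (alpha0 P * q1) * Q / ln (gamma2 P)"
      proof (intro add_mono mult_right_mono divide_right_mono)
        show "\<bar>\<Delta>\<bar> / (c / Q) \<le> \<bar>\<Delta>\<bar> / c * Q" by simp
        show "1 \<le> 1 / q * Q" using qQ q by simp
        have "ln (A * L1 / alpha0 P) \<le> A * L1 / alpha0 P"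
          using A L1 params by (intro less_imp_le ln_less_self) simp
        also have "\<dots> = A / (alpha0 P * q1) * (q1 * L1)" using q1 by simp
        also have "\<dots> \<le> A / (alpha0 P * q1) * Q" using A params q1 by (intro mult_left_mono Q_L1) simp_all
        finally show "ln (A * L1 / alpha0 P) \<le> A / (alpha0 P * q1) * Q" .
      qed (use g lg in simp_all)
      also have "\<dots> = B * Q" by (simp add: B_def algebra_simps)
      finally show ?thesis .
    qed
    have "\<exists>i. second_order_stationary M f \<epsilon>1 \<epsilon>2 (x i)"
    proof (rule ccontr)
      assume "\<not> ?thesis"
      with bound[of "nat \<lceil>B * Q\<rceil> + 1"] show False by simp linarith
    qed
    then obtain N where N: "second_order_stationary M f \<epsilon>1 \<epsilon>2 (x N)"
        "\<And>i. i < N \<Longrightarrow> \<not> second_order_stationary M f \<epsilon>1 \<epsilon>2 (x i)"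
      using exists_least_iff[of "\<lambda>i. second_order_stationary M f \<epsilon>1 \<epsilon>2 (x i)"] by auto
    have "1 \<le> 1 / q * Q" using qQ q by simp
    moreover have "real N \<le> B * Q" by (rule bound) (erule N(2))
    ultimately have N1: "real (N + 1) \<le> (B + 1 / q) * Q"
      by (simp only: distrib_right of_nat_add of_nat_1)
    also have "\<dots> \<le> C * Q" using C(2) Q by (intro mult_right_mono) simp_all
    finally have iter: "real (N + 1) \<le> C * Q" .
    have "real (length (rar_queries R p x v N)) \<le> real ((p + 2) * (N + 1))"
      using rar_queries_length by (rule of_nat_mono)
    also have "\<dots> = (real p + 2) * real (N + 1)" by (simp add: algebra_simps)
    also have "\<dots> \<le> (real p + 2) * ((B + 1 / q) * Q)" using N1 by (intro mult_left_mono) simp_all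
    also have "\<dots> = C * Q" by (simp add: C_def)
    finally have queries: "real (length (rar_queries R p x v N)) \<le> C * Q" .
    show "\<exists>N. second_order_stationary M f \<epsilon>1 \<epsilon>2 (x N) \<and>
           (\<forall>i<N. \<not> second_order_stationary M f \<epsilon>1 \<epsilon>2 (x i)) \<and>
           real (N + 1) \<le> C * max ((L1 / \<epsilon>1) powr ((real p + 1) / real p))
                                  ((L2 / \<epsilon>2) powr ((real p + 1) / (real p - 1))) \<and>
           real (length (rar_queries R p x v N))
             \<le> C * max ((L1 / \<epsilon>1) powr ((real p + 1) / real p))
                       ((L2 / \<epsilon>2) powr ((real p + 1) / (real p - 1)))"
      using N iter queries unfolding Q_def a1_def a2_def by blast
  qed
qed

end
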